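(* Let $n\ge1$, let $g$ be a Ricci-flat Kähler metric on $\mathbb{C}^n$, let $\varphi:\mathbb{C}^n\to\mathbb{R}$ be its Kähler potential, and let $\mu_g$ be the measure induced by $g$. Let $B_1$ be the unit ball of $\mathbb{C}^n$ and $|B_1|$ its Lebesgue measure. Suppose that $\mu_g$ is comparable with Lebesgue measure, i.e. there is a constant $C>0$ with $$C^{-1}dx\le\mu_g\le C\,dx ,$$ and that $$\varphi(x)=\left(\frac{\mu_g(B_1)}{|B_1|}\right)^{1/n}\frac{|x|^2}{2}+o(|x|^2)\quad\text{as }x\to\infty .$$ Then $\left(\dfrac{|B_1|}{\mu_g(B_1)}\right)^{1/n}g$ is the Euclidean metric.
   Context: $\mathbb{C}^n$ is identified with $\mathbb{R}^{2n}$ and carries its standard complex structure; $dx$ is Lebesgue measure and $|x|$ the Euclidean norm. Normalization: $\varphi$ is a smooth strictly plurisubharmonic function on $\mathbb{C}^n$ such that $g$ is the Kähler metric with Kähler form $i\partial\bar\partial\varphi$, normalized so that $\varphi=|x|^2/2$ is a Kähler potential of the Euclidean metric; i.e. as a Riemannian metric on $\mathbb{R}^{2n}$ (coordinates $(\operatorname{Re}z,\operatorname{Im}z)$), $g$ has matrix $\frac12\left(D^2\varphi+J^TD^2\varphi\,J\right)$, where $D^2\varphi$ is the real Hessian and $J=\begin{pmatrix}0&-I_n\\ I_n&0\end{pmatrix}$. The induced measure is the Riemannian volume measure $\mu_g=(i\partial\bar\partial\varphi)^n=\det\left(2\varphi_{z_i\bar z_k}\right)dx$, where $\varphi_{z_i\bar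 z_k}=\partial^2\varphi/\partial z_i\partial\bar z_k$. *)

theory Defs
  imports "HOL-Analysis.Analysis" "HOL-Library.Landau_Symbols"
begin

definition dir_deriv ::
    "'a::real_normed_vector \<Rightarrow> ('a \<Rightarrow> 'b::real_normed_vector) \<Rightarrow> 'a \<Rightarrow> 'b" where
  "dir_deriv v f x = frechet_derivative f (at x) v"

fun iter_deriv ::
    "'a::real_normed_vector list \<Rightarrow> ('a \<Rightarrow> 'b::real_normed_vector) \<Rightarrow> 'a \<Rightarrow> 'b" where
  "iter_deriv [] f = f"
| "iter_deriv (v # vs) f = dir_deriv v (iter_deriv vs f)"

(* C^infinity on the whole (finite-dimensional) space: every iterated directional derivative
   is Frechet differentiable everywhere, hence in particular continuous. *)
definition smooth :: "('a::euclidean_space \<Rightarrow> 'b::real_normed_vector) \<Rightarrow> bool" where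
  "smooth f \<longleftrightarrow> (\<forall>vs x. iter_deriv vs f differentiable (at x))"

(* The real coordinates (Re z, Im z) on C^n = R^{2n} are indexed by 'n + 'n:
   Inl j stands for Re z_j and Inr j for Im z_j. *)
primrec coord_vec :: "'n::finite + 'n \<Rightarrow> complex ^ 'n" where
  "coord_vec (Inl j) = axis j 1"
| "coord_vec (Inr j) = axis j \<i>"

definition coord_deriv ::
    "'n::finite + 'n \<Rightarrow> (complex ^ 'n \<Rightarrow> 'b::real_normed_vector) \<Rightarrow> complex ^ 'n \<Rightarrow> 'b" where
  "coord_deriv a = dir_deriv (coord_vec a)"

definition wirtinger ::
    "'n::finite \<Rightarrow> (complex ^ 'n \<Rightarrow> complex) \<Rightarrow> complex ^ 'n \<Rightarrow> complex" where
  "wirtinger j f x = (coord_deriv (Inl j) f x - \<i> * coord_deriv (Inr j) f x) / 2"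

definition wirtinger_bar ::
    "'n::finite \<Rightarrow> (complex ^ 'n \<Rightarrow> complex) \<Rightarrow> complex ^ 'n \<Rightarrow> complex" where
  "wirtinger_bar j f x = (coord_deriv (Inl j) f x + \<i> * coord_deriv (Inr j) f x) / 2"

definition complex_hessian ::
    "(complex ^ 'n::finite \<Rightarrow> real) \<Rightarrow> complex ^ 'n \<Rightarrow> complex ^ 'n ^ 'n" where
  "complex_hessian \<phi> x =
     (\<chi> j k. wirtinger j (wirtinger_bar k (\<lambda>y. complex_of_real (\<phi> y))) x)"

(* For smooth functions only. The Levi form is real since the complex Hessian is Hermitian;
   Re serves to state its positivity in the reals. *)
definition strictly_psh :: "(complex ^ 'n::finite \<Rightarrow> real) \<Rightarrow> bool" where
  "strictly_psh \<phi> \<longleftrightarrow>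
     (\<forall>x w. w \<noteq> 0 \<longrightarrow>
        0 < Re (\<Sum>j\<in>UNIV. \<Sum>k\<in>UNIV. complex_hessian \<phi> x $ j $ k * w $ j * cnj (w $ k)))"

definition real_hessian ::
    "(complex ^ 'n::finite \<Rightarrow> real) \<Rightarrow> complex ^ 'n \<Rightarrow> real ^ ('n + 'n) ^ ('n + 'n)" where
  "real_hessian \<phi> x = (\<chi> a b. coord_deriv a (coord_deriv b \<phi>) x)"

(* The block matrix (0, -I; I, 0), i.e. multiplication by the imaginary unit. *)
definition cstruct :: "real ^ ('n::finite + 'n) ^ ('n + 'n)" where
  "cstruct = (\<chi> a b. case (a, b) of
       (Inl j, Inr k) \<Rightarrow> if j = k then -1 else 0
     | (Inr j, Inl k) \<Rightarrow> if j = k then 1 else 0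
     | _ \<Rightarrow> 0)"

(* A metric is given by its matrix in the real coordinates. The form i ddbar phi is the
   Kaehler form of the metric (D^2 phi + J^T D^2 phi J) / 2, so |z|^2 / 2 is a potential of the
   Euclidean metric; strict plurisubharmonicity says that this matrix is positive definite. *)
definition kaehler_potential ::
    "(complex ^ 'n::finite \<Rightarrow> real) \<Rightarrow> (complex ^ 'n \<Rightarrow> real ^ ('n + 'n) ^ ('n + 'n)) \<Rightarrow> bool" where
  "kaehler_potential \<phi> g \<longleftrightarrow> smooth \<phi> \<and> strictly_psh \<phi> \<and>
     (\<forall>x. g x = (1/2) *\<^sub>R (real_hessian \<phi> x + transpose cstruct ** real_hessian \<phi> x ** cstruct))"

(* christoffel g c a b = Gamma^c_{ab} *)
definition christoffel ::
    "(complex ^ 'n::finite \<Rightarrow> real ^ ('n + 'n) ^ ('n + 'n)) \<Rightarrow>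
     'n + 'n \<Rightarrow> 'n + 'n \<Rightarrow> 'n + 'n \<Rightarrow> complex ^ 'n \<Rightarrow> real" where
  "christoffel g c a b x = (1/2) * (\<Sum>d\<in>UNIV. matrix_inv (g x) $ c $ d *
     (coord_deriv a (\<lambda>y. g y $ b $ d) x + coord_deriv b (\<lambda>y. g y $ a $ d) x
      - coord_deriv d (\<lambda>y. g y $ a $ b) x))"

(* riemann_curv g d c a b is the d-th component of R(e_a, e_b) e_c, where
   R(X, Y) Z = nabla_X nabla_Y Z - nabla_Y nabla_X Z - nabla_[X,Y] Z. *)
definition riemann_curv ::
    "(complex ^ 'n::finite \<Rightarrow> real ^ ('n + 'n) ^ ('n + 'n)) \<Rightarrow>
     'n + 'n \<Rightarrow> 'n + 'n \<Rightarrow> 'n + 'n \<Rightarrow> 'n + 'n \<Rightarrow> complex ^ 'n \<Rightarrow> real" where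
  "riemann_curv g d c a b x =
     coord_deriv a (christoffel g d b c) x - coord_deriv b (christoffel g d a c) x
     + (\<Sum>e\<in>UNIV. christoffel g d a e x * christoffel g e b c x
                - christoffel g d b e x * christoffel g e a c x)"

definition ricci ::
    "(complex ^ 'n::finite \<Rightarrow> real ^ ('n + 'n) ^ ('n + 'n)) \<Rightarrow>
     complex ^ 'n \<Rightarrow> real ^ ('n + 'n) ^ ('n + 'n)" where
  "ricci g x = (\<chi> c b. \<Sum>a\<in>UNIV. riemann_curv g a c a b x)"

definition ricci_flat ::
    "(complex ^ 'n::finite \<Rightarrow> real ^ ('n + 'n) ^ ('n + 'n)) \<Rightarrow> bool" where
  "ricci_flat g \<longleftrightarrow> (\<forall>x. ricci g x = 0)"

(* If g has Kaehler potential phi, the density equals det (2 * phi_{z_j zbar_k}). *)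
definition riemannian_volume ::
    "(complex ^ 'n::finite \<Rightarrow> real ^ ('n + 'n) ^ ('n + 'n)) \<Rightarrow> (complex ^ 'n) measure" where
  "riemannian_volume g = density lborel (\<lambda>x. ennreal (sqrt (det (g x))))"

end

theory Submission
  imports Defs "HOL-Complex_Analysis.Complex_Analysis"
begin

text \<open>
  The Ricci curvature of a Kaehler metric is minus half the \<open>J\<close>-invariant part of the Hessian of
  \<open>ln (det g)\<close>, so for a Ricci-flat metric \<open>ln (det g)\<close> is pluriharmonic; being bounded, it is constant.
  After rescaling, \<open>det g = 1\<close> and \<open>\<phi> = |x|\<^sup>2 / 2 + v\<close> with \<open>v = o(|x|\<^sup>2)\<close>.

  Let \<open>L\<close> be the Laplacian of \<open>g\<close>, let \<open>Cv\<close> be the mean of \<open>v\<close> over the circle of radius \<open>|e|\<close> in the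
  complex line through \<open>x\<close> in direction \<open>e\<close>, and let \<open>Tv\<close> be the mean over the disc weighted by the
  Green function. Since translates of \<open>\<phi>\<close> solve the same Monge-Ampere equation, the inequality between
  trace and determinant gives \<open>L (C\<phi> - \<phi>) \<ge> 0\<close>. Green's formula says that \<open>Cv - v\<close> is half the \<open>T\<close>-mean
  of the Levi form of \<open>v\<close> in direction \<open>e\<close>. So where \<open>Cv - v \<ge> \<delta>\<close>, some of the metrics averaged
  by \<open>T\<close> are not Euclidean, and the small function \<open>Tv - 2v = o(|x|\<^sup>2)\<close> satisfies
  \<open>L (Tv - 2v) \<ge> c tr\<^sub>g (Euclidean metric)\<close> with \<open>c\<close> depending only on \<open>n\<close>, \<open>|e|\<close> and \<open>\<delta>\<close>. This is exactly
  what absorbs the error of a cut-off function, so the maximum principle applied to a cut-off of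
  \<open>(Cv - v - \<delta>)\<^sub>+\<^sup>2\<close> plus a multiple of \<open>Tv - 2v\<close> bounds \<open>(Cv - v - \<delta>)\<^sub>+\<close> on a ball by a small multiple of its bound on the
  concentric ball of twice the radius. Iterating, \<open>Cv \<le> v\<close>, hence \<open>g\<close> is at most the Euclidean metric,
  and \<open>det g = 1\<close> forces equality. No a priori bound on the Hessian of \<open>\<phi>\<close> is needed.
\<close>

section \<open>Positive definite matrices\<close>

definition posdef :: "real ^ 'n::finite ^ 'n \<Rightarrow> bool" where
  "posdef A \<longleftrightarrow> transpose A = A \<and> (\<forall>x. x \<noteq> 0 \<longrightarrow> 0 < x \<bullet> (A *v x))"

text \<open>A maximiser \<open>b\<close> of the quadratic form on the unit sphere of
  \<open>S\<close> is an eigenvector: moving \<open>b\<close> along \<open>y = l b - f b\<close>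
  changes the form to first order by a multiple of \<open>|y|^2\<close>, and maximality forces
  \<open>y = 0\<close>.\<close>

lemma self_adjoint_eigenvector:
  fixes f :: "'a::euclidean_space \<Rightarrow> 'a"
  assumes f: "linear f" and sym: "\<And>x y. f x \<bullet> y = x \<bullet> f y"
    and S: "subspace S" "S \<noteq> {0}" "f ` S \<subseteq> S"
  obtains b l where "b \<in> S" "norm b = 1" "f b = l *\<^sub>R b"
proof -
  interpret linear f by fact
  let ?K = "S \<inter> sphere 0 1"
  obtain z where z: "z \<in> S" "z \<noteq> 0"
    using S subspace_0 by blast
  have "(1 / norm z) *\<^sub>R z \<in> ?K"
    using z S by (simp add: subspace_scale)
  then have ne: "?K \<noteq> {}"
    by blast
  have cpt: "compact ?K"
    using closed_subspace[OF S(1)] by (simp add: closed_Int_compact)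
  have cont: "continuous_on ?K (\<lambda>x. x \<bullet> f x)"
    by (intro continuous_intros linear_continuous_on linear_conv_bounded_linear[THEN iffD1] f)
  obtain b where b: "b \<in> ?K" "\<And>x. x \<in> ?K \<Longrightarrow> x \<bullet> f x \<le> b \<bullet> f b"
    using continuous_attains_sup[OF cpt ne cont] by blast
  define l where "l = b \<bullet> f b"
  have bS: "b \<in> S" and nb: "norm b = 1" and bb: "b \<bullet> b = 1"
    using b by (auto simp: norm_eq_1)
  have le: "x \<bullet> f x \<le> l * (x \<bullet> x)" if "x \<in> S" for x
  proof (cases "x = 0")
    case False
    have "(1 / norm x) *\<^sub>R x \<in> ?K"
      using that False S by (simp add: subspace_scale)
    then have "((1 / norm x) *\<^sub>R x) \<bullet> f ((1 / norm x) *\<^sub>R x) \<le> l"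
      using b unfolding l_def by blast
    then have "(x \<bullet> f x) / (norm x)\<^sup>2 \<le> l"
      by (simp add: scale power2_eq_square)
    then show ?thesis
      using False by (simp add: divide_le_eq dot_square_norm)
  qed (simp add: scale zero)
  define y where "y = l *\<^sub>R b - f b"
  have yS: "y \<in> S"
    unfolding y_def using S bS by (intro subspace_diff subspace_scale) auto
  have "0 \<le> 2 * t * (y \<bullet> y) + t\<^sup>2 * (l * (y \<bullet> y) - y \<bullet> f y)" for t
  proof -
    have "b + t *\<^sub>R y \<in> S"
      using S bS yS by (intro subspace_add subspace_scale)
    from le[OF this] have "0 \<le> l * ((b + t *\<^sub>R y) \<bullet> (b + t *\<^sub>R y)) - (b + t *\<^sub>R y) \<bullet> f (b + t *\<^sub>R y)"
      by simp
    also have "\<dots> = (l - b \<bullet> f b) + 2 * t * (l * (b \<bullet> y) - f b \<bullet> y) + t\<^sup>2 * (l * (y \<bullet> y) - y \<bullet> f y)"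
      using sym[of b y] bb
      by (simp add: add scale inner_add_left inner_add_right power2_eq_square inner_commute[of y b] algebra_simps)
        (simp add: inner_commute sym)
    also have "l * (b \<bullet> y) - f b \<bullet> y = y \<bullet> y"
      by (simp add: y_def inner_diff_left inner_diff_right inner_commute[of "f b" b])
    finally show ?thesis
      by (simp add: l_def)
  qed
  note quad = this
  have "y \<bullet> y = 0"
  proof (rule ccontr)
    assume "y \<bullet> y \<noteq> 0"
    then have p: "y \<bullet> y > 0" by (simp add: order_less_le)
    define c where "c = l * (y \<bullet> y) - y \<bullet> f y"
    \<comment> \<open>Negative, and so small that the quadratic term is at most half as large as the
      linear one; the whole expression is then at most \<open>t * (y \<bullet> y)\<close>, which is
      negative.\<close>
    define t where "t = - (y \<bullet> y) / (\<bar>c\<bar> + 1)"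
    have "t\<^sup>2 * c \<le> t\<^sup>2 * (\<bar>c\<bar> + 1)"
      by (intro mult_left_mono) auto
    also have "\<dots> = t * (t * (\<bar>c\<bar> + 1))"
      by (simp add: power2_eq_square)
    also have "t * (\<bar>c\<bar> + 1) = - (y \<bullet> y)"
      unfolding t_def by (simp add: add_pos_nonneg less_imp_neq[THEN not_sym])
    finally have "2 * t * (y \<bullet> y) + t\<^sup>2 * c \<le> t * (y \<bullet> y)"
      by simp
    moreover have "t < 0" using p by (simp add: t_def divide_neg_pos)
    ultimately show False
      using quad[of t] p unfolding c_def by (smt (verit) mult_neg_pos)
  qed
  then have "f b = l *\<^sub>R b"
    by (simp add: y_def)
  then show thesis
    using that bS nb by blast
qed

text \<open>Induction on the dimension: after splitting off a unit eigenvector \<open>b\<close>, the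
  vectors of \<open>S\<close> orthogonal to \<open>b\<close> again form an invariant subspace
  because \<open>f\<close> is self-adjoint.\<close>

lemma self_adjoint_orthonormal_eigenbasis:
  fixes f :: "'a::euclidean_space \<Rightarrow> 'a"
  assumes f: "linear f" and sym: "\<And>x y. f x \<bullet> y = x \<bullet> f y"
    and "subspace S" "f ` S \<subseteq> S"
  shows "\<exists>B. B \<subseteq> S \<and> finite B \<and> pairwise orthogonal B \<and> (\<forall>b\<in>B. norm b = 1 \<and> (\<exists>l. f b = l *\<^sub>R b))
           \<and> span B = S"
  using assms(3,4)
proof (induction "dim S" arbitrary: S rule: less_induct)
  case less
  show ?case
  proof (cases "S = {0}")
    case True
    then show ?thesis by (intro exI[of _ "{}"]) auto
  next
    case False
    obtain b l where b: "b \<in> S" "norm b = 1" "f b = l *\<^sub>R b"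
      using self_adjoint_eigenvector[OF f sym less.prems(1) False less.prems(2)] by blast
    have bb: "b \<bullet> b = 1" using b by (simp add: norm_eq_1)
    define T where "T = S \<inter> {x. b \<bullet> x = 0}"
    have T: "subspace T"
      unfolding T_def using less.prems subspace_hyperplane by (intro subspace_inter)
    have fT: "f ` T \<subseteq> T"
    proof
      fix y assume "y \<in> f ` T"
      then obtain x where x: "x \<in> S" "b \<bullet> x = 0" "y = f x" by (auto simp: T_def)
      have "b \<bullet> f x = f b \<bullet> x" by (simp add: sym)
      then show "y \<in> T" using x b less.prems by (auto simp: T_def)
    qed
    have "b \<notin> T" using bb by (simp add: T_def)
    then have "T \<subset> S" using b(1) unfolding T_def by blast
    moreover have "span S = S" "span T = T"
      using T less.prems by (auto simp: span_eq_iff)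
    ultimately have "dim T < dim S"
      by (metis dim_psubset)
    from less.hyps[OF this T fT] obtain B where B: "B \<subseteq> T" "finite B" "pairwise orthogonal B"
      "\<forall>b\<in>B. norm b = 1 \<and> (\<exists>l. f b = l *\<^sub>R b)" "span B = T" by blast
    have "span (insert b B) = S"
    proof
      show "span (insert b B) \<subseteq> S"
        using B b less.prems(1) by (intro span_minimal) (auto simp: T_def)
      show "S \<subseteq> span (insert b B)"
      proof
        fix x assume "x \<in> S"
        then have "x - (b \<bullet> x) *\<^sub>R b \<in> T"
          using b bb less.prems(1) by (auto simp: T_def inner_diff_right subspace_diff subspace_scale)
        then show "x \<in> span (insert b B)"
          using B(5) span_breakdown_eq by blast
      qed
    qed
    moreover have "pairwise orthogonal (insert b B)"
      using B(1,3) by (auto simp: pairwise_insert T_def orthogonal_def inner_commute)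
    ultimately show ?thesis
      using B b by (intro exI[of _ "insert b B"]) (auto simp: T_def)
  qed
qed

abbreviation diag_matrix :: "('n::finite \<Rightarrow> real) \<Rightarrow> real ^ 'n ^ 'n" where
  "diag_matrix c \<equiv> (\<chi> i j. if i = j then c i else 0)"

lemma symmetric_matrix_diagonalizable:
  fixes A :: "real ^ 'n::finite ^ 'n"
  assumes A: "transpose A = A"
  obtains Q d where "orthogonal_matrix Q" "transpose Q ** A ** Q = diag_matrix d"
proof -
  have sym: "(A *v x) \<bullet> y = x \<bullet> (A *v y)" for x y
    by (metis A dot_lmul_matrix transpose_matrix_vector)
  obtain B where B: "finite B" "pairwise orthogonal B"
      "\<forall>b\<in>B. norm b = 1 \<and> (\<exists>l. A *v b = l *\<^sub>R b)" "span B = (UNIV :: (real^'n) set)"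
    using self_adjoint_orthonormal_eigenbasis[of "(*v) A" UNIV] sym matrix_vector_mul_linear[of A] by auto
  have "0 \<notin> B" using B(3) by auto
  then have "independent B" using B(2) pairwise_orthogonal_independent by blast
  then have "card B = CARD('n)"
    using B(4) by (metis dim_UNIV dim_span dim_eq_card_independent DIM_cart DIM_real mult.right_neutral)
  then obtain b where b: "bij_betw b (UNIV::'n set) B"
    using B(1) by (metis finite_class.finite_UNIV finite_same_card_bij)
  have bB: "b i \<in> B" for i using b bij_betwE by blast
  have "\<forall>i. \<exists>l. A *v b i = l *\<^sub>R b i"
    using B(3) bB by blast
  then obtain d where d: "\<And>i. A *v b i = d i *\<^sub>R b i"
    by (auto dest!: choice)
  have orth: "b i \<bullet> b j = (if i = j then 1 else 0)" for i j
  proof (cases "i = j")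
    case False
    then have "b i \<noteq> b j" using b by (meson UNIV_I bij_betw_def inj_on_def)
    then show ?thesis using False B(2) bB by (auto simp: pairwise_def orthogonal_def)
  qed (use B(3) bB in \<open>metis norm_eq_1\<close>)
  define Q where "Q = (\<chi> i j. b j $ i)"
  have col: "column j Q = b j" for j by (simp add: Q_def column_def vec_eq_iff)
  have "orthogonal_matrix Q"
    by (simp add: orthogonal_matrix_orthonormal_columns col norm_eq_1 orth orthogonal_def)
  moreover have "(transpose Q ** A ** Q) $ i $ j = (if i = j then d i else 0)" for i j
  proof -
    have "(transpose Q ** A ** Q) $ i $ j = b i \<bullet> (A *v b j)"
      unfolding matrix_mul_assoc[symmetric]
      by (simp add: matrix_matrix_mult_def matrix_vector_mult_def inner_vec_def Q_def transpose_def)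
    then show ?thesis by (simp add: d orth)
  qed
  ultimately show thesis
    using that[of Q d] by (simp add: vec_eq_iff)
qed

lemma quadratic_form_congruence:
  fixes A W :: "real ^ 'n::finite ^ 'n"
  shows "x \<bullet> ((transpose W ** A ** W) *v x) = (W *v x) \<bullet> (A *v (W *v x))"
proof -
  have "(W *v x) \<bullet> y = x \<bullet> (transpose W *v y)" for y
    by (metis dot_lmul_matrix transpose_matrix_vector transpose_transpose)
  then show ?thesis
    by (simp add: matrix_vector_mul_assoc[symmetric] del: transpose_matrix_vector)
qed

lemma posdef_congruence:
  fixes A W :: "real ^ 'n::finite ^ 'n"
  assumes "posdef A" "invertible W"
  shows "posdef (transpose W ** A ** W)"
  unfolding posdef_def
proof (intro conjI allI impI)
  have "transpose A = A" using assms(1) by (simp add: posdef_def)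
  then show "transpose (transpose W ** A ** W) = transpose W ** A ** W"
    by (metis matrix_mul_assoc matrix_transpose_mul transpose_transpose)
next
  fix x :: "real^'n" assume "x \<noteq> 0"
  then have "W *v x \<noteq> 0"
    using assms(2) by (metis invertible_def matrix_left_invertible_ker)
  then show "0 < x \<bullet> ((transpose W ** A ** W) *v x)"
    using assms(1) unfolding quadratic_form_congruence by (simp add: posdef_def)
qed

lemma det_diag_matrix: "det (diag_matrix c) = (\<Prod>i\<in>UNIV. c i)"
  by (subst det_diagonal) auto

lemma diag_congruence:
  "transpose (diag_matrix c) ** A ** diag_matrix c = (\<chi> i j. c i * A $ i $ j * c j)"
proof -
  have *: "(\<Sum>k\<in>UNIV. (if k = i then c k else 0) * A $ k $ j) = c i * A $ i $ j" for i j
    by (simp add: mult_delta_left)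
  show ?thesis
    by (simp add: vec_eq_iff matrix_matrix_mult_def transpose_def mult_delta_right *)
qed

lemma diag_entry_eq: "(A::real^'n::finite^'n) $ i $ j = axis i 1 \<bullet> (A *v axis j 1)"
  by (simp add: matrix_vector_mult_basis inner_axis') (simp add: column_def)

lemma posdef_diagonalizable:
  fixes A :: "real ^ 'n::finite ^ 'n"
  assumes "posdef A"
  obtains Q d where "orthogonal_matrix Q" "\<And>i. 0 < d i"
    "transpose Q ** A ** Q = diag_matrix d"
proof -
  obtain Q d where Q: "orthogonal_matrix Q" "transpose Q ** A ** Q = diag_matrix d"
    using assms symmetric_matrix_diagonalizable[of A] unfolding posdef_def by blast
  have "invertible Q"
    using Q(1) by (auto simp: orthogonal_matrix_def invertible_def)
  then have "posdef (transpose Q ** A ** Q)"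
    using assms posdef_congruence by blast
  moreover have "axis i 1 \<noteq> (0::real^'n)" for i by (simp add: axis_eq_0_iff)
  ultimately have "0 < (transpose Q ** A ** Q) $ i $ i" for i
    unfolding posdef_def diag_entry_eq by blast
  then have "0 < d i" for i by (simp add: Q(2))
  then show thesis using that Q by blast
qed

lemma posdef_det_pos: assumes "posdef A" shows "0 < det A"
proof -
  obtain Q d where Q: "orthogonal_matrix Q" "\<And>i. 0 < d i"
    "transpose Q ** A ** Q = diag_matrix d"
    using posdef_diagonalizable[OF assms] by blast
  have "det (transpose Q ** A ** Q) = det A"
    using det_orthogonal_matrix[OF Q(1)] by (auto simp: det_mul)
  moreover have "det (transpose Q ** A ** Q) = (\<Prod>i\<in>UNIV. d i)"
    unfolding Q(3) by (rule det_diag_matrix)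
  ultimately show ?thesis using Q(2) by (metis prod_pos)
qed

text \<open>The inequality between arithmetic and geometric mean, applied to the
  eigenvalues.\<close>

lemma posdef_trace_ge_det:
  fixes A :: "real ^ 'n::finite ^ 'n"
  assumes "posdef A"
  shows "real CARD('n) * det A powr (1 / CARD('n)) \<le> trace A"
proof -
  obtain Q d where Q: "orthogonal_matrix Q" "\<And>i. 0 < d i"
    "transpose Q ** A ** Q = diag_matrix d"
    using posdef_diagonalizable[OF assms] by blast
  have "det (transpose Q ** A ** Q) = det A"
    using det_orthogonal_matrix[OF Q(1)] by (auto simp: det_mul)
  moreover have "det (transpose Q ** A ** Q) = (\<Prod>i\<in>UNIV. d i)"
    unfolding Q(3) by (rule det_diag_matrix)
  moreover have "trace (transpose Q ** A ** Q) = trace A"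
    using Q(1) by (subst trace_mul_sym) (simp add: matrix_mul_assoc orthogonal_matrix_def)
  moreover have "trace (transpose Q ** A ** Q) = (\<Sum>i\<in>UNIV. d i)"
    unfolding Q(3) by (simp add: trace_def)
  moreover have "(\<Prod>i\<in>UNIV. d i) powr (1 / CARD('n)) \<le> (\<Sum>i\<in>UNIV. d i / CARD('n))"
    using Q(2) by (intro arith_geom_mean) (auto simp: less_imp_le)
  ultimately show ?thesis
    by (simp add: sum_divide_distrib[symmetric] field_simps)
qed

text \<open>After an orthogonal diagonalisation, each axis is rescaled by the inverse square root of
  its eigenvalue.\<close>

lemma posdef_congruent_mat_1:
  fixes A :: "real ^ 'n::finite ^ 'n"
  assumes "posdef A"
  obtains W :: "real ^ 'n ^ 'n" where "invertible W" "transpose W ** A ** W = mat 1"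
proof -
  obtain Q d where Q: "orthogonal_matrix Q" "\<And>i. 0 < d i"
    "transpose Q ** A ** Q = diag_matrix d"
    using posdef_diagonalizable[OF assms] by blast
  define D where "D = diag_matrix (\<lambda>i. 1 / sqrt (d i))"
  have "transpose (Q ** D) ** A ** (Q ** D) = transpose D ** (transpose Q ** A ** Q) ** D"
    by (simp only: matrix_transpose_mul matrix_mul_assoc)
  also have "\<dots> = mat 1"
  proof -
    have "1 / sqrt (d i) * d i * (1 / sqrt (d i)) = 1" for i
      using Q(2)[of i] by (simp add: field_simps)
    then show ?thesis
      unfolding D_def diag_congruence Q(3) by (simp add: vec_eq_iff mat_def)
  qed
  finally have *: "transpose (Q ** D) ** A ** (Q ** D) = mat 1" .
  then have "invertible (Q ** D)"
    using matrix_left_right_inverse unfolding invertible_def by blast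
  then show thesis using * by (rule that)
qed

text \<open>\<open>w\<close> is a \<open>P\<close>-orthonormal basis that contains the normalised
  \<open>e\<close>. Scaling that one vector by \<open>sqrt k\<close> multiplies the determinant of
  the matrix of \<open>B\<close> by \<open>k\<close> and changes a single term of its trace, so the
  trace-determinant inequality acquires a term that sees \<open>B\<close> in direction
  \<open>e\<close>. One basis serves all \<open>B\<close> and \<open>k\<close>, which later permits
  averaging over \<open>B\<close>.\<close>

lemma posdef_frame:
  fixes P :: "real ^ 'n::finite ^ 'n"
  assumes P: "posdef P" "det P = 1" and e: "e \<noteq> 0"
  obtains w :: "'n \<Rightarrow> real ^ 'n" where
    "\<And>a. w a \<bullet> (P *v w a) = 1"
    "\<And>B k. posdef B \<Longrightarrow> det B = 1 \<Longrightarrow> 0 < k \<Longrightarrow>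
      real CARD('n) * k powr (1 / CARD('n)) + (1 - k) * ((e \<bullet> (B *v e)) / (e \<bullet> (P *v e)))
        \<le> (\<Sum>a\<in>UNIV. w a \<bullet> (B *v w a))"
proof -
  obtain W0 :: "real ^ 'n ^ 'n" where W0: "invertible W0" "transpose W0 ** P ** W0 = mat 1"
    using posdef_congruent_mat_1[OF P(1)] by blast
  obtain Wi where Wi: "W0 ** Wi = mat 1" "Wi ** W0 = mat 1"
    using W0(1) unfolding invertible_def by blast
  define f where "f = Wi *v e"
  have ef: "e = W0 *v f" by (simp add: f_def matrix_vector_mul_assoc Wi)
  have "f \<noteq> 0" using e ef by auto
  have nf: "e \<bullet> (P *v e) = (norm f)\<^sup>2"
    using quadratic_form_congruence[of f W0 P] by (simp add: W0 ef[symmetric] dot_square_norm)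
  fix k0 :: 'n
  \<comment> \<open>In the coordinates given by \<open>W0\<close> the form \<open>P\<close> is
    Euclidean, so an orthogonal matrix can carry the axis \<open>k0\<close> to the direction of
    \<open>e\<close>.\<close>
  obtain Q where Q: "orthogonal_matrix Q" "Q *v axis k0 1 = (1 / norm f) *\<^sub>R f"
    using orthogonal_matrix_exists_basis[of "(1 / norm f) *\<^sub>R f" k0] \<open>f \<noteq> 0\<close> by auto
  have invQ: "invertible Q"
    using Q(1) by (auto simp: orthogonal_matrix_def invertible_def)
  define W where "W = W0 ** Q"
  define w where "w a = W *v axis a 1" for a
  have invW: "invertible W"
    unfolding W_def using W0(1) invQ by (rule invertible_mult)
  have "transpose W ** P ** W = transpose Q ** (transpose W0 ** P ** W0) ** Q"
    unfolding W_def by (simp only: matrix_transpose_mul matrix_mul_assoc)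
  also have "\<dots> = mat 1"
    using Q(1) by (simp add: W0 orthogonal_matrix_def)
  finally have WP: "transpose W ** P ** W = mat 1" .
  have entry: "(transpose W ** B ** W) $ a $ a = w a \<bullet> (B *v w a)" for B a
    unfolding diag_entry_eq quadratic_form_congruence w_def ..
  have wk: "w k0 = (1 / norm f) *\<^sub>R e"
    unfolding w_def W_def by (simp add: matrix_vector_mul_assoc[symmetric] Q ef matrix_vector_mult_scaleR)
  show thesis
  proof (rule that[of w])
    show "w a \<bullet> (P *v w a) = 1" for a
      unfolding entry[symmetric] WP by (simp add: mat_def)
    fix B :: "real^'n^'n" and k :: real
    assume B: "posdef B" "det B = 1" and k: "0 < k"
    define c where "c a = (if a = k0 then sqrt k else 1)" for a
    define C where "C = transpose W ** B ** W"
    define r where "r = (e \<bullet> (B *v e)) / (e \<bullet> (P *v e))"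
    have cpos: "0 < c a" for a using k by (simp add: c_def)
    have pC: "posdef C" unfolding C_def using B invW by (intro posdef_congruence)
    have "det (diag_matrix c) \<noteq> 0"
      unfolding det_diag_matrix using cpos by (simp add: less_imp_neq[THEN not_sym])
    then have pD: "posdef (transpose (diag_matrix c) ** C ** diag_matrix c)"
      using pC by (intro posdef_congruence) (auto simp: invertible_det_nz)
    have "det W * det W = 1"
      using arg_cong[OF WP, of det] by (simp add: det_mul P)
    then have dC: "det C = 1"
      unfolding C_def by (simp add: det_mul B)
    have "(\<Prod>a\<in>UNIV. c a) = sqrt k"
      unfolding c_def by (simp add: prod.delta)
    then have det: "det (transpose (diag_matrix c) ** C ** diag_matrix c) = k"
      using k by (simp add: det_mul dC det_diag_matrix)
    have "trace (transpose (diag_matrix c) ** C ** diag_matrix c) = (\<Sum>a\<in>UNIV. c a * C $ a $ a * c a)"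
      unfolding diag_congruence by (simp add: trace_def)
    also have "\<dots> = (\<Sum>a\<in>UNIV. C $ a $ a + (if a = k0 then (k - 1) * C $ a $ a else 0))"
      using k by (intro sum.cong) (auto simp: c_def algebra_simps real_sqrt_mult_self)
    also have "\<dots> = (\<Sum>a\<in>UNIV. C $ a $ a) + (k - 1) * C $ k0 $ k0"
      by (simp add: sum.distrib)
    also have "C $ k0 $ k0 = r"
      unfolding C_def entry wk r_def nf by (simp add: matrix_vector_mult_scaleR power2_eq_square)
    finally show "real CARD('n) * k powr (1 / CARD('n)) + (1 - k) * ((e \<bullet> (B *v e)) / (e \<bullet> (P *v e)))
        \<le> (\<Sum>a\<in>UNIV. w a \<bullet> (B *v w a))"
      using posdef_trace_ge_det[OF pD] unfolding det r_def[symmetric]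
      by (simp add: C_def entry algebra_simps)
  qed
qed

section \<open>Calculus of directional derivatives\<close>

lemma dir_deriv_eqI: "(f has_derivative F) (at x) \<Longrightarrow> dir_deriv v f x = F v"
  unfolding dir_deriv_def using frechet_derivative_at by metis

lemma differentiable_has_derivative_dir_deriv:
  "f differentiable (at x) \<Longrightarrow> (f has_derivative (\<lambda>v. dir_deriv v f x)) (at x)"
  unfolding dir_deriv_def using frechet_derivative_works by blast

lemma iter_deriv_append: "iter_deriv (vs @ ws) f = iter_deriv vs (iter_deriv ws f)"
  by (induction vs) auto

lemma smooth_dir_deriv: "smooth f \<Longrightarrow> smooth (dir_deriv v f)"
  unfolding smooth_def by (metis iter_deriv.simps iter_deriv_append)

lemma smooth_differentiable: "smooth f \<Longrightarrow> f differentiable (at x)"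
  unfolding smooth_def by (metis iter_deriv.simps(1))

lemma smooth_has_derivative: "smooth f \<Longrightarrow> (f has_derivative (\<lambda>v. dir_deriv v f x)) (at x)"
  by (simp add: smooth_differentiable differentiable_has_derivative_dir_deriv)

lemma smooth_continuous_on: "smooth f \<Longrightarrow> continuous_on S f"
  by (meson continuous_at_imp_continuous_on differentiable_imp_continuous_within smooth_differentiable)

lemma linear_dir_deriv: "smooth f \<Longrightarrow> linear (\<lambda>v. dir_deriv v f x)"
  using smooth_has_derivative has_derivative_linear by blast

lemma dir_deriv_add: "smooth f \<Longrightarrow> dir_deriv (v + w) f x = dir_deriv v f x + dir_deriv w f x"
  by (rule linear_add[OF linear_dir_deriv])

lemma dir_deriv_scaleR: "smooth f \<Longrightarrow> dir_deriv (c *\<^sub>R v) f x = c *\<^sub>R dir_deriv v f x"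
  by (rule linear_scale[OF linear_dir_deriv])

lemma DERIV_line:
  fixes f :: "'a::euclidean_space \<Rightarrow> real"
  assumes "\<And>y. f differentiable (at y)"
  shows "((\<lambda>t. f (x + t *\<^sub>R w)) has_real_derivative dir_deriv w f (x + t *\<^sub>R w)) (at t within S)"
proof -
  note D = differentiable_has_derivative_dir_deriv[OF assms]
  have "((\<lambda>t. f (x + t *\<^sub>R w)) has_derivative (\<lambda>s. dir_deriv (s *\<^sub>R w) f (x + t *\<^sub>R w))) (at t within S)"
    by (rule has_derivative_compose[of "\<lambda>t. x + t *\<^sub>R w", OF _ D]) (auto intro!: derivative_eq_intros)
  then show ?thesis
    unfolding has_field_derivative_def
    by (simp add: linear_scale[OF has_derivative_linear[OF D]] mult_commute_abs)
qed

text \<open>The mean value theorem along \<open>v\<close> turns the second difference into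
  \<open>h\<close> times a first difference of \<open>dir_deriv v f\<close>, to which
  differentiability at the single point \<open>x\<close> applies.\<close>

lemma second_difference_asymptotics:
  fixes f :: "'a::euclidean_space \<Rightarrow> real"
  assumes f: "\<And>y. f differentiable (at y)" and fv: "dir_deriv v f differentiable (at x)" and e: "0 < e"
  shows "\<exists>d>0. \<forall>h. 0 < h \<longrightarrow> h < d \<longrightarrow>
    \<bar>f (x + h *\<^sub>R v + h *\<^sub>R w) - f (x + h *\<^sub>R v) - f (x + h *\<^sub>R w) + f x - h\<^sup>2 * dir_deriv w (dir_deriv v f) x\<bar>
      \<le> e * h\<^sup>2"
proof -
  let ?A = "\<lambda>u. dir_deriv u (dir_deriv v f) x"
  note D = differentiable_has_derivative_dir_deriv[OF fv]
  \<comment> \<open>The two displacements from \<open>x\<close> that occur below have total length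
    at most \<open>h * (2 * norm v + norm w)\<close>; the extra \<open>1\<close> makes
    \<open>c\<close> positive.\<close>
  define c where "c = 2 * norm v + norm w + 1"
  have c: "c > 0" by (simp add: c_def add_nonneg_pos)
  obtain r where r: "r > 0" "\<And>y. norm (y - x) < r \<Longrightarrow>
      norm (dir_deriv v f y - dir_deriv v f x - ?A (y - x)) \<le> e / c * norm (y - x)"
    using D[unfolded has_derivative_at_alt] e c by (meson divide_pos_pos)
  have r2: "\<bar>dir_deriv v f (x + u) - dir_deriv v f x - ?A u\<bar> \<le> e / c * norm u" if "norm u < r" for u
    using r(2)[of "x + u"] that by simp
  show ?thesis
  proof (intro exI[of _ "r / c"] conjI allI impI)
    show "r / c > 0" using r c by simp
    fix h assume h: "0 < h" "h < r / c"
    let ?g = "\<lambda>t. f (x + h *\<^sub>R w + t *\<^sub>R v) - f (x + t *\<^sub>R v)"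
    obtain s where s: "0 < s" "s < h"
      "?g h - ?g 0 = (h - 0) * (dir_deriv v f (x + h *\<^sub>R w + s *\<^sub>R v) - dir_deriv v f (x + s *\<^sub>R v))"
      using MVT2[of 0 h ?g "\<lambda>t. dir_deriv v f (x + h *\<^sub>R w + t *\<^sub>R v) - dir_deriv v f (x + t *\<^sub>R v)"]
        DERIV_line[OF f] h(1) DERIV_diff by blast
    have n1: "norm (s *\<^sub>R v) \<le> h * norm v"
      using s by (simp add: mult_right_mono)
    have n2: "norm (h *\<^sub>R w + s *\<^sub>R v) \<le> h * (norm w + norm v)"
      using norm_triangle_ineq[of "h *\<^sub>R w" "s *\<^sub>R v"] n1 h(1) by (simp add: distrib_left)
    have hc: "h * c < r" using h c by (simp add: pos_less_divide_eq)
    have le: "h * norm v < h * c" "h * (norm w + norm v) < h * c"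
      using h(1) norm_ge_zero[of v] norm_ge_zero[of w] by (auto simp: c_def intro!: mult_strict_left_mono simp del: norm_ge_zero)
    have A: "?A (h *\<^sub>R w + s *\<^sub>R v) - ?A (s *\<^sub>R v) = h * ?A w"
      using linear_add[OF has_derivative_linear[OF D]] linear_scale[OF has_derivative_linear[OF D]] by simp
    define a b where "a = dir_deriv v f (x + (h *\<^sub>R w + s *\<^sub>R v)) - dir_deriv v f x - ?A (h *\<^sub>R w + s *\<^sub>R v)"
      and "b = dir_deriv v f (x + s *\<^sub>R v) - dir_deriv v f x - ?A (s *\<^sub>R v)"
    have "\<bar>a\<bar> \<le> e / c * norm (h *\<^sub>R w + s *\<^sub>R v)"
      unfolding a_def using n2 le hc by (intro r2) linarith
    moreover have "\<bar>b\<bar> \<le> e / c * norm (s *\<^sub>R v)"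
      unfolding b_def using n1 le hc by (intro r2) linarith
    ultimately have "\<bar>a - b\<bar> \<le> e / c * norm (h *\<^sub>R w + s *\<^sub>R v) + e / c * norm (s *\<^sub>R v)"
      by linarith
    also have "\<dots> \<le> e / c * (h * (norm w + norm v)) + e / c * (h * norm v)"
      using n1 n2 e c by (intro add_mono mult_left_mono) auto
    also have "\<dots> \<le> e / c * (h * c)"
      using e c h(1) by (simp add: c_def algebra_simps flip: add_divide_distrib)
        (simp add: divide_right_mono)
    also have "\<dots> = e * h" using c by simp
    finally have ab: "\<bar>a - b\<bar> \<le> e * h" .
    have "f (x + h *\<^sub>R v + h *\<^sub>R w) - f (x + h *\<^sub>R v) - f (x + h *\<^sub>R w) + f x = ?g h - ?g 0"
      by (simp add: add_ac)
    also have "\<dots> = h * (a - b + h * ?A w)"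
      unfolding s(3) A[symmetric] a_def b_def by (simp add: add_ac)
    finally have "f (x + h *\<^sub>R v + h *\<^sub>R w) - f (x + h *\<^sub>R v) - f (x + h *\<^sub>R w) + f x - h\<^sup>2 * ?A w = h * (a - b)"
      by (simp add: power2_eq_square algebra_simps)
    moreover have "\<bar>h * (a - b)\<bar> \<le> h * (e * h)"
      using ab h(1) by (simp add: abs_mult)
    ultimately show "\<bar>f (x + h *\<^sub>R v + h *\<^sub>R w) - f (x + h *\<^sub>R v) - f (x + h *\<^sub>R w) + f x - h\<^sup>2 * ?A w\<bar> \<le> e * h\<^sup>2"
      by (simp add: power2_eq_square mult_ac)
  qed
qed

text \<open>The second difference is symmetric in \<open>v\<close> and \<open>w\<close>, and both
  mixed derivatives are its limit after division by \<open>h\<^sup>2\<close>. This pointwise form,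
  with hypotheses weaker than \<open>smooth\<close>, is the one applied to
  \<open>log_det\<close>.\<close>

lemma dir_deriv_commute_at:
  fixes f :: "'a::euclidean_space \<Rightarrow> real"
  assumes f: "\<And>y. f differentiable (at y)"
    and fv: "dir_deriv v f differentiable (at x)" and fw: "dir_deriv w f differentiable (at x)"
  shows "dir_deriv v (dir_deriv w f) x = dir_deriv w (dir_deriv v f) x"
proof (rule ccontr)
  let ?a = "dir_deriv w (dir_deriv v f) x" and ?b = "dir_deriv v (dir_deriv w f) x"
  assume "?b \<noteq> ?a"
  define e where "e = \<bar>?a - ?b\<bar> / 3"
  have e: "e > 0" using \<open>?b \<noteq> ?a\<close> by (simp add: e_def)
  obtain d1 where d1: "d1 > 0" "\<And>h. 0 < h \<Longrightarrow> h < d1 \<Longrightarrow>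
    \<bar>f (x + h *\<^sub>R v + h *\<^sub>R w) - f (x + h *\<^sub>R v) - f (x + h *\<^sub>R w) + f x - h\<^sup>2 * ?a\<bar> \<le> e * h\<^sup>2"
    using second_difference_asymptotics[OF f fv e, of w] by blast
  obtain d2 where d2: "d2 > 0" "\<And>h. 0 < h \<Longrightarrow> h < d2 \<Longrightarrow>
    \<bar>f (x + h *\<^sub>R w + h *\<^sub>R v) - f (x + h *\<^sub>R w) - f (x + h *\<^sub>R v) + f x - h\<^sup>2 * ?b\<bar> \<le> e * h\<^sup>2"
    using second_difference_asymptotics[OF f fw e, of v] by blast
  define h where "h = min d1 d2 / 2"
  have h: "0 < h" "h < d1" "h < d2" using d1(1) d2(1) by (auto simp: h_def)
  have "f (x + h *\<^sub>R w + h *\<^sub>R v) = f (x + h *\<^sub>R v + h *\<^sub>R w)" by (simp add: add_ac)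
  then have "\<bar>h\<^sup>2 * ?a - h\<^sup>2 * ?b\<bar> \<le> 2 * (e * h\<^sup>2)"
    using d1(2)[OF h(1,2)] d2(2)[OF h(1,3)] by linarith
  then have "h\<^sup>2 * \<bar>?a - ?b\<bar> \<le> h\<^sup>2 * (2 * e)"
    by (simp add: abs_mult mult_ac flip: right_diff_distrib)
  then show False using h e by (simp add: e_def)
qed

lemma smooth_DERIV_line:
  fixes f :: "'a::euclidean_space \<Rightarrow> real"
  assumes "smooth f"
  shows "((\<lambda>t. f (x + t *\<^sub>R w)) has_real_derivative dir_deriv w f (x + t *\<^sub>R w)) (at t within S)"
  using assms by (intro DERIV_line smooth_differentiable)

lemma dir_deriv_commute:
  fixes f :: "'a::euclidean_space \<Rightarrow> real"
  assumes "smooth f"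
  shows "dir_deriv v (dir_deriv w f) x = dir_deriv w (dir_deriv v f) x"
  using assms by (intro dir_deriv_commute_at smooth_differentiable smooth_dir_deriv)

lemma iter_deriv_bounded_linear:
  assumes "bounded_linear h" "smooth f"
  shows "iter_deriv vs (\<lambda>x. h (f x)) = (\<lambda>x. h (iter_deriv vs f x))"
proof (induction vs)
  case (Cons v vs)
  have "((\<lambda>x. h (iter_deriv vs f x)) has_derivative (\<lambda>v. h (dir_deriv v (iter_deriv vs f) x))) (at x)" for x
    using assms(2) unfolding smooth_def
    by (intro bounded_linear.has_derivative[OF assms(1)] differentiable_has_derivative_dir_deriv) auto
  then show ?case
    by (auto simp: Cons intro!: ext dir_deriv_eqI)
qed simp

lemma smooth_bounded_linear:
  assumes "bounded_linear h" "smooth f" shows "smooth (\<lambda>x. h (f x))"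
  unfolding smooth_def iter_deriv_bounded_linear[OF assms]
  using assms(2) unfolding smooth_def
  by (auto intro: differentiable_compose[OF bounded_linear_imp_differentiable[OF assms(1)]])

lemma iter_deriv_diff:
  assumes "smooth f" "smooth g"
  shows "iter_deriv vs (\<lambda>x. f x - g x) = (\<lambda>x. iter_deriv vs f x - iter_deriv vs g x)"
proof (induction vs)
  case (Cons v vs)
  have "((\<lambda>x. iter_deriv vs f x - iter_deriv vs g x) has_derivative
      (\<lambda>v. dir_deriv v (iter_deriv vs f) x - dir_deriv v (iter_deriv vs g) x)) (at x)" for x
    using assms unfolding smooth_def
    by (intro has_derivative_diff differentiable_has_derivative_dir_deriv) auto
  then show ?case
    by (auto simp: Cons intro!: ext dir_deriv_eqI)
qed simp

lemma smooth_diff: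
  assumes "smooth f" "smooth g" shows "smooth (\<lambda>x. f x - g x)"
  unfolding smooth_def iter_deriv_diff[OF assms]
  using assms unfolding smooth_def by (auto intro: differentiable_diff)

lemma dir_deriv_half_norm_sq: "dir_deriv v (\<lambda>x::'a::euclidean_space. (norm x)\<^sup>2 / 2) = (\<lambda>x. x \<bullet> v)"
proof
  fix x :: 'a
  have "((\<lambda>x. (norm x)\<^sup>2 / 2) has_derivative (\<lambda>v. x \<bullet> v)) (at x)"
    unfolding power2_norm_eq_inner by (auto intro!: derivative_eq_intros simp: inner_commute)
  then show "dir_deriv v (\<lambda>x. (norm x)\<^sup>2 / 2) x = x \<bullet> v"
    by (rule dir_deriv_eqI)
qed

lemma dir_deriv_inner: "dir_deriv v (\<lambda>x::'a::euclidean_space. x \<bullet> w) = (\<lambda>x. v \<bullet> w)"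
  by (intro ext dir_deriv_eqI) (auto intro!: derivative_eq_intros)

lemma dir_deriv_const: "dir_deriv v (\<lambda>x. c) = (\<lambda>x. 0)"
  by (intro ext dir_deriv_eqI) (auto intro!: derivative_eq_intros)

text \<open>Iterated derivatives keep to three shapes: the function itself, the linear forms
  \<open>\<lambda>x. x \<bullet> w\<close>, and constants.\<close>

lemma smooth_half_norm_sq: "smooth (\<lambda>x::'a::euclidean_space. (norm x)\<^sup>2 / 2)"
proof -
  let ?q = "\<lambda>x::'a. (norm x)\<^sup>2 / 2"
  have "iter_deriv vs ?q = ?q \<or> (\<exists>w. iter_deriv vs ?q = (\<lambda>x. x \<bullet> w)) \<or> (\<exists>c. iter_deriv vs ?q = (\<lambda>x. c))" for vs
  proof (induction vs)
    case (Cons v vs)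
    then show ?case
      by (elim disjE exE) (auto simp: dir_deriv_half_norm_sq dir_deriv_inner dir_deriv_const)
  qed simp
  moreover have "?q differentiable (at x)" for x
    unfolding power2_norm_eq_inner differentiable_def by (rule exI) (auto intro!: derivative_eq_intros)
  moreover have "(\<lambda>x. x \<bullet> w) differentiable (at x)" for x w :: 'a
    unfolding differentiable_def by (rule exI) (auto intro!: derivative_eq_intros)
  ultimately show ?thesis
    unfolding smooth_def by (metis differentiable_const)
qed

section \<open>Circle and disc means\<close>

text \<open>Polar coordinates: the radius in \<open>[0, 1]\<close> and the angle in
  \<open>[0, 2 * pi]\<close>. Circle means use the same box, with integrands constant in the
  radius.\<close>

abbreviation param_box :: "(real \<times> real) set" where
  "param_box \<equiv> cbox (0, 0) (1, 2 * pi)"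

text \<open>Treats circle and disc means together: \<open>k\<close> is a probability density on the
  parameters, \<open>\<gamma> p\<close> is the displacement from the centre, and \<open>r\<close>
  bounds how far the mean reaches.\<close>

locale averaging =
  fixes k :: "real \<times> real \<Rightarrow> real" and \<gamma> :: "real \<times> real \<Rightarrow> 'a::euclidean_space" and r :: real
  assumes cont_k: "continuous_on param_box k" and cont_\<gamma>: "continuous_on param_box \<gamma>"
    and k_nonneg: "\<And>p. p \<in> param_box \<Longrightarrow> 0 \<le> k p" and integral_k: "integral param_box k = 1"
    and norm_\<gamma>: "\<And>p. p \<in> param_box \<Longrightarrow> norm (\<gamma> p) \<le> r"
begin

definition avg :: "('a \<Rightarrow> real) \<Rightarrow> 'a \<Rightarrow> real" where
  "avg f x = integral param_box (\<lambda>p. k p * f (x + \<gamma> p))"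

lemma avg_continuous_integrand:
  assumes "continuous_on UNIV f"
  shows "continuous_on (S \<times> param_box) (\<lambda>(x, p). k p * f (x + \<gamma> p))"
proof -
  have "continuous_on (S \<times> param_box) (\<lambda>z. k (snd z))" "continuous_on (S \<times> param_box) (\<lambda>z. \<gamma> (snd z))"
    by (rule continuous_on_compose2[OF cont_k] continuous_on_compose2[OF cont_\<gamma>];
        auto intro!: continuous_intros)+
  then show ?thesis
    unfolding case_prod_unfold
    by (intro continuous_on_mult continuous_on_compose2[OF assms] continuous_on_add continuous_on_fst
        continuous_on_id) auto
qed

lemma avg_integrable:
  assumes "continuous_on UNIV f"
  shows "(\<lambda>p. k p * f (x + \<gamma> p)) integrable_on param_box"
proof -
  have "continuous_on param_box (\<lambda>p. k p * f (x + \<gamma> p))"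
    using continuous_on_compose2[OF avg_continuous_integrand[OF assms, of UNIV], of param_box "\<lambda>p. (x, p)"]
    by (simp add: continuous_on_Pair image_subset_iff)
  then show ?thesis by (rule integrable_continuous)
qed

lemma continuous_on_avg: "continuous_on UNIV f \<Longrightarrow> continuous_on S (avg f)"
  unfolding avg_def by (rule integral_continuous_on_param[OF avg_continuous_integrand])

lemma avg_const: "avg (\<lambda>_. c) x = c"
  by (simp add: avg_def integral_k)

lemma avg_add:
  "continuous_on UNIV f \<Longrightarrow> continuous_on UNIV g \<Longrightarrow> avg (\<lambda>y. f y + g y) x = avg f x + avg g x"
  by (simp add: avg_def distrib_left integral_add avg_integrable)

lemma avg_cmult: "avg (\<lambda>y. c * f y) x = c * avg f x"
  by (simp add: avg_def mult.left_commute[of _ c])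

lemma avg_sum:
  "finite A \<Longrightarrow> (\<And>a. a \<in> A \<Longrightarrow> continuous_on UNIV (f a)) \<Longrightarrow>
    avg (\<lambda>y. \<Sum>a\<in>A. f a y) x = (\<Sum>a\<in>A. avg (f a) x)"
  by (simp add: avg_def sum_distrib_left integral_sum avg_integrable)

lemma avg_mono:
  assumes "continuous_on UNIV f" "continuous_on UNIV g"
    and "\<And>p. p \<in> param_box \<Longrightarrow> f (x + \<gamma> p) \<le> g (x + \<gamma> p)"
  shows "avg f x \<le> avg g x"
  unfolding avg_def using assms k_nonneg by (intro integral_le avg_integrable mult_left_mono) auto

lemma avg_sum_add_const:
  assumes "finite A" "\<And>a. a \<in> A \<Longrightarrow> continuous_on UNIV (f a)"
  shows "avg (\<lambda>y. (\<Sum>a\<in>A. f a y) + c) x = (\<Sum>a\<in>A. avg (f a) x) + c"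
proof -
  have "continuous_on UNIV (\<lambda>y. \<Sum>a\<in>A. f a y)"
    using assms by (intro continuous_on_sum) auto
  then have "avg (\<lambda>y. (\<Sum>a\<in>A. f a y) + c) x = avg (\<lambda>y. \<Sum>a\<in>A. f a y) x + avg (\<lambda>y. c) x"
    by (rule avg_add[OF _ continuous_on_const])
  then show ?thesis
    using avg_sum[of A f x] assms by (simp add: avg_const)
qed

lemma avg_affine:
  assumes "continuous_on UNIV f"
  shows "avg (\<lambda>y. c + d * (f y + q)) x = c + d * (avg f x + q)"
  using avg_add[of "\<lambda>y. c" "\<lambda>y. d * (f y + q)"] avg_cmult[of d "\<lambda>y. f y + q"] avg_add[of f "\<lambda>y. q"] assms
  by (simp add: avg_const continuous_on_add continuous_on_mult_left)

lemma abs_avg_le: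
  assumes f: "continuous_on UNIV f" and s: "\<And>y. norm y \<le> norm x + r \<Longrightarrow> \<bar>f y\<bar> \<le> s"
  shows "\<bar>avg f x\<bar> \<le> s"
proof -
  have "\<bar>f (x + \<gamma> p)\<bar> \<le> s" if "p \<in> param_box" for p
    using norm_\<gamma>[OF that] norm_triangle_ineq[of x "\<gamma> p"] by (intro s) linarith
  then have "avg f x \<le> avg (\<lambda>_. s) x" "avg (\<lambda>_. - s) x \<le> avg f x"
    by (intro avg_mono f continuous_on_const; force)+
  then show ?thesis by (simp add: avg_const)
qed

text \<open>Differentiation under the integral sign. Derivatives along lines are the ones that the
  maximum principle will test.\<close>

lemma avg_DERIV_line:
  assumes f: "smooth f"
  shows "((\<lambda>t. avg f (x + t *\<^sub>R w)) has_real_derivative avg (dir_deriv w f) (x + t *\<^sub>R w)) (at t)"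
  unfolding avg_def
proof (rule leibniz_rule_field_derivative[where U = UNIV])
  show "((\<lambda>t. k p * f (x + t *\<^sub>R w + \<gamma> p)) has_real_derivative k p * dir_deriv w f (x + t *\<^sub>R w + \<gamma> p))
      (at t within UNIV)" for t p
    using DERIV_cmult[OF smooth_DERIV_line[OF f, of "x + \<gamma> p" w t UNIV], of "k p"] by (simp add: add_ac)
  show "(\<lambda>p. k p * f (x + t *\<^sub>R w + \<gamma> p)) integrable_on param_box" for t
    by (rule avg_integrable[OF smooth_continuous_on[OF f]])
  show "continuous_on (UNIV \<times> param_box) (\<lambda>(t, p). k p * dir_deriv w f (x + t *\<^sub>R w + \<gamma> p))"
    unfolding case_prod_unfold
    by (intro continuous_intros continuous_on_compose2[OF cont_k] continuous_on_compose2[OF cont_\<gamma>]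
      continuous_on_compose2[OF smooth_continuous_on[OF smooth_dir_deriv[OF f], of UNIV]]) auto
qed auto

end

text \<open>Only the origin needs care: there, substituting \<open>inverse s\<close> into the limit
  of \<open>ln x / x\<close> at infinity shows that \<open>s * ln s\<close> tends to
  \<open>0\<close>.\<close>

lemma continuous_on_mult_ln: "continuous_on {0..} (\<lambda>s::real. s * ln s)"
proof -
  have "((\<lambda>s::real. - (ln (inverse s) / inverse s)) \<longlongrightarrow> - 0) (at_right 0)"
    by (intro tendsto_minus filterlim_compose[OF ln_x_over_x_tendsto_0] filterlim_inverse_at_top_right)
  moreover have "eventually (\<lambda>s::real. - (ln (inverse s) / inverse s) = s * ln s) (at_right 0)"
    by (intro eventually_at_rightI[of 0 1]) (auto simp: ln_div field_simps)
  ultimately have "((\<lambda>s::real. s * ln s) \<longlongrightarrow> 0) (at_right 0)"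
    using Lim_transform_eventually by fastforce
  moreover have "at (0::real) within {0..} = at_right 0"
    by (metis at_within_Icc_at_right at_within_Ici_at_right)
  ultimately have "continuous (at 0 within {0..}) (\<lambda>s::real. s * ln s)"
    by (simp add: continuous_within)
  moreover have "continuous (at s within {0..}) (\<lambda>s::real. s * ln s)" if "s > 0" for s
    using that by (intro continuous_intros) auto
  ultimately show ?thesis
    unfolding continuous_on_eq_continuous_within by (metis atLeast_iff less_eq_real_def)
qed

text \<open>Green's formula on the disc spanned by \<open>a\<close> and \<open>b\<close>; the kernel is \<open>s ln s\<close> because
  \<open>ln s\<close> is the fundamental solution of the Laplacian in the plane.\<close>

lemma circle_mean_minus_center:
  fixes f :: "'a::euclidean_space \<Rightarrow> real" and a b x :: 'a
  assumes f: "smooth f"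
  defines "c \<equiv> \<lambda>\<theta>. cos \<theta> *\<^sub>R a + sin \<theta> *\<^sub>R b"
    and "F \<equiv> \<lambda>y. dir_deriv a (dir_deriv a f) y + dir_deriv b (dir_deriv b f) y"
  shows "integral {0..2*pi} (\<lambda>\<theta>. f (x + c \<theta>)) - 2 * pi * f x
    = integral {0..1} (\<lambda>s. - (s * ln s) * integral {0..2*pi} (\<lambda>\<theta>. F (x + s *\<^sub>R c \<theta>)))"
proof -
  define fa fb where "fa = dir_deriv a f" and "fb = dir_deriv b f"
  define faa fab fbb where "faa = dir_deriv a fa" and "fab = dir_deriv b fa" and "fbb = dir_deriv b fb"
  have sm: "smooth fa" "smooth fb" "smooth faa" "smooth fab" "smooth fbb"
    unfolding fa_def fb_def faa_def fab_def fbb_def by (intro smooth_dir_deriv f)+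
  have fba: "dir_deriv a fb = fab"
    unfolding fb_def fab_def fa_def by (rule ext) (rule dir_deriv_commute[OF f])
  have contc: "continuous_on S (\<lambda>z. c (g z))" if "continuous_on S g" for S :: "'b::metric_space set" and g
    unfolding c_def by (intro continuous_intros that)
  note [continuous_intros] = contc sm(1,2)[THEN smooth_continuous_on, THEN continuous_on_compose2, OF _ subset_UNIV]
    sm(3-5)[THEN smooth_continuous_on, THEN continuous_on_compose2, OF _ subset_UNIV]
    f[THEN smooth_continuous_on, THEN continuous_on_compose2, OF _ subset_UNIV]
  define m D1 D2 P where "m s = integral {0..2*pi} (\<lambda>\<theta>. f (x + s *\<^sub>R c \<theta>))"
    and "D1 s \<theta> = cos \<theta> * fa (x + s *\<^sub>R c \<theta>) + sin \<theta> * fb (x + s *\<^sub>R c \<theta>)"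
    and "D2 s \<theta> = cos \<theta> * (cos \<theta> * faa (x + s *\<^sub>R c \<theta>) + sin \<theta> * fab (x + s *\<^sub>R c \<theta>))
      + sin \<theta> * (cos \<theta> * fab (x + s *\<^sub>R c \<theta>) + sin \<theta> * fbb (x + s *\<^sub>R c \<theta>))"
    and "P s \<theta> = sin \<theta> * (sin \<theta> * faa (x + s *\<^sub>R c \<theta>) - cos \<theta> * fab (x + s *\<^sub>R c \<theta>))
      + cos \<theta> * (cos \<theta> * fbb (x + s *\<^sub>R c \<theta>) - sin \<theta> * fab (x + s *\<^sub>R c \<theta>))"
    for s \<theta>
  have dc: "dir_deriv (c \<theta>) g y = cos \<theta> * dir_deriv a g y + sin \<theta> * dir_deriv b g y" if "smooth g"
    for g :: "'a \<Rightarrow> real" and \<theta> y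
    using that by (simp add: c_def dir_deriv_add dir_deriv_scaleR)
  have d1: "((\<lambda>s. g (x + s *\<^sub>R c \<theta>)) has_real_derivative
      cos \<theta> * dir_deriv a g (x + s *\<^sub>R c \<theta>) + sin \<theta> * dir_deriv b g (x + s *\<^sub>R c \<theta>)) (at s within S)"
    if "smooth g" for g s \<theta> S
    using smooth_DERIV_line[OF that, of x "c \<theta>" s S] unfolding dc[OF that] .
  have dm: "(m has_real_derivative integral {0..2*pi} (D1 s)) (at s within UNIV)" for s
    unfolding m_def[abs_def] interval_cbox
  proof (rule leibniz_rule_field_derivative[where U = UNIV])
    show "((\<lambda>s. f (x + s *\<^sub>R c \<theta>)) has_real_derivative D1 s \<theta>) (at s within UNIV)" for s \<theta>
      unfolding D1_def fa_def fb_def by (rule d1[OF f])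
    show "(\<lambda>\<theta>. f (x + s *\<^sub>R c \<theta>)) integrable_on cbox 0 (2 * pi)" for s
      by (intro integrable_continuous continuous_intros)
    show "continuous_on (UNIV \<times> cbox 0 (2 * pi)) (\<lambda>(s, \<theta>). D1 s \<theta>)"
      unfolding case_prod_unfold D1_def by (intro continuous_intros)
  qed auto
  have dD1: "((\<lambda>s. integral {0..2*pi} (D1 s)) has_real_derivative integral {0..2*pi} (D2 s)) (at s within UNIV)" for s
    unfolding interval_cbox
  proof (rule leibniz_rule_field_derivative[where U = UNIV])
    show "((\<lambda>s. D1 s \<theta>) has_real_derivative D2 s \<theta>) (at s within UNIV)" for s \<theta>
      unfolding D1_def D2_def
      using DERIV_add[OF DERIV_cmult[OF d1[OF sm(1)]] DERIV_cmult[OF d1[OF sm(2)]]]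
      by (simp add: faa_def fab_def fbb_def fba[unfolded fab_def])
    show "D1 s integrable_on cbox 0 (2 * pi)" for s
      unfolding D1_def by (intro integrable_continuous continuous_intros)
    show "continuous_on (UNIV \<times> cbox 0 (2 * pi)) (\<lambda>(s, \<theta>). D2 s \<theta>)"
      unfolding case_prod_unfold D2_def by (intro continuous_intros)
  qed auto
  have c': "(c has_vector_derivative (cos \<theta> *\<^sub>R b - sin \<theta> *\<^sub>R a)) (at \<theta> within S)" for \<theta> S
    unfolding c_def by (auto intro!: derivative_eq_intros)
  have dth: "((\<lambda>\<theta>. g (x + s *\<^sub>R c \<theta>)) has_real_derivative
      s * (cos \<theta> * dir_deriv b g (x + s *\<^sub>R c \<theta>) - sin \<theta> * dir_deriv a g (x + s *\<^sub>R c \<theta>))) (at \<theta> within S)"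
    if "smooth g" for g s \<theta> S
  proof -
    have *: "((\<lambda>\<theta>. g (x + s *\<^sub>R c \<theta>)) has_derivative
        (\<lambda>t. dir_deriv (s *\<^sub>R (t *\<^sub>R (cos \<theta> *\<^sub>R b - sin \<theta> *\<^sub>R a))) g (x + s *\<^sub>R c \<theta>))) (at \<theta> within S)"
      by (rule has_derivative_compose[of "\<lambda>\<theta>. x + s *\<^sub>R c \<theta>", OF _ smooth_has_derivative[OF that]])
        (use c'[unfolded has_vector_derivative_def] in \<open>auto intro!: derivative_eq_intros\<close>)
    have "dir_deriv (cos \<theta> *\<^sub>R b - sin \<theta> *\<^sub>R a) g y = cos \<theta> * dir_deriv b g y - sin \<theta> * dir_deriv a g y" for y
      using that linear_diff[OF linear_dir_deriv[OF that, of y]] by (simp add: dir_deriv_scaleR)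
    then have "(\<lambda>t. dir_deriv (s *\<^sub>R (t *\<^sub>R (cos \<theta> *\<^sub>R b - sin \<theta> *\<^sub>R a))) g (x + s *\<^sub>R c \<theta>))
        = (*) (s * (cos \<theta> * dir_deriv b g (x + s *\<^sub>R c \<theta>) - sin \<theta> * dir_deriv a g (x + s *\<^sub>R c \<theta>)))"
      by (intro ext) (simp add: dir_deriv_scaleR[OF that])
    then show ?thesis
      using * unfolding has_field_derivative_def by simp
  qed
  \<comment> \<open>\<open>s * P\<close> and \<open>D1\<close> differ by the angular derivative of
    \<open>?h\<close>, whose integral over a full period vanishes. Stated without dividing by
    \<open>s\<close>, the identity also holds at the centre.\<close>
  have ang: "integral {0..2*pi} (D1 s) = s * integral {0..2*pi} (P s)" for s
  proof -
    let ?h = "\<lambda>\<theta>. cos \<theta> * fb (x + s *\<^sub>R c \<theta>) - sin \<theta> * fa (x + s *\<^sub>R c \<theta>)"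
    have "(?h has_real_derivative s * P s \<theta> - D1 s \<theta>) (at \<theta> within {0..2*pi})" for \<theta>
      unfolding D1_def P_def
      by (rule derivative_eq_intros dth sm refl)+
        (simp add: faa_def[symmetric] fab_def[symmetric] fbb_def[symmetric] fba algebra_simps)
    then have "((\<lambda>\<theta>. s * P s \<theta> - D1 s \<theta>) has_integral (?h (2*pi) - ?h 0)) {0..2*pi}"
      by (intro fundamental_theorem_of_calculus) (auto simp: has_real_derivative_iff_has_vector_derivative)
    moreover have "?h (2*pi) - ?h 0 = 0"
      by (simp add: c_def)
    ultimately have "integral {0..2*pi} (\<lambda>\<theta>. s * P s \<theta> - D1 s \<theta>) = 0"
      by (simp add: integral_unique)
    moreover have "P s integrable_on {0..2*pi}" "D1 s integrable_on {0..2*pi}"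
      unfolding P_def D1_def by (intro integrable_continuous_real continuous_intros)+
    then have "integral {0..2*pi} (\<lambda>\<theta>. s * P s \<theta> - D1 s \<theta>) = s * integral {0..2*pi} (P s) - integral {0..2*pi} (D1 s)"
      by (subst integral_diff) (auto intro!: integrable_on_mult_right)
    ultimately show ?thesis
      by simp
  qed
  \<comment> \<open>The radial second derivative and the angular part add up to \<open>F\<close>,
    because the squares of sine and cosine add up to \<open>1\<close>.\<close>
  have PD: "integral {0..2*pi} (P s) + integral {0..2*pi} (D2 s) = integral {0..2*pi} (\<lambda>\<theta>. F (x + s *\<^sub>R c \<theta>))" for s
  proof -
    have "P s integrable_on {0..2*pi}" "D2 s integrable_on {0..2*pi}"
      unfolding P_def D2_def by (intro integrable_continuous_real continuous_intros)+
    then have "integral {0..2*pi} (P s) + integral {0..2*pi} (D2 s) = integral {0..2*pi} (\<lambda>\<theta>. P s \<theta> + D2 s \<theta>)"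
      by (simp add: integral_add)
    also have "(\<lambda>\<theta>. P s \<theta> + D2 s \<theta>) = (\<lambda>\<theta>. F (x + s *\<^sub>R c \<theta>))"
    proof
      fix \<theta>
      have "P s \<theta> + D2 s \<theta> = ((sin \<theta>)\<^sup>2 + (cos \<theta>)\<^sup>2) * (faa (x + s *\<^sub>R c \<theta>) + fbb (x + s *\<^sub>R c \<theta>))"
        unfolding P_def D2_def power2_eq_square by algebra
      then show "P s \<theta> + D2 s \<theta> = F (x + s *\<^sub>R c \<theta>)"
        by (simp add: F_def faa_def fbb_def fa_def fb_def)
    qed
    finally show ?thesis .
  qed
  \<comment> \<open>An antiderivative of the integrand on the right. Its logarithmic term vanishes
    at both ends, leaving \<open>m 1 - m 0\<close> with \<open>m 0 = 2 * pi * f x\<close>.\<close>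
  define Y where "Y s = m s - s * ln s * integral {0..2*pi} (D1 s)" for s
  have "((\<lambda>s. - (s * ln s) * integral {0..2*pi} (\<lambda>\<theta>. F (x + s *\<^sub>R c \<theta>))) has_integral (Y 1 - Y 0)) {0..1}"
  proof (rule fundamental_theorem_of_calculus_interior)
    have "continuous_on {0..1} m" "continuous_on {0..1} (\<lambda>s. integral {0..2*pi} (D1 s))"
      by (rule DERIV_continuous_on[OF has_field_derivative_at_within[OF dm]]
          DERIV_continuous_on[OF has_field_derivative_at_within[OF dD1]])+
    then show "continuous_on {0..1} Y"
      unfolding Y_def by (intro continuous_intros continuous_on_subset[OF continuous_on_mult_ln]) auto
    fix s :: real assume s: "s \<in> {0<..<1}"
    have "(Y has_real_derivative
        integral {0..2*pi} (D1 s) - ((ln s + 1) * integral {0..2*pi} (D1 s) + s * ln s * integral {0..2*pi} (D2 s))) (at s)"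
      unfolding Y_def using s
      by (auto intro!: derivative_eq_intros dm dD1)
    also have "integral {0..2*pi} (D1 s) - ((ln s + 1) * integral {0..2*pi} (D1 s) + s * ln s * integral {0..2*pi} (D2 s))
        = - (s * ln s) * integral {0..2*pi} (\<lambda>\<theta>. F (x + s *\<^sub>R c \<theta>))"
      unfolding PD[symmetric] ang by (simp add: algebra_simps)
    finally show "(Y has_vector_derivative - (s * ln s) * integral {0..2*pi} (\<lambda>\<theta>. F (x + s *\<^sub>R c \<theta>))) (at s)"
      by (simp add: has_real_derivative_iff_has_vector_derivative)
  qed simp
  from integral_unique[OF this] show ?thesis
    by (simp add: Y_def m_def)
qed

definition circle_kernel :: "real \<times> real \<Rightarrow> real" where
  "circle_kernel p = 1 / (2 * pi)"

text \<open>The Green function of the unit disc times the Jacobian of polar coordinates, normalised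
  to total mass \<open>1\<close>.\<close>

definition disc_kernel :: "real \<times> real \<Rightarrow> real" where
  "disc_kernel p = - 4 * (fst p * ln (fst p)) / (2 * pi)"

text \<open>A circle when \<open>a\<close> and \<open>b\<close> are orthogonal of equal length, in
  general a possibly degenerate ellipse; \<open>norm a + norm b\<close> bounds the displacement in
  every case.\<close>

definition circle_path :: "'a::euclidean_space \<Rightarrow> 'a \<Rightarrow> real \<times> real \<Rightarrow> 'a" where
  "circle_path a b p = cos (snd p) *\<^sub>R a + sin (snd p) *\<^sub>R b"

definition disc_path :: "'a::euclidean_space \<Rightarrow> 'a \<Rightarrow> real \<times> real \<Rightarrow> 'a" where
  "disc_path a b p = fst p *\<^sub>R circle_path a b p"

lemma norm_circle_path: "norm (circle_path a b p) \<le> norm a + norm b"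
proof -
  have "norm (circle_path a b p) \<le> \<bar>cos (snd p)\<bar> * norm a + \<bar>sin (snd p)\<bar> * norm b"
    unfolding circle_path_def by (metis norm_scaleR norm_triangle_ineq)
  also have "\<dots> \<le> 1 * norm a + 1 * norm b"
    by (intro add_mono mult_right_mono) auto
  finally show ?thesis by simp
qed

lemma continuous_on_circle_path: "continuous_on S (circle_path a b)"
  unfolding circle_path_def by (intro continuous_intros)

lemma continuous_on_disc_kernel: "continuous_on param_box disc_kernel"
proof -
  have "continuous_on param_box (\<lambda>p. fst p * ln (fst p))"
    by (rule continuous_on_compose2[OF continuous_on_mult_ln]) (auto intro!: continuous_intros)
  then have "continuous_on param_box (\<lambda>p. (- 4 / (2 * pi)) * (fst p * ln (fst p)))"
    by (rule continuous_on_mult_left)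
  then show ?thesis
    by (simp add: disc_kernel_def[abs_def])
qed

lemma integral_disc_kernel: "integral param_box disc_kernel = 1"
proof -
  let ?Y = "\<lambda>s::real. s\<^sup>2 - 2 * (s * (s * ln s))"
  have *: "((\<lambda>s::real. - 4 * (s * ln s)) has_integral (?Y 1 - ?Y 0)) {0..1}"
  proof (rule fundamental_theorem_of_calculus_interior)
    show "continuous_on {0..1} ?Y"
      by (intro continuous_intros continuous_on_subset[OF continuous_on_mult_ln]) auto
    fix s :: real assume "s \<in> {0<..<1}"
    then have "(?Y has_real_derivative (2 * s - 2 * (1 * (s * ln s) + s * (ln s + 1)))) (at s)"
      by (auto intro!: derivative_eq_intros)
    then show "(?Y has_vector_derivative - 4 * (s * ln s)) (at s)"
      by (simp add: has_real_derivative_iff_has_vector_derivative algebra_simps)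
  qed simp
  have "integral param_box disc_kernel = integral {0..1} (\<lambda>s. - 4 * (s * ln s))"
    by (subst integral_prod_continuous[OF continuous_on_disc_kernel]) (simp add: disc_kernel_def flip: interval_cbox)
  also have "\<dots> = 1"
    unfolding integral_unique[OF *] by simp
  finally show ?thesis .
qed

interpretation circle: averaging circle_kernel "circle_path a b" "norm a + norm b" for a b
proof
  show "integral param_box circle_kernel = 1"
    by (simp add: circle_kernel_def[abs_def] content_Pair)
qed (auto simp: circle_kernel_def[abs_def] norm_circle_path continuous_on_circle_path)

interpretation disc: averaging disc_kernel "disc_path a b" "norm a + norm b" for a b
proof
  show "continuous_on param_box (disc_path a b)"
    unfolding disc_path_def by (intro continuous_intros continuous_on_circle_path)
  fix p :: "real \<times> real" assume "p \<in> param_box"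
  then have p: "0 \<le> fst p" "fst p \<le> 1" by (cases p; auto simp: cbox_Pair_eq)+
  then have "fst p * ln (fst p) \<le> 0"
    by (cases "fst p = 0") (auto simp: mult_le_0_iff)
  then show "0 \<le> disc_kernel p"
    unfolding disc_kernel_def by (intro divide_nonneg_pos) auto
  show "norm (disc_path a b p) \<le> norm a + norm b"
    using mult_mono[OF p(2) norm_circle_path[of a b p]] p by (simp add: disc_path_def)
qed (rule continuous_on_disc_kernel integral_disc_kernel)+

text \<open>Green's formula rewritten with probability means; the \<open>4\<close> comes from the
  normalisation of \<open>disc_kernel\<close>.\<close>

lemma circle_avg_minus_center:
  fixes f :: "'a::euclidean_space \<Rightarrow> real"
  assumes f: "smooth f"
  shows "circle.avg a b f x - f x
    = disc.avg a b (\<lambda>y. dir_deriv a (dir_deriv a f) y + dir_deriv b (dir_deriv b f) y) x / 4"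
proof -
  define F where "F = (\<lambda>y. dir_deriv a (dir_deriv a f) y + dir_deriv b (dir_deriv b f) y)"
  define c where "c \<theta> = cos \<theta> *\<^sub>R a + sin \<theta> *\<^sub>R b" for \<theta>
  have F: "continuous_on UNIV F"
    unfolding F_def by (intro continuous_intros smooth_continuous_on smooth_dir_deriv f)
  have 1: "continuous_on param_box (\<lambda>p. circle_kernel p * f (x + circle_path a b p))"
    using continuous_on_compose2[OF circle.avg_continuous_integrand[OF smooth_continuous_on[OF f], of UNIV a b],
        of param_box "\<lambda>p. (x, p)"]
    by (simp add: continuous_on_Pair image_subset_iff)
  have 2: "continuous_on param_box (\<lambda>p. disc_kernel p * F (x + disc_path a b p))"
    using continuous_on_compose2[OF disc.avg_continuous_integrand[OF F, of UNIV a b], of param_box "\<lambda>p. (x, p)"]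
    by (simp add: continuous_on_Pair image_subset_iff)
  define I where "I = integral {0..1} (\<lambda>s. - (s * ln s) * integral {0..2*pi} (\<lambda>\<theta>. F (x + s *\<^sub>R c \<theta>)))"
  have "circle.avg a b f x = integral {0..2*pi} (\<lambda>\<theta>. f (x + c \<theta>)) / (2 * pi)"
    unfolding circle.avg_def
    by (subst integral_prod_continuous[OF 1]) (simp add: circle_kernel_def circle_path_def c_def flip: interval_cbox)
  also have "\<dots> = (I + 2 * pi * f x) / (2 * pi)"
    using circle_mean_minus_center[OF f, of x a b] unfolding F_def c_def I_def by simp
  also have "\<dots> = I / (2 * pi) + f x"
    by (simp add: add_divide_distrib)
  finally have *: "circle.avg a b f x - f x = I / (2 * pi)"
    by simp
  have "disc.avg a b F x
      = integral {0..1} (\<lambda>s. 4 / (2 * pi) * (- (s * ln s) * integral {0..2*pi} (\<lambda>\<theta>. F (x + s *\<^sub>R c \<theta>))))"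
    unfolding disc.avg_def
    by (subst integral_prod_continuous[OF 2])
      (simp add: disc_kernel_def disc_path_def circle_path_def c_def mult.assoc flip: interval_cbox)
  also have "\<dots> = 4 / (2 * pi) * I"
    unfolding I_def by (rule integral_mult_right)
  finally show ?thesis
    unfolding F_def[symmetric] * by simp
qed

section \<open>The maximum principle\<close>

text \<open>Were \<open>z2\<close> positive, then \<open>z1\<close>, which vanishes at
  \<open>0\<close>, would be positive just to the right of \<open>0\<close>, and the mean value
  theorem would produce larger values of \<open>z\<close> there.\<close>

lemma second_derivative_nonpos_at_local_max:
  fixes z z1 :: "real \<Rightarrow> real"
  assumes z: "\<And>t. (z has_real_derivative z1 t) (at t)" and z1: "(z1 has_real_derivative z2) (at 0)"
    and d: "0 < d" "\<And>t. \<bar>t\<bar> < d \<Longrightarrow> z t \<le> z 0"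
  shows "z2 \<le> 0"
proof (rule ccontr)
  assume "\<not> z2 \<le> 0"
  have "z1 0 = 0"
    by (rule DERIV_local_max[OF z d(1)]) (use d(2) in auto)
  then obtain d' where d': "d' > 0" "\<And>h. 0 < h \<Longrightarrow> h < d' \<Longrightarrow> 0 < z1 h"
    using DERIV_pos_inc_right[OF z1] \<open>\<not> z2 \<le> 0\<close> by auto
  define h where "h = min d d' / 2"
  have h: "0 < h" "h < d" "h < d'" using d(1) d'(1) by (auto simp: h_def)
  obtain y where "0 < y" "y < h" "z h - z 0 = (h - 0) * z1 y"
    using MVT2[OF h(1) z] by blast
  then have "z h > z 0"
    using d'(2)[of y] h by (smt (verit) mult_pos_pos)
  then show False using d(2)[of h] h by simp
qed

text \<open>Both inequalities compare functions that vanish at \<open>\<tau> = 0\<close>. In the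
  first, the left side has slope \<open>0\<close> and the right side slope
  \<open>2 * \<delta> * m\<close>; in the second, the slopes are \<open>m\<close> and
  \<open>2 * m\<close>. Hence every small \<open>\<tau>\<close> works.\<close>

lemma exists_AM_GM_tangent_gap:
  fixes \<delta> E :: real
  assumes "0 < \<delta>" "0 < m"
  obtains \<tau> where "0 < \<tau>" "\<tau> < 1"
    "E * ((1 + \<tau>) ^ m + (1 - \<tau>) ^ m - 2) < 2 * \<delta> * (1 - (1 - \<tau>) ^ m)"
    "(1 + \<tau>) ^ m - 1 < 2 * (real m * \<tau>)"
proof -
  let ?f = "\<lambda>\<tau>. 2 * \<delta> * (1 - (1 - \<tau>) ^ m) - E * ((1 + \<tau>) ^ m + (1 - \<tau>) ^ m - 2)"
  let ?g = "\<lambda>\<tau>. 2 * (real m * \<tau>) - ((1 + \<tau>) ^ m - 1)"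
  have "(?f has_real_derivative 2 * \<delta> * real m) (at 0)"
    by (auto intro!: derivative_eq_intros)
  then obtain d1 where d1: "d1 > 0" "\<And>h. 0 < h \<Longrightarrow> h < d1 \<Longrightarrow> ?f 0 < ?f (0 + h)"
    using DERIV_pos_inc_right[of ?f "2 * \<delta> * real m" 0] assms by auto
  have "(?g has_real_derivative real m) (at 0)"
    by (auto intro!: derivative_eq_intros)
  then obtain d2 where d2: "d2 > 0" "\<And>h. 0 < h \<Longrightarrow> h < d2 \<Longrightarrow> ?g 0 < ?g (0 + h)"
    using DERIV_pos_inc_right[of ?g "real m" 0] assms by auto
  define \<tau> where "\<tau> = min (min d1 d2) 1 / 2"
  have t: "0 < \<tau>" "\<tau> < 1" "\<tau> < d1" "\<tau> < d2" using d1(1) d2(1) by (auto simp: \<tau>_def)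
  show thesis
    using that[OF t(1,2)] d1(2)[OF t(1,3)] d2(2)[OF t(1,4)] by simp
qed

text \<open>Half the Laplacian along the complex line of \<open>w\<close>, scaled so that for
  isometric \<open>J\<close> the function \<open>(norm x)\<^sup>2 / 2\<close> has Levi form
  \<open>(norm w)\<^sup>2\<close>.\<close>

definition levi :: "('a \<Rightarrow> 'a) \<Rightarrow> ('a::euclidean_space \<Rightarrow> real) \<Rightarrow> 'a \<Rightarrow> 'a \<Rightarrow> real" where
  "levi J f x w = (dir_deriv w (dir_deriv w f) x + dir_deriv (J w) (dir_deriv (J w) f) x) / 2"

lemma dir_deriv_twice_scaleR:
  "smooth f \<Longrightarrow> dir_deriv (r *\<^sub>R w) (dir_deriv (r *\<^sub>R w) f) x = r\<^sup>2 *\<^sub>R dir_deriv w (dir_deriv w f) x"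
proof -
  assume f: "smooth f"
  have "dir_deriv (r *\<^sub>R w) f = (\<lambda>x. r *\<^sub>R dir_deriv w f x)"
    using f by (auto simp: dir_deriv_scaleR)
  moreover have "dir_deriv v (\<lambda>x. r *\<^sub>R dir_deriv w f x) x = r *\<^sub>R dir_deriv v (dir_deriv w f) x" for v
    using iter_deriv_bounded_linear[OF bounded_linear_scaleR_right smooth_dir_deriv[OF f], of "[v]" r w]
    by (auto dest: fun_cong)
  ultimately show ?thesis
    using f by (simp add: dir_deriv_scaleR smooth_dir_deriv power2_eq_square)
qed

lemma sum_dir_deriv_twice:
  "(\<lambda>y. dir_deriv w (dir_deriv w f) y + dir_deriv (J w) (dir_deriv (J w) f) y) = (\<lambda>y. 2 * levi J f y w)"
  unfolding levi_def by (intro ext) simp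

lemma continuous_on_levi: "smooth f \<Longrightarrow> continuous_on S (\<lambda>x. levi J f x w)"
  unfolding levi_def by (intro continuous_intros smooth_continuous_on smooth_dir_deriv) auto

section \<open>Mean values and the maximum principle for the Monge-Ampere equation\<close>

text \<open>\<open>v\<close> is the difference of the potential and the Euclidean one, and \<open>G\<close> is the metric, expressed
  through an isometry \<open>\<iota>\<close> of the tangent space with \<open>real ^ 'm\<close>.\<close>

locale monge_ampere =
  fixes v :: "'a::euclidean_space \<Rightarrow> real" and J :: "'a \<Rightarrow> 'a"
    and \<iota> :: "real ^ 'm::finite \<Rightarrow> 'a" and G :: "'a \<Rightarrow> real ^ 'm ^ 'm"
  assumes smooth_v: "smooth v"
    and linear_J: "linear J" and norm_J: "\<And>w. norm (J w) = norm w"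
    and norm_\<iota>: "\<And>y. norm (\<iota> y) = norm y" and surj_\<iota>: "surj \<iota>"
    and posdef_G: "\<And>x. posdef (G x)" and det_G: "\<And>x. det (G x) = 1"
    and G_levi: "\<And>x y. y \<bullet> (G x *v y) = levi J v x (\<iota> y) + (norm y)\<^sup>2"
    and growth: "\<And>\<epsilon>. 0 < \<epsilon> \<Longrightarrow> \<exists>R. \<forall>x. R \<le> norm x \<longrightarrow> \<bar>v x\<bar> \<le> \<epsilon> * (norm x)\<^sup>2"
begin

text \<open>Packages the conclusions of \<open>posdef_frame\<close> for \<open>P = G x\<close>.
  Summing a Levi form over \<open>w\<close> plays the role of the Laplacian of the metric at
  \<open>x\<close>.\<close>

definition frame :: "'a \<Rightarrow> (real ^ 'm) \<Rightarrow> ('m \<Rightarrow> real ^ 'm) \<Rightarrow> bool" where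
  "frame x e w \<longleftrightarrow> (\<forall>a. w a \<bullet> (G x *v w a) = 1) \<and>
    (\<forall>B k. posdef B \<longrightarrow> det B = 1 \<longrightarrow> 0 < k \<longrightarrow>
      real CARD('m) * k powr (1 / CARD('m)) + (1 - k) * ((e \<bullet> (B *v e)) / (e \<bullet> (G x *v e)))
        \<le> (\<Sum>a\<in>UNIV. w a \<bullet> (B *v w a)))"

lemma frame_exists:
  assumes "e \<noteq> 0" shows "\<exists>w. frame x e w"
  by (rule posdef_frame[OF posdef_G det_G assms, of x]) (auto simp: frame_def)

lemma levi_scaleR: "levi J v x (r *\<^sub>R w) = r\<^sup>2 * levi J v x w"
  using smooth_v by (simp add: levi_def dir_deriv_twice_scaleR linear_scale[OF linear_J] distrib_left)

definition circle_gap :: "'a \<Rightarrow> 'a \<Rightarrow> real" where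
  "circle_gap e x = circle.avg e (J e) v x - v x"

text \<open>With the coefficient \<open>2\<close>, the frame sum of the Levi form is
  \<open>F + S - 2 * N\<close>, where \<open>F\<close> is the frame sum of the Euclidean form,
  \<open>S\<close> the disc mean of that of the metric, and \<open>N\<close> the real dimension.
  This is the quantity that \<open>barrier_lower_bound\<close> estimates.\<close>

definition barrier :: "'a \<Rightarrow> 'a \<Rightarrow> real" where
  "barrier e x = disc.avg e (J e) v x - 2 * v x"

lemma circle_gap_eq: "circle_gap e x = disc.avg e (J e) (\<lambda>y. levi J v y e) x / 2"
  using circle_avg_minus_center[OF smooth_v, of e "J e" x]
  by (simp add: circle_gap_def sum_dir_deriv_twice disc.avg_cmult)

lemma trace_metric: "(\<Sum>a\<in>UNIV. w a \<bullet> (G y *v w a)) = (\<Sum>a\<in>UNIV. levi J v y (\<iota> (w a))) + (\<Sum>a\<in>UNIV. (norm (w a))\<^sup>2)"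
  by (simp add: G_levi sum.distrib)

lemma continuous_on_trace_metric: "continuous_on S (\<lambda>y. \<Sum>a\<in>UNIV. w a \<bullet> (G y *v w a))"
  unfolding trace_metric by (intro continuous_intros continuous_on_levi smooth_v)

lemma disc_avg_trace_metric:
  fixes w :: "'m \<Rightarrow> real ^ 'm"
  shows "disc.avg e b (\<lambda>y. \<Sum>a\<in>UNIV. w a \<bullet> (G y *v w a)) x
    = (\<Sum>a\<in>UNIV. disc.avg e b (\<lambda>y. levi J v y (\<iota> (w a))) x) + (\<Sum>a\<in>UNIV. (norm (w a))\<^sup>2)"
  unfolding trace_metric
  by (rule disc.avg_sum_add_const[OF finite]) (rule continuous_on_levi[OF smooth_v])

lemma circle_avg_trace_metric:
  fixes w :: "'m \<Rightarrow> real ^ 'm"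
  shows "circle.avg e b (\<lambda>y. \<Sum>a\<in>UNIV. w a \<bullet> (G y *v w a)) x
    = (\<Sum>a\<in>UNIV. circle.avg e b (\<lambda>y. levi J v y (\<iota> (w a))) x) + (\<Sum>a\<in>UNIV. (norm (w a))\<^sup>2)"
  unfolding trace_metric
  by (rule circle.avg_sum_add_const[OF finite]) (rule continuous_on_levi[OF smooth_v])

text \<open>The case \<open>k = 1\<close> of the frame inequality, where the directional term drops
  out.\<close>

lemma frame_trace_ge:
  assumes "frame x e w" shows "real CARD('m) \<le> (\<Sum>a\<in>UNIV. w a \<bullet> (G y *v w a))"
proof -
  have "real CARD('m) * 1 powr (1 / CARD('m)) + (1 - 1) * ((e \<bullet> (G y *v e)) / (e \<bullet> (G x *v e)))
      \<le> (\<Sum>a\<in>UNIV. w a \<bullet> (G y *v w a))"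
    using assms posdef_G det_G unfolding frame_def by (meson zero_less_one)
  then show ?thesis by simp
qed

lemma posdef_mat_1: "posdef (mat 1 :: real ^ 'm ^ 'm)"
  by (simp add: posdef_def transpose_mat)

lemma frame_norm_ge:
  assumes "frame x e w" shows "real CARD('m) \<le> (\<Sum>a\<in>UNIV. (norm (w a))\<^sup>2)"
proof -
  have "real CARD('m) * 1 powr (1 / CARD('m)) + (1 - 1) * ((e \<bullet> (mat 1 *v e)) / (e \<bullet> (G x *v e)))
      \<le> (\<Sum>a\<in>UNIV. w a \<bullet> (mat 1 *v w a))"
    using assms posdef_mat_1 det_I unfolding frame_def by (meson zero_less_one)
  then show ?thesis by (simp add: power2_norm_eq_inner)
qed

text \<open>Taking \<open>k = (1 - \<tau>) ^ N\<close> for the metric and \<open>k = (1 + \<tau>) ^ N\<close> for the Euclidean metric in the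
  inequality for frames makes the constant terms add up to \<open>2 * N\<close>.\<close>

lemma barrier_lower_bound:
  assumes e: "e \<noteq> 0" and \<delta>: "0 < \<delta>"
  shows "\<exists>c>0. \<forall>x w. frame x e w \<longrightarrow> \<delta> \<le> circle_gap (\<iota> e) x \<longrightarrow>
    c * (\<Sum>a\<in>UNIV. (norm (w a))\<^sup>2)
      \<le> (\<Sum>a\<in>UNIV. (norm (w a))\<^sup>2)
        + disc.avg (\<iota> e) (J (\<iota> e)) (\<lambda>y. \<Sum>a\<in>UNIV. w a \<bullet> (G y *v w a)) x - 2 * real CARD('m)"
proof -
  define E where "E = (norm e)\<^sup>2"
  define N where "N = CARD('m)"
  have E: "E > 0" and N: "N > 0" using e by (auto simp: E_def N_def)
  obtain \<tau> where \<tau>: "0 < \<tau>" "\<tau> < 1"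
    "E * ((1 + \<tau>) ^ N + (1 - \<tau>) ^ N - 2) < 2 * \<delta> * (1 - (1 - \<tau>) ^ N)"
    "(1 + \<tau>) ^ N - 1 < 2 * (real N * \<tau>)"
    using exists_AM_GM_tangent_gap[OF \<delta> N] by metis
  define P M where "P = 1 - (1 - \<tau>) ^ N" and "M = (1 + \<tau>) ^ N - 1"
  have P: "P \<ge> 0" using \<tau> by (simp add: P_def power_le_one)
  have M: "M > 0" using \<tau> N by (simp add: M_def one_less_power)
  \<comment> \<open>Lower bounds for \<open>F + S - 2 * N\<close> in the two cases
    \<open>a \<le> 2 * E\<close> and \<open>a > 2 * E\<close> below; the two properties of
    \<open>\<tau>\<close> make them positive.\<close>
  define d1 d2 where "d1 = (2 * \<delta> * P - E * (M - P)) / (2 * E)" and "d2 = real N * \<tau> - M / 2"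
  have d1: "d1 > 0" using \<tau>(3) E by (simp add: d1_def P_def M_def algebra_simps)
  have d2: "d2 > 0" using \<tau>(4) by (simp add: d2_def M_def)
  define c0 where "c0 = min d1 d2"
  have c0: "c0 > 0" using d1 d2 by (simp add: c0_def)
  show ?thesis
  \<comment> \<open>This constant turns an additive gain into a multiple of \<open>F\<close>: for
    \<open>X = F + S - 2 * N\<close>, the bounds \<open>X \<ge> c0\<close> and
    \<open>X \<ge> F - N\<close> give
    \<open>(N + c0) * X \<ge> N * c0 + c0 * (F - N) = c0 * F\<close>.\<close>
  proof (intro exI[of _ "c0 / (real N + c0)"] conjI allI impI)
    show "0 < c0 / (real N + c0)" using c0 N by (simp add: add_pos_pos)
    fix x w assume w: "frame x e w" and gap: "\<delta> \<le> circle_gap (\<iota> e) x"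
    define S where "S = disc.avg (\<iota> e) (J (\<iota> e)) (\<lambda>y. \<Sum>a\<in>UNIV. w a \<bullet> (G y *v w a)) x"
    define F where "F = (\<Sum>a\<in>UNIV. (norm (w a))\<^sup>2)"
    define a where "a = e \<bullet> (G x *v e)"
    have a: "a > 0" using posdef_G e by (simp add: a_def posdef_def)
    have root: "(q ^ N) powr (1 / real N) = q" if "q > 0" for q :: real
      using that N by (simp add: powr_powr flip: powr_realpow)
    have tangent: "real N * q + (1 - q ^ N) * ((e \<bullet> (B *v e)) / a) \<le> (\<Sum>a\<in>UNIV. w a \<bullet> (B *v w a))"
      if "posdef B" "det B = 1" "q > 0" for B q
    proof -
      have "0 < q ^ N" using that by simp
      then have "real CARD('m) * (q ^ N) powr (1 / CARD('m)) + (1 - q ^ N) * ((e \<bullet> (B *v e)) / (e \<bullet> (G x *v e)))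
        \<le> (\<Sum>a\<in>UNIV. w a \<bullet> (B *v w a))"
        using w that(1,2) unfolding frame_def by blast
      then show ?thesis
        using root[OF that(3)] by (simp add: a_def N_def[symmetric])
    qed
    \<comment> \<open>At each point of the disc the frame inequality is affine in the Levi form in
      direction \<open>e\<close>, so averaging it and applying Green's formula bounds
      \<open>S\<close> below through the circle gap.\<close>
    have "disc.avg (\<iota> e) (J (\<iota> e)) (\<lambda>y. real N * (1 - \<tau>) + (P / a) * (levi J v y (\<iota> e) + E)) x \<le> S"
      unfolding S_def
    proof (rule disc.avg_mono)
      fix y
      have "real N * (1 - \<tau>) + P * ((e \<bullet> (G y *v e)) / a) \<le> (\<Sum>a\<in>UNIV. w a \<bullet> (G y *v w a))" for y
        using tangent[OF posdef_G det_G, of "1 - \<tau>" y] \<tau> by (simp add: P_def)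
      then show "real N * (1 - \<tau>) + (P / a) * (levi J v (x + y) (\<iota> e) + E) \<le> (\<Sum>a\<in>UNIV. w a \<bullet> (G (x + y) *v w a))"
        by (simp add: G_levi E_def)
    qed (intro continuous_intros continuous_on_levi smooth_v continuous_on_trace_metric)+
    also have "disc.avg (\<iota> e) (J (\<iota> e)) (\<lambda>y. real N * (1 - \<tau>) + (P / a) * (levi J v y (\<iota> e) + E)) x
        = real N * (1 - \<tau>) + (P / a) * (2 * circle_gap (\<iota> e) x + E)"
      by (simp only: circle_gap_eq disc.avg_affine[OF continuous_on_levi[OF smooth_v]]) simp
    finally have "real N * (1 - \<tau>) + (P / a) * (2 * circle_gap (\<iota> e) x + E) \<le> S" .
    moreover have "(P / a) * (2 * \<delta> + E) \<le> (P / a) * (2 * circle_gap (\<iota> e) x + E)"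
      using gap P a by (intro mult_left_mono) auto
    ultimately have S: "real N * (1 - \<tau>) + (P / a) * (2 * \<delta> + E) \<le> S" by linarith
    have "real N * (1 + \<tau>) + (1 - (1 + \<tau>) ^ N) * (E / a) \<le> F"
      using tangent[OF posdef_mat_1 det_I, of "1 + \<tau>"] \<tau>
      by (simp add: E_def F_def power2_norm_eq_inner)
    then have F: "real N * (1 + \<tau>) - M * (E / a) \<le> F"
      by (simp add: M_def algebra_simps)
    have SN: "real N \<le> S"
    proof -
      have "disc.avg (\<iota> e) (J (\<iota> e)) (\<lambda>y. real N) x \<le> S"
        unfolding S_def N_def
        by (rule disc.avg_mono) (intro continuous_intros continuous_on_trace_metric frame_trace_ge[OF w])+
      then show ?thesis by (simp add: disc.avg_const)
    qed
    have FN: "real N \<le> F" unfolding F_def N_def by (rule frame_norm_ge[OF w])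
    have "c0 \<le> F + S - 2 * real N"
    \<comment> \<open>For moderate \<open>a\<close>, adding the bounds for \<open>S\<close> and
      \<open>F\<close> cancels the constants and leaves a positive numerator over \<open>a\<close>.
      For large \<open>a\<close> the directional loss in the bound for \<open>F\<close> is at most
      \<open>M / 2\<close>, and \<open>F\<close> alone exceeds \<open>N\<close> by
      \<open>d2\<close>.\<close>
    proof (cases "a \<le> 2 * E")
      case True
      have "d1 = (2 * \<delta> * P - E * (M - P)) / (2 * E)" by (simp add: d1_def)
      also have "\<dots> \<le> (2 * \<delta> * P - E * (M - P)) / a"
        using True a d1 E by (intro divide_left_mono) (auto simp: d1_def zero_less_divide_iff)
      also have "\<dots> = (P / a) * (2 * \<delta> + E) - M * (E / a)"
        by (simp add: diff_divide_distrib algebra_simps add_divide_distrib)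
      also have "\<dots> \<le> F + S - 2 * real N"
        using S F by (simp add: algebra_simps)
      finally show ?thesis by (simp add: c0_def)
    next
      case False
      then have "E / a \<le> 1 / 2" using a by (simp add: field_simps)
      then have "M * (E / a) \<le> M * (1 / 2)" using M by (intro mult_left_mono) auto
      moreover have "real N * (1 + \<tau>) = real N + real N * \<tau>" by (simp add: algebra_simps)
      ultimately have "d2 \<le> F - real N" using F unfolding d2_def by linarith
      then show ?thesis using SN by (simp add: c0_def)
    qed
    then have "real N * c0 + c0 * (F - real N) \<le> real N * (F + S - 2 * real N) + c0 * (F + S - 2 * real N)"
      using N c0 SN by (intro add_mono mult_left_mono) auto
    then have "c0 * F \<le> (real N + c0) * (F + S - 2 * real N)"
      by (simp add: algebra_simps)
    then show "c0 / (real N + c0) * (\<Sum>a\<in>UNIV. (norm (w a))\<^sup>2)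
      \<le> (\<Sum>a\<in>UNIV. (norm (w a))\<^sup>2)
        + disc.avg (\<iota> e) (J (\<iota> e)) (\<lambda>y. \<Sum>a\<in>UNIV. w a \<bullet> (G y *v w a)) x - 2 * real CARD('m)"
      using c0 N unfolding F_def[symmetric] S_def[symmetric] N_def[symmetric]
      by (simp add: pos_divide_le_eq add_pos_pos mult.commute)
  qed
qed

lemma circle_gap_DERIV_line:
  "((\<lambda>t. circle_gap e (x + t *\<^sub>R u)) has_real_derivative
    circle.avg e (J e) (dir_deriv u v) (x + t *\<^sub>R u) - dir_deriv u v (x + t *\<^sub>R u)) (at t)"
  unfolding circle_gap_def by (intro DERIV_diff circle.avg_DERIV_line smooth_DERIV_line smooth_v)

lemma circle_gap_bound:
  assumes "\<And>y. norm y \<le> norm x + 2 * norm e \<Longrightarrow> \<bar>v y\<bar> \<le> s"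
  shows "circle_gap e x \<le> 2 * s"
proof -
  have "\<bar>circle.avg e (J e) v x\<bar> \<le> s"
    using assms by (intro circle.abs_avg_le smooth_continuous_on smooth_v) (simp add: norm_J)
  moreover have "\<bar>v x\<bar> \<le> s" by (rule assms) simp
  ultimately show ?thesis by (simp add: circle_gap_def)
qed

lemma abs_barrier_bound:
  assumes "\<And>y. norm y \<le> norm x + 2 * norm e \<Longrightarrow> \<bar>v y\<bar> \<le> s"
  shows "\<bar>barrier e x\<bar> \<le> 3 * s"
proof -
  have "\<bar>disc.avg e (J e) v x\<bar> \<le> s"
    using assms by (intro disc.abs_avg_le smooth_continuous_on smooth_v) (simp add: norm_J)
  moreover have "\<bar>v x\<bar> \<le> s" by (rule assms) simp
  ultimately show ?thesis by (simp add: barrier_def)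
qed

lemma continuous_on_circle_gap: "continuous_on S (circle_gap e)"
  unfolding circle_gap_def by (intro continuous_intros circle.continuous_on_avg smooth_continuous_on smooth_v)

lemma continuous_on_barrier: "continuous_on S (barrier e)"
  unfolding barrier_def by (intro continuous_intros disc.continuous_on_avg smooth_continuous_on smooth_v)

text \<open>With \<open>W = circle_gap e - \<delta>\<close>, completing the square in \<open>\<eta> * W' + 2 * \<eta>' * W\<close> leaves the errors
  \<open>6 * (\<eta>' * W)\<^sup>2\<close> and \<open>2 * \<eta> * \<eta>'' * W\<^sup>2\<close>; as \<open>(\<eta>')\<^sup>2 \<le> 4 * (norm u)\<^sup>2 / R\<^sup>2\<close>, they contribute \<open>24\<close> and \<open>4\<close> to
  the constant \<open>28\<close>.\<close>

lemma second_order_condition: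
  fixes \<delta> R A :: real
  defines "\<eta> \<equiv> \<lambda>y. 1 - (norm y)\<^sup>2 / R\<^sup>2"
  assumes R: "0 < R" and x: "norm x < R"
    and gap: "\<delta> < circle_gap e x" "circle_gap e x \<le> \<delta> + M"
    and max: "\<And>y. norm y \<le> R \<Longrightarrow> \<delta> < circle_gap e y \<Longrightarrow>
      (\<eta> y * (circle_gap e y - \<delta>))\<^sup>2 + A * barrier e y \<le> (\<eta> x * (circle_gap e x - \<delta>))\<^sup>2 + A * barrier e x"
  shows "2 * (\<eta> x)\<^sup>2 * (circle_gap e x - \<delta>) *
      (circle.avg e (J e) (dir_deriv u (dir_deriv u v)) x - dir_deriv u (dir_deriv u v) x)
    + A * (disc.avg e (J e) (dir_deriv u (dir_deriv u v)) x - 2 * dir_deriv u (dir_deriv u v) x)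
    \<le> 28 * M\<^sup>2 / R\<^sup>2 * (norm u)\<^sup>2"
proof -
  define v1 v2 where "v1 = dir_deriv u v" and "v2 = dir_deriv u v1"
  have sm: "smooth v1" "smooth v2" unfolding v1_def v2_def by (intro smooth_dir_deriv smooth_v)+
  define W W1 W2 where "W t = circle_gap e (x + t *\<^sub>R u) - \<delta>"
    and "W1 t = circle.avg e (J e) v1 (x + t *\<^sub>R u) - v1 (x + t *\<^sub>R u)"
    and "W2 t = circle.avg e (J e) v2 (x + t *\<^sub>R u) - v2 (x + t *\<^sub>R u)" for t
  define B B1 B2 where "B t = barrier e (x + t *\<^sub>R u)"
    and "B1 t = disc.avg e (J e) v1 (x + t *\<^sub>R u) - 2 * v1 (x + t *\<^sub>R u)"
    and "B2 t = disc.avg e (J e) v2 (x + t *\<^sub>R u) - 2 * v2 (x + t *\<^sub>R u)" for t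
  define k where "k = 1 / R\<^sup>2"
  define h h1 h2 where "h t = \<eta> (x + t *\<^sub>R u)" and "h1 t = - 2 * (x \<bullet> u + t * (u \<bullet> u)) * k"
    and "h2 = - 2 * (u \<bullet> u) * k" for t
  have dW: "(W has_real_derivative W1 t) (at t)" for t
    unfolding W_def W1_def v1_def by (auto intro!: derivative_eq_intros circle_gap_DERIV_line)
  have dW1: "(W1 has_real_derivative W2 t) (at t)" for t
    unfolding W1_def W2_def v2_def by (intro DERIV_diff circle.avg_DERIV_line smooth_DERIV_line sm)
  have dB: "(B has_real_derivative B1 t) (at t)" for t
    unfolding B_def B1_def v1_def barrier_def
    by (intro DERIV_diff DERIV_cmult disc.avg_DERIV_line smooth_DERIV_line smooth_v)
  have dB1: "(B1 has_real_derivative B2 t) (at t)" for t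
    unfolding B1_def B2_def v2_def by (intro DERIV_diff DERIV_cmult disc.avg_DERIV_line smooth_DERIV_line sm)
  have h_eq: "h = (\<lambda>t. 1 - (x \<bullet> x + 2 * t * (x \<bullet> u) + t\<^sup>2 * (u \<bullet> u)) * k)"
  proof
    fix t
    have "(x + t *\<^sub>R u) \<bullet> (x + t *\<^sub>R u) = x \<bullet> x + 2 * t * (x \<bullet> u) + t\<^sup>2 * (u \<bullet> u)"
      by (simp add: inner_add_left inner_add_right inner_commute power2_eq_square)
    then show "h t = 1 - (x \<bullet> x + 2 * t * (x \<bullet> u) + t\<^sup>2 * (u \<bullet> u)) * k"
      unfolding h_def \<eta>_def power2_norm_eq_inner k_def by simp
  qed
  have dh: "(h has_real_derivative h1 t) (at t)" for t
    unfolding h_eq h1_def by (auto intro!: derivative_eq_intros simp: algebra_simps)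
  have dh1: "(h1 has_real_derivative h2) (at t)" for t
    unfolding h1_def h2_def by (auto intro!: derivative_eq_intros)
  define z z1 where "z t = (h t * W t)\<^sup>2 + A * B t"
    and "z1 t = 2 * (h t * W t) * (h1 t * W t + h t * W1 t) + A * B1 t" for t
  define z2 where "z2 = 2 * (h1 0 * W 0 + h 0 * W1 0)\<^sup>2
    + 2 * (h 0 * W 0) * (h2 * W 0 + 2 * h1 0 * W1 0 + h 0 * W2 0) + A * B2 0"
  have dz: "(z has_real_derivative z1 t) (at t)" for t
    unfolding z_def z1_def
    by (rule derivative_eq_intros dh dW dB refl)+ (simp add: algebra_simps)
  have dz1: "(z1 has_real_derivative z2) (at 0)"
    unfolding z1_def z2_def
    by (rule derivative_eq_intros dh dh1 dW dW1 dB1 refl)+ (simp add: algebra_simps power2_eq_square)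
  have "isCont W 0" by (rule DERIV_isCont[OF dW])
  then obtain d1 where d1: "d1 > 0" "\<And>t. \<bar>t\<bar> < d1 \<Longrightarrow> \<bar>W t - W 0\<bar> < W 0"
    using gap(1) unfolding isCont_def LIM_def W_def
    by (auto simp: dist_real_def) (metis abs_zero cancel_comm_monoid_add_class.diff_cancel diff_gt_0_iff_gt scale_zero_left add.right_neutral)
  \<comment> \<open>Keeps the segment inside the closed ball of radius \<open>R\<close>.\<close>
  define d2 where "d2 = (R - norm x) / (norm u + 1)"
  have d2: "d2 > 0" using x by (simp add: d2_def add_nonneg_pos)
  have "z2 \<le> 0"
  proof (rule second_derivative_nonpos_at_local_max[OF dz dz1])
    show "0 < min d1 d2" using d1 d2 by simp
    fix t assume t: "\<bar>t\<bar> < min d1 d2"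
    then have "W t > 0" using d1(2)[of t] by (simp add: abs_less_iff)
    moreover have "norm (x + t *\<^sub>R u) \<le> R"
    proof -
      have "norm (x + t *\<^sub>R u) \<le> norm x + \<bar>t\<bar> * norm u"
        by (metis norm_scaleR norm_triangle_ineq)
      also have "\<dots> \<le> norm x + d2 * (norm u + 1)"
        using t d2 by (intro add_left_mono mult_mono) auto
      also have "d2 * (norm u + 1) = R - norm x"
        unfolding d2_def by (simp add: add_nonneg_pos less_imp_neq[THEN not_sym])
      finally show ?thesis by simp
    qed
    ultimately show "z t \<le> z 0"
      using max[of "x + t *\<^sub>R u"] by (simp add: z_def h_def W_def B_def)
  qed
  have W0: "0 < W 0" "W 0 \<le> M" using gap by (auto simp: W_def)
  have h0: "0 < h 0" "h 0 \<le> 1"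
    using x R by (auto simp: h_def \<eta>_def power_strict_mono)
  have Cauchy: "(x \<bullet> u)\<^sup>2 \<le> R\<^sup>2 * (norm u)\<^sup>2"
  proof -
    have "\<bar>x \<bullet> u\<bar> \<le> R * norm u"
      using Cauchy_Schwarz_ineq2[of x u] x by (meson less_imp_le mult_right_mono norm_ge_zero order_trans)
    then show ?thesis
      by (metis abs_ge_zero power2_abs power_mono power_mult_distrib)
  qed
  have "(h1 0)\<^sup>2 = 4 * (x \<bullet> u)\<^sup>2 / (R\<^sup>2 * R\<^sup>2)"
    by (simp add: h1_def k_def power_divide power_mult_distrib power2_eq_square)
  also have "\<dots> \<le> 4 * (R\<^sup>2 * (norm u)\<^sup>2) / (R\<^sup>2 * R\<^sup>2)"
    using Cauchy by (intro divide_right_mono) auto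
  also have "\<dots> = 4 * (norm u)\<^sup>2 / R\<^sup>2"
    using R by (simp add: field_simps power2_eq_square)
  finally have h1: "(h1 0)\<^sup>2 \<le> 4 * (norm u)\<^sup>2 / R\<^sup>2" .
  have W2: "(W 0)\<^sup>2 \<le> M\<^sup>2" using W0 by (intro power_mono) auto
  have a: "6 * ((h1 0)\<^sup>2 * (W 0)\<^sup>2) \<le> 6 * ((4 * (norm u)\<^sup>2 / R\<^sup>2) * M\<^sup>2)"
    using h1 W2 by (intro mult_left_mono mult_mono) auto
  have "h 0 * (W 0)\<^sup>2 * ((norm u)\<^sup>2 / R\<^sup>2) \<le> 1 * M\<^sup>2 * ((norm u)\<^sup>2 / R\<^sup>2)"
    using h0 W2 by (intro mult_right_mono mult_mono) auto
  moreover have "- 2 * h2 * h 0 * (W 0)\<^sup>2 = 4 * (h 0 * (W 0)\<^sup>2 * ((norm u)\<^sup>2 / R\<^sup>2))"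
    by (simp add: h2_def k_def power2_norm_eq_inner)
  moreover have "4 * ((norm u)\<^sup>2 / R\<^sup>2) * M\<^sup>2 = 4 * (1 * M\<^sup>2 * ((norm u)\<^sup>2 / R\<^sup>2))"
    by simp
  ultimately have b: "- 2 * h2 * h 0 * (W 0)\<^sup>2 \<le> 4 * ((norm u)\<^sup>2 / R\<^sup>2) * M\<^sup>2"
    by linarith
  have "z2 = 2 * (h 0 * W1 0 + 2 * (h1 0 * W 0))\<^sup>2 - 6 * ((h1 0)\<^sup>2 * (W 0)\<^sup>2)
      + 2 * h2 * h 0 * (W 0)\<^sup>2 + 2 * (h 0)\<^sup>2 * W 0 * W2 0 + A * B2 0"
    unfolding z2_def by (simp add: power2_eq_square algebra_simps)
  moreover have "0 \<le> 2 * (h 0 * W1 0 + 2 * (h1 0 * W 0))\<^sup>2" by simp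
  ultimately have "2 * (h 0)\<^sup>2 * W 0 * W2 0 + A * B2 0
      \<le> 6 * ((4 * (norm u)\<^sup>2 / R\<^sup>2) * M\<^sup>2) + 4 * ((norm u)\<^sup>2 / R\<^sup>2) * M\<^sup>2"
    using a b \<open>z2 \<le> 0\<close> by linarith
  also have "\<dots> = 28 * M\<^sup>2 / R\<^sup>2 * (norm u)\<^sup>2"
    by (simp add: field_simps)
  finally show ?thesis
    by (simp add: h_def W_def W2_def B2_def v2_def v1_def)
qed

text \<open>Maximum principle on the ball for the squared cut-off excess of the gap over
  \<open>\<delta>\<close> plus \<open>A\<close> times the barrier. At an interior maximum with
  positive excess, the second-order conditions summed over a frame contradict
  \<open>barrier_lower_bound\<close>. Hence the squared term vanishes at the maximum, and comparing
  barrier values bounds it by \<open>6 * A * s\<close> everywhere. As \<open>A\<close> is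
  proportional to \<open>M\<^sup>2 / R\<^sup>2\<close>, taking the root gives the new bound.\<close>

lemma circle_gap_improvement:
  assumes e: "e \<noteq> 0" and \<delta>: "0 < \<delta>"
  obtains K where "0 < K"
    "\<And>R M s x. 0 < R \<Longrightarrow> 0 < M \<Longrightarrow> (\<And>y. norm y \<le> R + 2 * norm (\<iota> e) \<Longrightarrow> \<bar>v y\<bar> \<le> s) \<Longrightarrow>
      (\<And>y. norm y \<le> R \<Longrightarrow> circle_gap (\<iota> e) y \<le> \<delta> + M) \<Longrightarrow> norm x \<le> R / 2 \<Longrightarrow>
      circle_gap (\<iota> e) x \<le> \<delta> + M * sqrt (K * s / R\<^sup>2)"
proof -
  define d where "d = \<iota> e"
  obtain c where c: "c > 0" and barrier: "\<And>x w. frame x e w \<Longrightarrow> \<delta> \<le> circle_gap d x \<Longrightarrow>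
    c * (\<Sum>a\<in>UNIV. (norm (w a))\<^sup>2)
      \<le> (\<Sum>a\<in>UNIV. (norm (w a))\<^sup>2) + disc.avg d (J d) (\<lambda>y. \<Sum>a\<in>UNIV. w a \<bullet> (G y *v w a)) x
        - 2 * real CARD('m)"
    using barrier_lower_bound[OF e \<delta>] unfolding d_def by blast
  show thesis
  \<comment> \<open>\<open>310\<close> rounds up \<open>29 * 6 * 16 / 9\<close>: \<open>29\<close>
    comes from \<open>A\<close>, \<open>6\<close> from the oscillation of the barrier, and
    \<open>16 / 9\<close> from \<open>\<eta> \<ge> 3 / 4\<close> on the half ball.\<close>
  proof (rule that[of "310 / c"])
    show "0 < 310 / c" using c by simp
    fix R M s :: real and x :: 'a
    assume R: "0 < R" and M: "0 < M" and s: "\<And>y. norm y \<le> R + 2 * norm (\<iota> e) \<Longrightarrow> \<bar>v y\<bar> \<le> s"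
      and gapM: "\<And>y. norm y \<le> R \<Longrightarrow> circle_gap (\<iota> e) y \<le> \<delta> + M" and x: "norm x \<le> R / 2"
    \<comment> \<open>\<open>29\<close> exceeds the constant \<open>28\<close> of
      \<open>second_order_condition\<close>, so the barrier strictly dominates the errors of the
      cut-off.\<close>
    define A where "A = 29 * M\<^sup>2 / (c * R\<^sup>2)"
    have A: "A > 0" using M c R by (simp add: A_def)
    have B: "\<bar>barrier d y\<bar> \<le> 3 * s" if "norm y \<le> R" for y
      using that by (intro abs_barrier_bound s) (simp add: d_def)
    define \<eta> where "\<eta> = (\<lambda>y::'a. 1 - (norm y)\<^sup>2 / R\<^sup>2)"
    define Z where "Z y = (\<eta> y * max 0 (circle_gap d y - \<delta>))\<^sup>2 + A * barrier d y" for y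
    have "continuous_on (cball 0 R) Z"
      unfolding Z_def \<eta>_def using R
      by (intro continuous_intros continuous_on_circle_gap continuous_on_barrier) auto
    then obtain p where p: "norm p \<le> R" "\<And>y. norm y \<le> R \<Longrightarrow> Z y \<le> Z p"
      using continuous_attains_sup[of "cball 0 R" Z] R by auto
    have "\<not> (norm p < R \<and> \<delta> < circle_gap d p)"
    proof
      assume p': "norm p < R \<and> \<delta> < circle_gap d p"
      obtain w where w: "frame p e w" using frame_exists[OF e] by blast
      define W where "W = circle_gap d p - \<delta>"
      define Q where "Q = 2 * (\<eta> p)\<^sup>2 * W"
      have Q: "Q \<ge> 0" using p' by (simp add: Q_def W_def)
      have so: "Q * (circle.avg d (J d) (dir_deriv u (dir_deriv u v)) p - dir_deriv u (dir_deriv u v) p)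
        + A * (disc.avg d (J d) (dir_deriv u (dir_deriv u v)) p - 2 * dir_deriv u (dir_deriv u v) p)
        \<le> 28 * M\<^sup>2 / R\<^sup>2 * (norm u)\<^sup>2" for u
        unfolding Q_def W_def \<eta>_def
      proof (rule second_order_condition[OF R])
        fix y assume "norm y \<le> R" "\<delta> < circle_gap d y"
        then show "((1 - (norm y)\<^sup>2 / R\<^sup>2) * (circle_gap d y - \<delta>))\<^sup>2 + A * barrier d y
            \<le> ((1 - (norm p)\<^sup>2 / R\<^sup>2) * (circle_gap d p - \<delta>))\<^sup>2 + A * barrier d p"
          using p(2)[of y] p' by (simp add: Z_def \<eta>_def max_def)
      qed (use p' gapM[of p] in \<open>auto simp: d_def\<close>)
      define CL DL where "CL u = circle.avg d (J d) (\<lambda>y. levi J v y u) p"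
        and "DL u = disc.avg d (J d) (\<lambda>y. levi J v y u) p" for u
      have C: "2 * CL u = circle.avg d (J d) (dir_deriv u (dir_deriv u v)) p
          + circle.avg d (J d) (dir_deriv (J u) (dir_deriv (J u) v)) p" for u
        unfolding CL_def circle.avg_cmult[symmetric] sum_dir_deriv_twice[symmetric]
        by (intro circle.avg_add smooth_continuous_on smooth_dir_deriv smooth_v)
      have D: "2 * DL u = disc.avg d (J d) (dir_deriv u (dir_deriv u v)) p
          + disc.avg d (J d) (dir_deriv (J u) (dir_deriv (J u) v)) p" for u
        unfolding DL_def disc.avg_cmult[symmetric] sum_dir_deriv_twice[symmetric]
        by (intro disc.avg_add smooth_continuous_on smooth_dir_deriv smooth_v)
      \<comment> \<open>Averaging the second-order conditions for \<open>u\<close> and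
        \<open>J u\<close> assembles real second derivatives into Levi forms.\<close>
      have levi_le: "Q * (CL u - levi J v p u) + A * (DL u - 2 * levi J v p u) \<le> 28 * M\<^sup>2 / R\<^sup>2 * (norm u)\<^sup>2" for u
      proof -
        have l: "2 * levi J v p u = dir_deriv u (dir_deriv u v) p + dir_deriv (J u) (dir_deriv (J u) v) p"
          by (simp add: levi_def)
        have "2 * (Q * (CL u - levi J v p u) + A * (DL u - 2 * levi J v p u))
            = Q * (2 * CL u - 2 * levi J v p u) + A * (2 * DL u - 2 * (2 * levi J v p u))"
          by (simp add: algebra_simps)
        also have "\<dots> \<le> 28 * M\<^sup>2 / R\<^sup>2 * (norm u)\<^sup>2 + 28 * M\<^sup>2 / R\<^sup>2 * (norm (J u))\<^sup>2"
          unfolding l C D using add_mono[OF so[of u] so[of "J u"]] by (simp add: algebra_simps)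
        finally show ?thesis by (simp add: norm_J)
      qed
      define N F where "N = real CARD('m)" and "F = (\<Sum>a\<in>UNIV. (norm (w a))\<^sup>2)"
      define S where "S = disc.avg d (J d) (\<lambda>y. \<Sum>a\<in>UNIV. w a \<bullet> (G y *v w a)) p"
      define S' where "S' = circle.avg d (J d) (\<lambda>y. \<Sum>a\<in>UNIV. w a \<bullet> (G y *v w a)) p"
      have S: "S = (\<Sum>a\<in>UNIV. DL (\<iota> (w a))) + F"
        unfolding S_def DL_def F_def by (rule disc_avg_trace_metric)
      have S': "S' = (\<Sum>a\<in>UNIV. CL (\<iota> (w a))) + F"
        unfolding S'_def CL_def F_def by (rule circle_avg_trace_metric)
      have N: "N = (\<Sum>a\<in>UNIV. levi J v p (\<iota> (w a))) + F"
        using trace_metric[of w p] w by (simp add: frame_def N_def F_def)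
      have "N \<le> S'"
      proof -
        have "circle.avg d (J d) (\<lambda>y. N) p \<le> S'"
          unfolding S'_def N_def
          by (rule circle.avg_mono) (intro continuous_intros continuous_on_trace_metric frame_trace_ge[OF w])+
        then show ?thesis by (simp add: circle.avg_const)
      qed
      have FN: "N \<le> F" unfolding F_def N_def by (rule frame_norm_ge[OF w])
      have "N > 0" by (simp add: N_def)
      \<comment> \<open>Trace over the frame. The \<open>Q\<close> term is nonnegative because the
        circle mean of the traces is at least \<open>N\<close>; what remains is
        \<open>29 * M\<^sup>2 / R\<^sup>2 * F\<close> against
        \<open>28 * M\<^sup>2 / R\<^sup>2 * F\<close>.\<close>
      have "(\<Sum>a\<in>UNIV. Q * (CL (\<iota> (w a)) - levi J v p (\<iota> (w a))) + A * (DL (\<iota> (w a)) - 2 * levi J v p (\<iota> (w a))))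
          \<le> (\<Sum>a\<in>UNIV. 28 * M\<^sup>2 / R\<^sup>2 * (norm (\<iota> (w a)))\<^sup>2)"
        by (intro sum_mono levi_le)
      also have "\<dots> = 28 * M\<^sup>2 / R\<^sup>2 * F"
        by (simp add: norm_\<iota> F_def sum_distrib_left)
      also have "(\<Sum>a\<in>UNIV. Q * (CL (\<iota> (w a)) - levi J v p (\<iota> (w a))) + A * (DL (\<iota> (w a)) - 2 * levi J v p (\<iota> (w a))))
          = Q * (S' - N) + A * (F + S - 2 * N)"
        unfolding S S' N by (simp add: sum.distrib sum_subtractf sum_distrib_left[symmetric] algebra_simps)
      finally have "Q * (S' - N) + A * (F + S - 2 * N) \<le> 28 * M\<^sup>2 / R\<^sup>2 * F" .
      moreover have "0 \<le> Q * (S' - N)" using Q \<open>N \<le> S'\<close> by simp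
      moreover have "A * (c * F) \<le> A * (F + S - 2 * N)"
        using A barrier[OF w] p' by (intro mult_left_mono) (auto simp: F_def S_def N_def)
      moreover have "A * (c * F) = 29 * M\<^sup>2 / R\<^sup>2 * F"
        using c by (simp add: A_def)
      moreover have "28 * M\<^sup>2 / R\<^sup>2 * F < 29 * M\<^sup>2 / R\<^sup>2 * F"
        using M R FN \<open>N > 0\<close> by (intro mult_strict_right_mono divide_strict_right_mono) auto
      ultimately show False by linarith
    qed
    \<comment> \<open>Either \<open>p\<close> lies on the sphere of radius \<open>R\<close>, where
      \<open>\<eta>\<close> vanishes, or the gap at \<open>p\<close> is at most
      \<open>\<delta>\<close>.\<close>
    then have "\<eta> p * max 0 (circle_gap d p - \<delta>) = 0"
      using p(1) R by (auto simp: \<eta>_def max_def)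
    then have "Z p \<le> A * (3 * s)"
      using B[OF p(1)] A unfolding Z_def by (simp only: abs_le_iff) simp
    have xR: "norm x \<le> R" using x R by simp
    have "- (3 * s) \<le> barrier d x" using B[OF xR] by (simp add: abs_le_iff)
    then have "A * - (3 * s) \<le> A * barrier d x" using A by (intro mult_left_mono) auto
    then have Zx: "(\<eta> x * max 0 (circle_gap d x - \<delta>))\<^sup>2 \<le> 6 * (A * s)"
      using p(2)[OF xR] \<open>Z p \<le> A * (3 * s)\<close> unfolding Z_def by simp
    define h where "h = max 0 (circle_gap d x - \<delta>)"
    have "(norm x)\<^sup>2 \<le> (R / 2)\<^sup>2" using x by (intro power_mono) auto
    then have "(norm x)\<^sup>2 / R\<^sup>2 \<le> 1 / 4"
      using R by (simp add: field_simps power_divide)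
    then have "3 / 4 \<le> \<eta> x" by (simp add: \<eta>_def)
    then have "(3 / 4 * h)\<^sup>2 \<le> (\<eta> x * h)\<^sup>2"
      by (intro power_mono mult_right_mono) (auto simp: h_def)
    then have "9 * h\<^sup>2 \<le> 96 * (A * s)"
      using Zx unfolding h_def by (simp add: power_mult_distrib power_divide)
    moreover have "0 \<le> s" using s[of 0] R by force
    then have "96 * (A * s) \<le> 9 * (M\<^sup>2 * (310 / c * s / R\<^sup>2))"
      using c R M by (simp add: A_def field_simps)
    ultimately have "h\<^sup>2 \<le> M\<^sup>2 * (310 / c * s / R\<^sup>2)" by simp
    then have "h \<le> sqrt (M\<^sup>2 * (310 / c * s / R\<^sup>2))" by (rule real_le_rsqrt)
    also have "\<dots> = M * sqrt (310 / c * s / R\<^sup>2)" unfolding real_sqrt_mult using M by simp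
    finally show "circle_gap (\<iota> e) x \<le> \<delta> + M * sqrt (310 / c * s / R\<^sup>2)"
      unfolding h_def d_def by simp
  qed
qed

text \<open>Since \<open>v\<close> is small against the square of the radius, passing from the ball
  of radius \<open>2 * R\<close> to that of radius \<open>R\<close> shrinks the excess over
  \<open>\<delta>\<close> by the factor \<open>1 / 8\<close>, while a bound quadratic in the radius
  costs only a factor \<open>4\<close> under doubling. Each round therefore halves the
  bound.\<close>

lemma circle_gap_le:
  assumes e: "e \<noteq> 0" and \<delta>: "0 < \<delta>"
  shows "circle_gap (\<iota> e) x \<le> \<delta>"
proof -
  obtain K where K: "0 < K"
    "\<And>R M s x. 0 < R \<Longrightarrow> 0 < M \<Longrightarrow> (\<And>y. norm y \<le> R + 2 * norm (\<iota> e) \<Longrightarrow> \<bar>v y\<bar> \<le> s) \<Longrightarrow>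
      (\<And>y. norm y \<le> R \<Longrightarrow> circle_gap (\<iota> e) y \<le> \<delta> + M) \<Longrightarrow> norm x \<le> R / 2 \<Longrightarrow>
      circle_gap (\<iota> e) x \<le> \<delta> + M * sqrt (K * s / R\<^sup>2)"
    using circle_gap_improvement[OF e \<delta>] by blast
  \<comment> \<open>Chosen so that \<open>K * (4 * \<epsilon>) = (1 / 8)\<^sup>2\<close>, the number
    under the root in the improvement step.\<close>
  define \<epsilon> where "\<epsilon> = 1 / (K * 256)"
  have \<epsilon>: "\<epsilon> > 0" using K by (simp add: \<epsilon>_def)
  obtain R1 where R1: "\<And>x. R1 \<le> norm x \<Longrightarrow> \<bar>v x\<bar> \<le> \<epsilon> * (norm x)\<^sup>2"
    using growth[OF \<epsilon>] by blast
  have "compact (v ` cball 0 R1)"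
    by (intro compact_continuous_image smooth_continuous_on smooth_v compact_cball)
  then have "bounded (v ` cball 0 R1)" by (rule compact_imp_bounded)
  then obtain C where "\<forall>x\<in>cball 0 R1. \<bar>v x\<bar> \<le> C"
    unfolding bounded_iff by auto
  then have C: "\<bar>v x\<bar> \<le> C" if "norm x \<le> R1" for x
    using that by simp
  \<comment> \<open>From \<open>R0\<close> on, the ball of radius
    \<open>R + 2 * norm (\<iota> e)\<close> lies in that of radius \<open>2 * R\<close>, whence the
    \<open>4\<close> in \<open>v_le\<close>, and the bound \<open>C\<close> near the origin is
    absorbed by \<open>\<epsilon> * R\<^sup>2\<close>.\<close>
  define R0 where "R0 = max (max 1 (2 * norm (\<iota> e))) (sqrt (\<bar>C\<bar> / \<epsilon>))"
  have R0: "1 \<le> R0" "2 * norm (\<iota> e) \<le> R0" "sqrt (\<bar>C\<bar> / \<epsilon>) \<le> R0" by (auto simp: R0_def)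
  have v_le: "\<bar>v y\<bar> \<le> 4 * \<epsilon> * R\<^sup>2" if "R0 \<le> R" "norm y \<le> R + 2 * norm (\<iota> e)" for R y
  proof (cases "norm y \<le> R1")
    case True
    have "\<bar>C\<bar> / \<epsilon> \<le> R\<^sup>2"
      using that(1) R0 \<epsilon> by (metis order_trans real_sqrt_le_iff real_sqrt_abs abs_of_nonneg zero_le_one)
    then have "\<bar>C\<bar> \<le> \<epsilon> * R\<^sup>2" using \<epsilon> by (simp add: field_simps)
    moreover have "0 \<le> \<epsilon> * R\<^sup>2" using \<epsilon> by simp
    ultimately show ?thesis using C[OF True] by linarith
  next
    case False
    have "norm y \<le> 2 * R" using that R0 by linarith
    then have "(norm y)\<^sup>2 \<le> (2 * R)\<^sup>2" by (intro power_mono) auto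
    then have "\<epsilon> * (norm y)\<^sup>2 \<le> \<epsilon> * (4 * R\<^sup>2)"
      using \<epsilon> by (intro mult_left_mono) (auto simp: power_mult_distrib)
    then show ?thesis using R1[of y] False by simp
  qed
  have decay: "R0 \<le> R \<Longrightarrow> norm x \<le> R \<Longrightarrow> circle_gap (\<iota> e) x \<le> \<delta> + 8 * \<epsilon> / 2 ^ k * R\<^sup>2" for k R x
  proof (induction k arbitrary: R x)
    case 0
    have "circle_gap (\<iota> e) x \<le> 2 * (4 * \<epsilon> * R\<^sup>2)"
      using 0 by (intro circle_gap_bound v_le) auto
    then show ?case using \<delta> by simp
  next
    case (Suc k)
    have R: "R > 0" using Suc.prems R0 by linarith
    have *: "K * (4 * \<epsilon> * (2 * R)\<^sup>2) / (2 * R)\<^sup>2 = (1 / 8)\<^sup>2"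
      using K R by (simp add: \<epsilon>_def power2_eq_square)
    have "circle_gap (\<iota> e) x \<le> \<delta> + (8 * \<epsilon> / 2 ^ k * (2 * R)\<^sup>2) * sqrt (K * (4 * \<epsilon> * (2 * R)\<^sup>2) / (2 * R)\<^sup>2)"
    proof (rule K(2))
      show "\<bar>v y\<bar> \<le> 4 * \<epsilon> * (2 * R)\<^sup>2" if "norm y \<le> 2 * R + 2 * norm (\<iota> e)" for y
        using that Suc.prems R by (intro v_le) auto
      show "circle_gap (\<iota> e) y \<le> \<delta> + 8 * \<epsilon> / 2 ^ k * (2 * R)\<^sup>2" if "norm y \<le> 2 * R" for y
        using that Suc.prems R by (intro Suc.IH) auto
    qed (use R \<epsilon> Suc.prems in auto)
    also have "\<dots> = \<delta> + 8 * \<epsilon> / 2 ^ Suc k * R\<^sup>2"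
      unfolding * by (simp add: power_mult_distrib)
    finally show ?case .
  qed
  define R where "R = max R0 (norm x)"
  have "(\<lambda>k. \<delta> + 8 * \<epsilon> * (1 / 2) ^ k * R\<^sup>2) \<longlonglongrightarrow> \<delta> + 8 * \<epsilon> * 0 * R\<^sup>2"
    by (intro tendsto_intros LIMSEQ_power_zero) auto
  moreover have "circle_gap (\<iota> e) x \<le> \<delta> + 8 * \<epsilon> * (1 / 2) ^ k * R\<^sup>2" for k
    using decay[of R x k] by (simp add: R_def power_divide)
  ultimately show ?thesis
    using LIMSEQ_le_const by fastforce
qed

text \<open>A positive Levi form at \<open>x\<close> stays above a constant \<open>c\<close> nearby,
  so by Green's formula the gap for a small multiple \<open>t\<close> of \<open>u\<close> would be
  at least \<open>t\<^sup>2 * c / 2\<close>, although \<open>circle_gap_le\<close> makes it at most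
  \<open>t\<^sup>2 * c / 4\<close>.\<close>

lemma levi_nonpos: "levi J v x u \<le> 0"
proof (rule ccontr)
  assume "\<not> levi J v x u \<le> 0"
  then have pos: "levi J v x u > 0" by simp
  define c where "c = levi J v x u / 2"
  have c: "c > 0" using pos by (simp add: c_def)
  have "isCont (\<lambda>y. levi J v y u) x"
    using continuous_on_levi[OF smooth_v, of UNIV J u] by (simp add: continuous_on_eq_continuous_at)
  then obtain r where r: "r > 0" "\<And>y. norm (y - x) < r \<Longrightarrow> \<bar>levi J v y u - levi J v x u\<bar> < c"
    using c unfolding isCont_def LIM_def dist_norm by (metis diff_self norm_zero real_norm_def abs_zero)
  then have r': "c \<le> levi J v y u" if "norm (y - x) < r" for y
    using r(2)[OF that] by (simp add: c_def abs_if split: if_splits)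
  \<comment> \<open>Keeps the disc, whose points are at distance at most
    \<open>2 * (t * norm u)\<close> from \<open>x\<close>, within the radius
    \<open>r\<close>.\<close>
  define t where "t = r / (2 * norm u + 1)"
  have t: "t > 0" using r by (simp add: t_def add_nonneg_pos)
  have "2 * (t * norm u) < t * (2 * norm u + 1)" using t by (simp add: algebra_simps)
  also have "\<dots> = r" by (simp add: t_def add_nonneg_pos less_imp_neq[THEN not_sym])
  finally have tr: "2 * (t * norm u) < r" .
  have "u \<noteq> 0"
  proof
    assume "u = 0"
    then show False using pos levi_scaleR[of x 0 u] by simp
  qed
  obtain e where e: "\<iota> e = t *\<^sub>R u" using surj_\<iota> by (metis surjD)
  have "e \<noteq> 0" using norm_\<iota>[of e] t \<open>u \<noteq> 0\<close> by (auto simp: e)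
  have "disc.avg (\<iota> e) (J (\<iota> e)) (\<lambda>y. t\<^sup>2 * c) x \<le> disc.avg (\<iota> e) (J (\<iota> e)) (\<lambda>y. levi J v y (\<iota> e)) x"
  proof (rule disc.avg_mono)
    fix p assume "p \<in> param_box"
    then have "norm (disc_path (\<iota> e) (J (\<iota> e)) p) \<le> 2 * (t * norm u)"
      using disc.norm_\<gamma>[of p "\<iota> e" "J (\<iota> e)"] t by (simp add: norm_J e)
    then have "c \<le> levi J v (x + disc_path (\<iota> e) (J (\<iota> e)) p) u"
      using tr by (intro r') simp
    then show "t\<^sup>2 * c \<le> levi J v (x + disc_path (\<iota> e) (J (\<iota> e)) p) (\<iota> e)"
      by (simp add: e levi_scaleR mult_left_mono)
  qed (intro continuous_intros continuous_on_levi smooth_v)+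
  then have "t\<^sup>2 * c \<le> 2 * circle_gap (\<iota> e) x"
    by (simp add: circle_gap_eq disc.avg_const)
  moreover have "circle_gap (\<iota> e) x \<le> t\<^sup>2 * c / 4"
    using t c by (intro circle_gap_le \<open>e \<noteq> 0\<close>) auto
  moreover have "0 < t\<^sup>2 * c" using t c by simp
  ultimately show False by linarith
qed

text \<open>By \<open>levi_nonpos\<close> the metric is at most Euclidean; a strict deficit in one
  direction contradicts determinant \<open>1\<close>, by the frame inequality based at the
  identity.\<close>

theorem levi_eq_0: "levi J v x u = 0"
proof (rule ccontr)
  assume "levi J v x u \<noteq> 0"
  then have neg: "levi J v x u < 0" using levi_nonpos[of x u] by simp
  obtain e where e: "\<iota> e = u" using surj_\<iota> by (metis surjD)
  have "u \<noteq> 0"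
    using neg levi_scaleR[of x 0 u] by auto
  then have "e \<noteq> 0" using norm_\<iota>[of e] by (auto simp: e)
  define N where "N = CARD('m)"
  have N: "N > 0" by (simp add: N_def)
  define \<rho> where "\<rho> = (e \<bullet> (G x *v e)) / (e \<bullet> (mat 1 *v e))"
  have \<rho>: "\<rho> < 1"
    using neg \<open>e \<noteq> 0\<close> by (simp add: \<rho>_def G_levi e power2_norm_eq_inner)
  obtain w :: "'m \<Rightarrow> real ^ 'm" where w: "\<And>a. w a \<bullet> (mat 1 *v w a) = 1"
    "\<And>B k. posdef B \<Longrightarrow> det B = 1 \<Longrightarrow> 0 < k \<Longrightarrow>
      real CARD('m) * k powr (1 / CARD('m)) + (1 - k) * ((e \<bullet> (B *v e)) / (e \<bullet> (mat 1 *v e)))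
        \<le> (\<Sum>a\<in>UNIV. w a \<bullet> (B *v w a))"
    using posdef_frame[OF posdef_mat_1 det_I \<open>e \<noteq> 0\<close>] by blast
  have "(\<Sum>a\<in>UNIV. w a \<bullet> (G x *v w a)) \<le> (\<Sum>a\<in>(UNIV::'m set). 1)"
  proof (rule sum_mono)
    fix a
    have "(norm (w a))\<^sup>2 = 1" using w(1)[of a] by (simp add: power2_norm_eq_inner)
    then show "w a \<bullet> (G x *v w a) \<le> 1" using levi_nonpos[of x "\<iota> (w a)"] by (simp add: G_levi)
  qed
  then have trace: "(\<Sum>a\<in>UNIV. w a \<bullet> (G x *v w a)) \<le> real N" by (simp add: N_def)
  \<comment> \<open>The frame inequality with \<open>k = (1 + \<tau>) ^ N\<close> would force
    \<open>?f \<tau> \<le> 0\<close>, but \<open>?f\<close> vanishes at \<open>0\<close> with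
    positive slope \<open>N * (1 - \<rho>)\<close>.\<close>
  let ?f = "\<lambda>\<tau>. real N * \<tau> + (1 - (1 + \<tau>) ^ N) * \<rho>"
  have "(?f has_real_derivative (real N - real N * \<rho>)) (at 0)"
    by (auto intro!: derivative_eq_intros)
  moreover have "0 < real N - real N * \<rho>" using N \<rho> by simp
  ultimately obtain d where d: "d > 0" "\<And>h. 0 < h \<Longrightarrow> h < d \<Longrightarrow> ?f 0 < ?f (0 + h)"
    using DERIV_pos_inc_right[of ?f "real N - real N * \<rho>" 0] by blast
  define \<tau> where "\<tau> = d / 2"
  have \<tau>: "0 < \<tau>" "0 < ?f \<tau>" using d(1) d(2)[of \<tau>] by (auto simp: \<tau>_def)
  have "((1 + \<tau>) ^ N) powr (1 / real N) = 1 + \<tau>"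
    using \<tau>(1) N by (simp add: powr_powr flip: powr_realpow)
  then have "real N * (1 + \<tau>) + (1 - (1 + \<tau>) ^ N) * \<rho> \<le> real N"
    using w(2)[OF posdef_G det_G, of "(1 + \<tau>) ^ N" x] \<tau>(1) trace
    unfolding N_def[symmetric] \<rho>_def[symmetric] by simp
  then show False using \<tau>(2) by (simp add: algebra_simps)
qed

end

section \<open>Determinants and bounded harmonic functions\<close>

text \<open>A permutation other than the identity moves at least two indices, so its product keeps a
  vanishing off-diagonal factor even after one factor has been differentiated.\<close>

lemma has_derivative_det_at_mat_1:
  fixes M :: "'a::real_normed_vector \<Rightarrow> real ^ 'n::finite ^ 'n"
  assumes M: "\<And>i j. ((\<lambda>y. M y $ i $ j) has_derivative (\<lambda>h. M' h $ i $ j)) (at x)" and Mx: "M x = mat 1"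
  shows "((\<lambda>y. det (M y)) has_derivative (\<lambda>h. trace (M' h))) (at x)"
proof -
  have "((\<lambda>y. det (M y)) has_derivative
      (\<lambda>h. \<Sum>p | p permutes UNIV. of_int (sign p) * (\<Sum>i\<in>UNIV. M' h $ i $ p i * (\<Prod>j\<in>UNIV - {i}. M x $ j $ p j)))) (at x)"
    unfolding det_def by (intro has_derivative_sum has_derivative_mult_right has_derivative_prod M)
  moreover have "(\<Sum>p | p permutes UNIV. of_int (sign p) * (\<Sum>i\<in>UNIV. M' h $ i $ p i * (\<Prod>j\<in>UNIV - {i}. M x $ j $ p j)))
      = trace (M' h)" for h
  proof -
    have zero: "(\<Prod>j\<in>UNIV - {i}. M x $ j $ p j) = 0" if p: "p permutes UNIV" "p \<noteq> id" for p and i :: 'n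
    proof -
      obtain k where k: "p k \<noteq> k" using p(2) by (auto simp: fun_eq_iff)
      have "\<exists>j. j \<noteq> i \<and> p j \<noteq> j"
      proof (cases "k = i")
        case True
        have "p (p k) \<noteq> p k" using p(1) k by (metis permutes_inverses(2))
        then show ?thesis using True k by metis
      qed (use k in blast)
      then obtain j where "j \<in> UNIV - {i}" "M x $ j $ p j = 0"
        by (auto simp: Mx mat_def)
      then show ?thesis
        by (intro prod_zero) auto
    qed
    have "(\<Sum>p | p permutes (UNIV::'n set). of_int (sign p) * (\<Sum>i\<in>UNIV. M' h $ i $ p i * (\<Prod>j\<in>UNIV - {i}. M x $ j $ p j)))
      = (\<Sum>p\<in>{id}. of_int (sign p) * (\<Sum>i\<in>UNIV. M' h $ i $ p i * (\<Prod>j\<in>UNIV - {i}. M x $ j $ p j)))"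
      by (rule sum.mono_neutral_right) (auto simp: zero permutes_id finite_permutations)
    also have "\<dots> = trace (M' h)"
      by (simp add: sign_id Mx mat_def trace_def)
    finally show ?thesis .
  qed
  ultimately show ?thesis by simp
qed

lemma matrix_inv_inverse:
  fixes A :: "real ^ 'n::finite ^ 'n"
  assumes "det A \<noteq> 0"
  shows "A ** matrix_inv A = mat 1" "matrix_inv A ** A = mat 1"
proof -
  have "\<exists>B. A ** B = mat 1 \<and> B ** A = mat 1"
    using assms invertible_det_nz[of A] unfolding invertible_def by blast
  then show "A ** matrix_inv A = mat 1" "matrix_inv A ** A = mat 1"
    unfolding matrix_inv_def by (metis (mono_tags, lifting) someI_ex)+
qed

text \<open>Jacobi's formula, reduced to the identity matrix by multiplying with the constant
  inverse of \<open>A x\<close>.\<close>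

lemma has_derivative_det:
  fixes A :: "'a::real_normed_vector \<Rightarrow> real ^ 'n::finite ^ 'n"
  assumes A: "\<And>i j. ((\<lambda>y. A y $ i $ j) has_derivative (\<lambda>h. A' h $ i $ j)) (at x)" and nz: "det (A x) \<noteq> 0"
  shows "((\<lambda>y. det (A y)) has_derivative (\<lambda>h. det (A x) * trace (matrix_inv (A x) ** A' h))) (at x)"
proof -
  let ?B = "matrix_inv (A x)"
  have "((\<lambda>y. det (?B ** A y)) has_derivative (\<lambda>h. trace (?B ** A' h))) (at x)"
    by (rule has_derivative_det_at_mat_1)
      (auto simp: matrix_matrix_mult_def matrix_inv_inverse[OF nz, unfolded matrix_matrix_mult_def]
        intro!: has_derivative_sum has_derivative_mult_right A)
  then have "((\<lambda>y. det (A x) * det (?B ** A y)) has_derivative (\<lambda>h. det (A x) * trace (?B ** A' h))) (at x)"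
    by (rule has_derivative_mult_right)
  moreover have "det (A x) * det (?B ** A y) = det (A y)" for y
  proof -
    have "det (A x) * det ?B = 1"
      using arg_cong[OF matrix_inv_inverse(1)[OF nz], of det] by (simp add: det_mul)
    then show ?thesis by (simp add: det_mul mult.assoc[symmetric])
  qed
  ultimately show ?thesis by simp
qed

text \<open>Cramer's rule. It displays the entries of the inverse as quotients of determinants,
  which makes their differentiability evident.\<close>

lemma matrix_inv_entry:
  fixes A :: "real ^ 'n::finite ^ 'n"
  assumes "det A \<noteq> 0"
  shows "matrix_inv A $ c $ d = det (\<chi> i j. if j = c then axis d 1 $ i else A $ i $ j) / det A"
proof -
  have "A *v (matrix_inv A *v axis d 1) = axis d 1"
    by (simp add: matrix_vector_mul_assoc matrix_inv_inverse[OF assms])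
  then have "matrix_inv A *v axis d 1 = (\<chi> k. det (\<chi> i j. if j = k then axis d 1 $ i else A $ i $ j) / det A)"
    using cramer[OF assms] by blast
  then have "(matrix_inv A *v axis d 1) $ c = det (\<chi> i j. if j = c then axis d 1 $ i else A $ i $ j) / det A"
    by simp
  then show ?thesis
    by (simp add: matrix_vector_mult_basis column_def)
qed

lemma differentiable_det:
  fixes A :: "'a::real_normed_vector \<Rightarrow> real ^ 'n::finite ^ 'n"
  assumes "\<And>i j. (\<lambda>y. A y $ i $ j) differentiable (at x)"
  shows "(\<lambda>y. det (A y)) differentiable (at x)"
proof -
  have "\<exists>F. \<forall>i j. ((\<lambda>y. A y $ i $ j) has_derivative F i j) (at x)"
    using assms unfolding differentiable_def by metis
  then obtain F where F: "\<And>i j. ((\<lambda>y. A y $ i $ j) has_derivative F i j) (at x)" by blast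
  show ?thesis
    unfolding det_def differentiable_def
    by (rule exI, rule has_derivative_sum, rule has_derivative_mult_right, rule has_derivative_prod, rule F)
qed

lemma differentiable_matrix_inv:
  fixes A :: "'a::real_normed_vector \<Rightarrow> real ^ 'n::finite ^ 'n"
  assumes A: "\<And>i j. (\<lambda>y. A y $ i $ j) differentiable (at x)" and nz: "\<And>y. det (A y) \<noteq> 0"
  shows "(\<lambda>y. matrix_inv (A y) $ c $ d) differentiable (at x)"
  unfolding matrix_inv_entry[OF nz]
proof (intro differentiable_divide differentiable_det nz A)
  show "(\<lambda>y. (\<chi> i j. if j = c then axis d 1 $ i else A y $ i $ j) $ i $ j) differentiable (at x)" for i j
    using A by (cases "j = c") auto
qed

text \<open>The hypotheses contain the Cauchy-Riemann equations for
  \<open>F = k1 - \<i> * k2\<close>. A primitive \<open>P\<close> of \<open>F\<close> has real part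
  \<open>k\<close> up to a constant, so \<open>exp P\<close> is bounded and, by Liouville's theorem,
  constant; hence \<open>F = 0\<close>.\<close>

lemma bounded_harmonic_gradient_eq_0:
  fixes k k1 k2 a b :: "complex \<Rightarrow> real"
  assumes k: "\<And>z. (k has_derivative (\<lambda>h. Re h * k1 z + Im h * k2 z)) (at z)"
    and k1: "\<And>z. (k1 has_derivative (\<lambda>h. Re h * a z + Im h * b z)) (at z)"
    and k2: "\<And>z. (k2 has_derivative (\<lambda>h. Re h * b z - Im h * a z)) (at z)"
    and bound: "\<And>z. k z \<le> C"
  shows "k1 z = 0 \<and> k2 z = 0"
proof -
  define F where "F z = Complex (k1 z) (- k2 z)" for z
  have F: "F = (\<lambda>z. of_real (k1 z) - \<i> * of_real (k2 z))"
    by (auto simp: F_def complex_eq_iff)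
  have dF: "(F has_field_derivative Complex (a z) (- b z)) (at z)" for z
  proof -
    have "(F has_derivative (\<lambda>h. of_real (Re h * a z + Im h * b z) - \<i> * of_real (Re h * b z - Im h * a z))) (at z)"
      unfolding F by (intro has_derivative_diff has_derivative_mult_right has_derivative_of_real k1 k2)
    moreover have "(\<lambda>h. of_real (Re h * a z + Im h * b z) - \<i> * of_real (Re h * b z - Im h * a z)) = (*) (Complex (a z) (- b z))"
      by (auto simp: complex_eq_iff algebra_simps)
    ultimately show ?thesis by (simp add: has_field_derivative_def)
  qed
  then have "F holomorphic_on UNIV"
    by (auto simp: holomorphic_on_def field_differentiable_def)
  then obtain P where P: "\<And>z. (P has_field_derivative F z) (at z)"
    using holomorphic_convex_primitive'[of UNIV F] by auto
  have "((\<lambda>z. Re (P z) - k z) has_derivative (\<lambda>h. 0)) (at z within UNIV)" for z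
  proof -
    have "((\<lambda>z. Re (P z) - k z) has_derivative (\<lambda>h. Re (F z * h) - (Re h * k1 z + Im h * k2 z))) (at z)"
      using P[of z] unfolding has_field_derivative_def by (intro has_derivative_diff has_derivative_Re k)
    then show ?thesis by (simp add: F_def algebra_simps)
  qed
  then obtain c where c: "\<And>z. Re (P z) - k z = c"
    using has_derivative_zero_constant[of UNIV "\<lambda>z. Re (P z) - k z"] by auto
  have dexp: "((\<lambda>z. exp (P z)) has_field_derivative exp (P z) * F z) (at z)" for z
    by (rule DERIV_chain2[OF DERIV_exp P])
  have "norm (exp (P z)) \<le> exp (C + c)" for z
    using c[of z] bound[of z] by simp
  then have "bounded (range (\<lambda>z. exp (P z)))"
    by (auto simp: bounded_iff)
  moreover have "(\<lambda>z. exp (P z)) holomorphic_on UNIV"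
    using dexp by (auto simp: holomorphic_on_def field_differentiable_def)
  ultimately obtain q where "\<And>z. exp (P z) = q"
    using Liouville_theorem by (metis constant_on_def UNIV_I)
  then have "((\<lambda>z. exp (P z)) has_field_derivative 0) (at z)"
    by simp
  then have "exp (P z) * F z = 0"
    using dexp DERIV_unique by blast
  then have "F z = 0" by simp
  then show ?thesis by (simp add: F_def complex_eq_iff)
qed

section \<open>Ricci curvature of a Kaehler metric\<close>

text \<open>Together with \<open>rot_sign\<close> this describes the complex structure: it sends the
  coordinate vector of index \<open>a\<close> to \<open>rot_sign a\<close> times that of index
  \<open>rot a\<close>.\<close>

definition rot :: "'n + 'n \<Rightarrow> 'n + 'n" where "rot = case_sum Inr Inl"

definition rot_sign :: "'n + 'n \<Rightarrow> real" where "rot_sign = case_sum (\<lambda>_. 1) (\<lambda>_. - 1)"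

lemma rot_rot [simp]: "rot (rot a) = a"
  by (cases a) (auto simp: rot_def)

lemma rot_eq_iff [simp]: "rot a = rot b \<longleftrightarrow> a = b"
  by (metis rot_rot)

lemma rot_sign_rot [simp]: "rot_sign (rot a) = - rot_sign a"
  by (cases a) (auto simp: rot_def rot_sign_def)

lemma rot_sign_square [simp]: "rot_sign a * rot_sign a = 1" "rot_sign a * (rot_sign a * x) = x"
  by (cases a; simp add: rot_sign_def)+

lemma rot_sign_cases: "rot_sign a = 1 \<or> rot_sign a = - 1"
  by (cases a) (auto simp: rot_sign_def)

lemma sum_rot: "(\<Sum>a\<in>UNIV. f (rot a)) = (\<Sum>a\<in>(UNIV :: ('n::finite + 'n) set). f a)"
  by (rule sum.reindex_bij_witness[of _ rot rot]) auto

lemma sum_UNIV_sum: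
  "(\<Sum>a\<in>(UNIV :: ('a::finite + 'b::finite) set). f a) = (\<Sum>j\<in>UNIV. f (Inl j)) + (\<Sum>j\<in>UNIV. f (Inr j))"
  using sum.Plus[of "UNIV :: 'a set" "UNIV :: 'b set" f] by (simp add: comp_def)

lemma sum_UNIV_sum_sum:
  "(\<Sum>a\<in>(UNIV :: ('a::finite + 'b::finite) set). \<Sum>b\<in>(UNIV :: ('c::finite + 'd::finite) set). F a b)
    = (\<Sum>j\<in>UNIV. \<Sum>k\<in>UNIV. F (Inl j) (Inl k)) + (\<Sum>j\<in>UNIV. \<Sum>k\<in>UNIV. F (Inl j) (Inr k))
     + (\<Sum>j\<in>UNIV. \<Sum>k\<in>UNIV. F (Inr j) (Inl k)) + (\<Sum>j\<in>UNIV. \<Sum>k\<in>UNIV. F (Inr j) (Inr k))"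
  by (simp add: sum_UNIV_sum sum.distrib add_ac)

lemma cstruct_entry: "cstruct $ c $ b = (if c = rot b then rot_sign b else 0)"
  by (cases b; cases c) (auto simp: cstruct_def rot_def rot_sign_def)

lemma cstruct_congruence_entry:
  "(transpose cstruct ** M ** cstruct) $ a $ b = rot_sign a * rot_sign b * M $ rot a $ rot b"
proof -
  have *: "(\<Sum>k\<in>UNIV. (if k = rot a then rot_sign a else 0) * M $ k $ j) = rot_sign a * M $ rot a $ j" for j
    by (simp add: mult_delta_left)
  show ?thesis
    by (simp add: matrix_matrix_mult_def transpose_def cstruct_entry mult_delta_right *)
qed

lemma orthogonal_matrix_cstruct: "orthogonal_matrix (cstruct :: real ^ ('n::finite + 'n) ^ ('n + 'n))"
  unfolding orthogonal_matrix
proof -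
  let ?C = "cstruct :: real ^ ('n + 'n) ^ ('n + 'n)"
  have "(transpose ?C ** mat 1 ** ?C) $ a $ b = mat 1 $ a $ b" for a b
    unfolding cstruct_congruence_entry by (simp add: mat_def)
  then show "transpose ?C ** ?C = mat 1"
    by (simp add: vec_eq_iff)
qed

section \<open>Real coordinates, real and complex Hessians\<close>

definition of_coords :: "real ^ ('n::finite + 'n) \<Rightarrow> complex ^ 'n" where
  "of_coords y = (\<chi> j. Complex (y $ Inl j) (y $ Inr j))"

lemma of_coords_eq:
  fixes y :: "real ^ ('n::finite + 'n)"
  shows "of_coords y = (\<Sum>a\<in>UNIV. y $ a *\<^sub>R coord_vec a)"
proof -
  have 1: "(\<Sum>k\<in>UNIV. y $ Inl k *\<^sub>R (axis k 1 :: complex ^ 'n) $ j) = of_real (y $ Inl j)" for j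
    by (simp add: axis_def if_distrib cong: if_cong) (simp add: scaleR_conv_of_real)
  have 2: "(\<Sum>k\<in>UNIV. y $ Inr k *\<^sub>R (axis k \<i> :: complex ^ 'n) $ j) = of_real (y $ Inr j) * \<i>" for j
    by (simp add: axis_def if_distrib cong: if_cong) (simp add: scaleR_conv_of_real)
  show ?thesis
    unfolding vec_eq_iff of_coords_def sum_UNIV_sum
    by (simp add: 1 2 complex_eq_iff)
qed

lemma norm_of_coords: "norm (of_coords y) = norm y"
  by (simp add: norm_vec_def L2_set_def of_coords_def sum_UNIV_sum cmod_power2 sum.distrib)

lemma surj_of_coords: "surj of_coords"
proof (rule surjI)
  show "of_coords (\<chi> a. case a of Inl j \<Rightarrow> Re (z $ j) | Inr j \<Rightarrow> Im (z $ j)) = z" for z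
    by (simp add: of_coords_def vec_eq_iff)
qed

lemma of_coords_cstruct: "of_coords (cstruct *v y) = \<i> *s of_coords y"
proof -
  have 1: "(cstruct *v y) $ rot b = rot_sign b * y $ b" for b
    by (simp add: matrix_vector_mult_def cstruct_entry mult_delta_left)
  have "(cstruct *v y) $ Inl j = - (y $ Inr j)" "(cstruct *v y) $ Inr j = y $ Inl j" for j
    using 1[of "Inr j"] 1[of "Inl j"] by (auto simp: rot_def rot_sign_def)
  then show ?thesis
    by (simp add: of_coords_def vec_eq_iff complex_eq_iff)
qed

lemma smooth_coord_deriv: "smooth f \<Longrightarrow> smooth (coord_deriv a f)"
  unfolding coord_deriv_def by (rule smooth_dir_deriv)

lemma coord_deriv_commute:
  fixes f :: "complex ^ 'n::finite \<Rightarrow> real"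
  shows "smooth f \<Longrightarrow> coord_deriv a (coord_deriv b f) = coord_deriv b (coord_deriv a f)"
  unfolding coord_deriv_def by (rule ext) (rule dir_deriv_commute)

lemma dir_deriv_of_coords:
  assumes "f differentiable (at x)"
  shows "dir_deriv (of_coords y) f x = (\<Sum>a\<in>UNIV. y $ a *\<^sub>R coord_deriv a f x)"
proof -
  have lin: "linear (\<lambda>v. dir_deriv v f x)"
    using differentiable_has_derivative_dir_deriv[OF assms] has_derivative_linear by blast
  show ?thesis
    unfolding of_coords_eq coord_deriv_def by (simp add: linear_sum[OF lin] linear_scale[OF lin])
qed

lemma real_hessian_form:
  assumes f: "smooth f"
  shows "y \<bullet> (real_hessian f x *v y) = dir_deriv (of_coords y) (dir_deriv (of_coords y) f) x"
proof -
  have "dir_deriv (of_coords y) f = (\<lambda>x. \<Sum>a\<in>UNIV. y $ a * coord_deriv a f x)"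
    using dir_deriv_of_coords[OF smooth_differentiable[OF f]] by auto
  moreover have "((\<lambda>x. \<Sum>a\<in>UNIV. y $ a * coord_deriv a f x) has_derivative
      (\<lambda>v. \<Sum>a\<in>UNIV. y $ a * dir_deriv v (coord_deriv a f) x)) (at x)"
    by (intro has_derivative_sum has_derivative_mult_right smooth_has_derivative smooth_coord_deriv f)
  ultimately have "dir_deriv (of_coords y) (dir_deriv (of_coords y) f) x
      = (\<Sum>a\<in>UNIV. y $ a * dir_deriv (of_coords y) (coord_deriv a f) x)"
    by (simp add: dir_deriv_eqI)
  also have "\<dots> = (\<Sum>a\<in>UNIV. y $ a * (\<Sum>b\<in>UNIV. y $ b * coord_deriv a (coord_deriv b f) x))"
    by (simp add: dir_deriv_of_coords[OF smooth_differentiable[OF smooth_coord_deriv[OF f]]]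
        coord_deriv_commute[OF f])
  also have "\<dots> = y \<bullet> (real_hessian f x *v y)"
    by (simp add: inner_vec_def matrix_vector_mult_def real_hessian_def mult.commute)
  finally show ?thesis ..
qed

lemma complex_hessian_entry:
  assumes f: "smooth f"
  shows "complex_hessian f x $ j $ k =
    (of_real (real_hessian f x $ Inl j $ Inl k + real_hessian f x $ Inr j $ Inr k)
      + \<i> * of_real (real_hessian f x $ Inl j $ Inr k - real_hessian f x $ Inr j $ Inl k)) / 4"
proof -
  have 1: "coord_deriv a (\<lambda>y. complex_of_real (f y)) = (\<lambda>y. of_real (coord_deriv a f y))" for a
    unfolding coord_deriv_def
    by (intro ext dir_deriv_eqI has_derivative_of_real smooth_has_derivative f)
  have 2: "wirtinger_bar k (\<lambda>y. complex_of_real (f y)) = (\<lambda>y. (of_real (coord_deriv (Inl k) f y) + \<i> * of_real (coord_deriv (Inr k) f y)) / 2)" for k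
    by (auto simp: wirtinger_bar_def 1)
  have "((\<lambda>y. (complex_of_real (coord_deriv (Inl k) f y) + \<i> * of_real (coord_deriv (Inr k) f y)) / 2) has_derivative
      (\<lambda>v. (of_real (dir_deriv v (coord_deriv (Inl k) f) x) + \<i> * of_real (dir_deriv v (coord_deriv (Inr k) f) x)) / 2)) (at x)" for k
    by (intro bounded_linear.has_derivative[OF bounded_linear_divide] has_derivative_add has_derivative_mult_right
        has_derivative_of_real smooth_has_derivative smooth_coord_deriv f)
  then have 3: "coord_deriv a (\<lambda>y. (complex_of_real (coord_deriv (Inl k) f y) + \<i> * of_real (coord_deriv (Inr k) f y)) / 2) x
     = (of_real (coord_deriv a (coord_deriv (Inl k) f) x) + \<i> * of_real (coord_deriv a (coord_deriv (Inr k) f) x)) / 2" for a k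
    unfolding coord_deriv_def[of a] by (rule dir_deriv_eqI)
  show ?thesis
    unfolding complex_hessian_def wirtinger_def 2
    by (simp add: 3 real_hessian_def complex_eq_iff)
qed

text \<open>Turns strict plurisubharmonicity into positivity of a real matrix; for a Kaehler
  potential the right-hand side is half the metric form of \<open>y\<close>.\<close>

lemma complex_hessian_form:
  fixes f :: "complex ^ 'n::finite \<Rightarrow> real" and y :: "real ^ ('n + 'n)"
  assumes f: "smooth f"
  shows "Re (\<Sum>j\<in>UNIV. \<Sum>k\<in>UNIV. complex_hessian f x $ j $ k * of_coords y $ j * cnj (of_coords y $ k))
    = (y \<bullet> ((real_hessian f x + transpose cstruct ** real_hessian f x ** cstruct) *v y)) / 4"
proof -
  define h :: "'n + 'n \<Rightarrow> 'n + 'n \<Rightarrow> real" where "h a b = real_hessian f x $ a $ b" for a b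
  define F :: "'n + 'n \<Rightarrow> 'n + 'n \<Rightarrow> real"
    where "F a b = y $ a * ((h a b + rot_sign a * rot_sign b * h (rot a) (rot b)) * y $ b)" for a b
  have entry: "Re (complex_hessian f x $ j $ k * of_coords y $ j * cnj (of_coords y $ k))
    = (F (Inl j) (Inl k) + F (Inl j) (Inr k) + F (Inr j) (Inl k) + F (Inr j) (Inr k)) / 4" for j k :: 'n
  proof -
    define A B where "A = h (Inl j) (Inl k) + h (Inr j) (Inr k)" and "B = h (Inl j) (Inr k) - h (Inr j) (Inl k)"
    have "complex_hessian f x $ j $ k = Complex (A / 4) (B / 4)"
      unfolding complex_hessian_entry[OF f] h_def[symmetric] A_def[symmetric] B_def[symmetric]
      by (simp add: complex_eq_iff)
    then have "Re (complex_hessian f x $ j $ k * of_coords y $ j * cnj (of_coords y $ k))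
      = (A * (y $ Inl j * y $ Inl k + y $ Inr j * y $ Inr k) + B * (y $ Inl j * y $ Inr k - y $ Inr j * y $ Inl k)) / 4"
      by (simp add: of_coords_def field_simps)
    then show ?thesis
      by (simp add: A_def B_def F_def rot_def rot_sign_def algebra_simps)
  qed
  have "Re (\<Sum>j\<in>UNIV. \<Sum>k\<in>UNIV. complex_hessian f x $ j $ k * of_coords y $ j * cnj (of_coords y $ k))
    = (\<Sum>j\<in>UNIV. \<Sum>k\<in>UNIV. (F (Inl j) (Inl k) + F (Inl j) (Inr k) + F (Inr j) (Inl k) + F (Inr j) (Inr k)) / 4)"
    unfolding Re_sum entry ..
  also have "\<dots> = (\<Sum>a\<in>UNIV. \<Sum>b\<in>UNIV. F a b) / 4"
    by (simp add: sum_UNIV_sum_sum sum_divide_distrib[symmetric] sum.distrib)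
  also have "\<dots> = (y \<bullet> ((real_hessian f x + transpose cstruct ** real_hessian f x ** cstruct) *v y)) / 4"
    by (simp add: F_def h_def inner_vec_def matrix_vector_mult_def cstruct_congruence_entry sum_distrib_left)
  finally show ?thesis .
qed

text \<open>A continuous density exceeding \<open>C\<close> at one point exceeds some
  \<open>m > C\<close> on a ball, which has positive finite measure.\<close>

lemma density_le_imp_le:
  fixes f :: "'a::euclidean_space \<Rightarrow> real"
  assumes f: "continuous_on UNIV f" and C: "0 < C"
    and le: "\<And>A. A \<in> sets lborel \<Longrightarrow>
      emeasure (density lborel (\<lambda>x. ennreal (f x))) A \<le> ennreal C * emeasure lborel A"
  shows "f x \<le> C"
proof (rule ccontr)
  assume "\<not> f x \<le> C"
  define m where "m = (f x + C) / 2"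
  have m: "C < m" "m < f x" using \<open>\<not> f x \<le> C\<close> by (auto simp: m_def)
  have "open {y. m < f y}" by (intro open_Collect_less f continuous_on_const)
  moreover have "x \<in> {y. m < f y}" using m by simp
  ultimately obtain r where r: "r > 0" "ball x r \<subseteq> {y. m < f y}"
    unfolding open_contains_ball by blast
  let ?e = "measure lborel (ball x r)"
  have "emeasure lborel (ball x r) \<noteq> \<infinity>"
    using emeasure_lborel_ball_finite[of x r] by (rule less_imp_neq)
  then have e: "emeasure lborel (ball x r) = ennreal ?e"
    by (simp add: emeasure_eq_ennreal_measure)
  have e': "0 < ?e" using content_ball_pos[OF r(1), of x] by simp
  have [measurable]: "f \<in> borel_measurable borel"
    using f by (rule borel_measurable_continuous_onI)
  have "ennreal m * emeasure lborel (ball x r) = (\<integral>\<^sup>+ y. ennreal m * indicator (ball x r) y \<partial>lborel)"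
    by (simp add: nn_integral_cmult_indicator)
  also have "\<dots> \<le> (\<integral>\<^sup>+ y. ennreal (f y) * indicator (ball x r) y \<partial>lborel)"
  proof (intro nn_integral_mono)
    fix y
    have "m \<le> f y" if "y \<in> ball x r" using r(2) that by (auto intro: less_imp_le)
    then show "ennreal m * indicator (ball x r) y \<le> ennreal (f y) * indicator (ball x r) y"
      by (simp add: indicator_def ennreal_leI)
  qed
  also have "\<dots> = emeasure (density lborel (\<lambda>x. ennreal (f x))) (ball x r)"
    by (subst emeasure_density) auto
  also have "\<dots> \<le> ennreal C * emeasure lborel (ball x r)"
    by (rule le) simp
  finally have "ennreal (m * ?e) \<le> ennreal (C * ?e)"
    using m C e' unfolding e by (simp add: ennreal_mult)
  then have "m * ?e \<le> C * ?e"
    using C e' by (subst (asm) ennreal_le_iff) auto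
  then show False using m e' by simp
qed

lemma det_scaleR: "det (c *\<^sub>R A) = c ^ CARD('n) * det (A :: real ^ 'n::finite ^ 'n)"
proof -
  have "c *\<^sub>R A = (\<chi> i. c *s A $ i)"
    by (simp add: vec_eq_iff)
  then show ?thesis
    using det_rows_mul[of "\<lambda>_. c" "\<lambda>i. A $ i"] by simp
qed

text \<open>Polarisation.\<close>

lemma matrix_eq_mat_1_if_quadratic_form:
  fixes A :: "real ^ 'n::finite ^ 'n"
  assumes sym: "transpose A = A" and form: "\<And>y. y \<bullet> (A *v y) = (norm y)\<^sup>2"
  shows "A = mat 1"
proof -
  have symf: "x \<bullet> (A *v y) = y \<bullet> (A *v x)" for x y
    by (metis sym dot_lmul_matrix transpose_matrix_vector inner_commute)
  have "x \<bullet> (A *v y) = x \<bullet> y" for x y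
  proof -
    have "(x + y) \<bullet> (A *v (x + y)) = x \<bullet> (A *v x) + y \<bullet> (A *v y) + 2 * (x \<bullet> (A *v y))"
      by (simp add: matrix_vector_right_distrib inner_add_left inner_add_right symf[of y x])
    then show ?thesis
      unfolding form power2_norm_eq_inner by (simp add: inner_add_left inner_add_right inner_commute)
  qed
  then show ?thesis
    by (simp add: vec_eq_iff diag_entry_eq[of A] mat_def inner_axis_axis)
qed

lemma levi_affine:
  assumes f: "smooth f" and J: "\<And>w. norm (J w) = norm w"
  shows "levi J (\<lambda>x. c * f x - (norm x)\<^sup>2 / 2) x w = c * levi J f x w - (norm w)\<^sup>2"
proof -
  have "iter_deriv [w, w] (\<lambda>x. c * f x - (norm x)\<^sup>2 / 2) x = c * iter_deriv [w, w] f x - (norm w)\<^sup>2" for w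
  proof -
    have "iter_deriv [w, w] (\<lambda>x. c * f x - (norm x)\<^sup>2 / 2)
        = (\<lambda>x. iter_deriv [w, w] (\<lambda>x. c * f x) x - iter_deriv [w, w] (\<lambda>x. (norm x)\<^sup>2 / 2) x)"
      by (intro iter_deriv_diff smooth_bounded_linear[OF bounded_linear_mult_right f] smooth_half_norm_sq)
    also have "iter_deriv [w, w] (\<lambda>x. c * f x) = (\<lambda>x. c * iter_deriv [w, w] f x)"
      by (rule iter_deriv_bounded_linear[OF bounded_linear_mult_right f])
    also have "iter_deriv [w, w] (\<lambda>x. (norm x)\<^sup>2 / 2) = (\<lambda>x. (norm w)\<^sup>2)"
      by (simp add: dir_deriv_half_norm_sq dir_deriv_inner dot_square_norm)
    finally show ?thesis by simp
  qed
  from this[of w] this[of "J w"] show ?thesis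
    by (simp add: levi_def J field_simps)
qed

lemma linear_mult_i: "linear ((*s) \<i> :: complex ^ 'n::finite \<Rightarrow> complex ^ 'n)"
  by (rule linearI) (simp_all add: vec_eq_iff algebra_simps)

lemma norm_mult_i: "norm (\<i> *s w) = norm (w :: complex ^ 'n::finite)"
  by (simp add: norm_vec_def norm_mult)

section \<open>Christoffel symbols, Ricci curvature and the logarithm of the determinant\<close>

locale kaehler_metric =
  fixes \<phi> :: "complex ^ 'n::finite \<Rightarrow> real" and g :: "complex ^ 'n \<Rightarrow> real ^ ('n + 'n) ^ ('n + 'n)"
  assumes kaehler: "kaehler_potential \<phi> g"
begin

lemma smooth_potential: "smooth \<phi>"
  using kaehler by (simp add: kaehler_potential_def)

lemma g_eq: "g x = (1/2) *\<^sub>R (real_hessian \<phi> x + transpose cstruct ** real_hessian \<phi> x ** cstruct)"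
  using kaehler by (simp add: kaehler_potential_def)

lemma g_entry: "g x $ a $ b = (coord_deriv a (coord_deriv b \<phi>) x
    + rot_sign a * rot_sign b * coord_deriv (rot a) (coord_deriv (rot b) \<phi>) x) / 2"
  unfolding g_eq by (simp add: cstruct_congruence_entry real_hessian_def)

lemma g_form: "y \<bullet> (g x *v y) = levi ((*s) \<i>) \<phi> x (of_coords y)"
  unfolding g_eq levi_def
  by (simp add: scaleR_matrix_vector_assoc[symmetric] matrix_vector_mult_add_rdistrib inner_add_right
      quadratic_form_congruence real_hessian_form[OF smooth_potential] of_coords_cstruct)

lemma g_sym: "g x $ a $ b = g x $ b $ a"
  by (simp add: g_entry coord_deriv_commute[OF smooth_potential, of a] coord_deriv_commute[OF smooth_potential, of "rot a"])

lemma posdef_g: "posdef (g x)"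
  unfolding posdef_def
proof (intro conjI allI impI)
  show "transpose (g x) = g x"
    by (simp add: vec_eq_iff transpose_def g_sym)
  fix y :: "real ^ ('n + 'n)" assume "y \<noteq> 0"
  then have "of_coords y \<noteq> 0" using norm_of_coords[of y] by force
  then have "0 < (y \<bullet> ((real_hessian \<phi> x + transpose cstruct ** real_hessian \<phi> x ** cstruct) *v y)) / 4"
    using kaehler unfolding complex_hessian_form[OF smooth_potential, symmetric] kaehler_potential_def strictly_psh_def
    by blast
  then show "0 < y \<bullet> (g x *v y)"
    unfolding g_eq by (simp add: scaleR_matrix_vector_assoc[symmetric])
qed

lemma det_g_pos: "0 < det (g x)"
  by (rule posdef_det_pos[OF posdef_g])

definition third :: "'n + 'n \<Rightarrow> 'n + 'n \<Rightarrow> 'n + 'n \<Rightarrow> complex ^ 'n \<Rightarrow> real" where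
  "third a b c = coord_deriv a (coord_deriv b (coord_deriv c \<phi>))"

lemma smooth_third: "smooth (third a b c)"
  unfolding third_def by (intro smooth_coord_deriv smooth_potential)

lemma third_commute: "third a b c = third b a c" "third a b c = third a c b"
  unfolding third_def
  by (rule coord_deriv_commute[OF smooth_coord_deriv[OF smooth_potential]])
    (simp only: coord_deriv_commute[OF smooth_potential, of b c])

lemma g_has_derivative:
  "((\<lambda>y. g y $ a $ b) has_derivative (\<lambda>v. (dir_deriv v (coord_deriv a (coord_deriv b \<phi>)) x
    + rot_sign a * rot_sign b * dir_deriv v (coord_deriv (rot a) (coord_deriv (rot b) \<phi>)) x) / 2)) (at x)"
  unfolding g_entry
  by (intro bounded_linear.has_derivative[OF bounded_linear_divide] has_derivative_add has_derivative_mult_right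
      smooth_has_derivative smooth_coord_deriv smooth_potential)

lemma g_differentiable: "(\<lambda>y. g y $ a $ b) differentiable (at x)"
  using g_has_derivative by (auto simp: differentiable_def)

definition dg :: "'n + 'n \<Rightarrow> 'n + 'n \<Rightarrow> 'n + 'n \<Rightarrow> complex ^ 'n \<Rightarrow> real" where
  "dg c a b = coord_deriv c (\<lambda>y. g y $ a $ b)"

lemma dg_eq: "dg c a b x = (third c a b x + rot_sign a * rot_sign b * third c (rot a) (rot b) x) / 2"
  unfolding dg_def third_def coord_deriv_def[of c] by (rule dir_deriv_eqI[OF g_has_derivative])

lemma dg_sym: "dg c a b x = dg c b a x"
  by (simp add: dg_eq third_commute(2)[of c a] third_commute(2)[of c "rot a"])

lemma dg_differentiable: "dg c a b differentiable (at x)"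
proof -
  have "dg c a b = (\<lambda>x. (third c a b x + rot_sign a * rot_sign b * third c (rot a) (rot b) x) / 2)"
    by (auto simp: dg_eq)
  then show ?thesis
    by (simp add: smooth_differentiable[OF smooth_third])
qed

definition ginv :: "'n + 'n \<Rightarrow> 'n + 'n \<Rightarrow> complex ^ 'n \<Rightarrow> real" where
  "ginv c d x = matrix_inv (g x) $ c $ d"

lemma det_g_nonzero: "det (g x) \<noteq> 0"
  using det_g_pos[of x] by simp

lemma ginv_differentiable: "ginv c d differentiable (at x)"
  unfolding ginv_def[abs_def] by (intro differentiable_matrix_inv g_differentiable det_g_nonzero)

lemma matrix_inv_g_unique: "g x ** B = mat 1 \<Longrightarrow> B = matrix_inv (g x)"
  by (metis matrix_inv_inverse[OF det_g_nonzero] matrix_mul_assoc matrix_mul_lid matrix_mul_rid)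

lemma ginv_sym: "ginv c d x = ginv d c x"
proof -
  have "transpose (g x) = g x" by (simp add: vec_eq_iff transpose_def g_sym)
  then have "g x ** transpose (matrix_inv (g x)) = mat 1"
    by (metis matrix_transpose_mul matrix_inv_inverse(2)[OF det_g_nonzero] transpose_mat)
  then have "transpose (matrix_inv (g x)) = matrix_inv (g x)"
    by (rule matrix_inv_g_unique)
  then have "transpose (matrix_inv (g x)) $ c $ d = matrix_inv (g x) $ c $ d"
    by simp
  then show ?thesis
    by (simp add: ginv_def transpose_def)
qed

text \<open>The metric is invariant under the complex structure, which is orthogonal; uniqueness of
  the inverse passes the invariance on.\<close>

lemma ginv_rot: "rot_sign c * rot_sign d * ginv (rot c) (rot d) x = ginv c d x"
proof -
  let ?C = "cstruct :: real ^ ('n + 'n) ^ ('n + 'n)"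
  have C: "transpose ?C ** ?C = mat 1" "?C ** transpose ?C = mat 1"
    using orthogonal_matrix_cstruct by (auto simp: orthogonal_matrix_def)
  have gC: "transpose ?C ** g x ** ?C = g x"
    unfolding vec_eq_iff cstruct_congruence_entry by (simp add: g_entry algebra_simps)
  have "g x ** (transpose ?C ** matrix_inv (g x) ** ?C)
      = transpose ?C ** g x ** (?C ** transpose ?C) ** matrix_inv (g x) ** ?C"
    by (subst gC[symmetric]) (simp only: matrix_mul_assoc)
  also have "\<dots> = transpose ?C ** (g x ** matrix_inv (g x)) ** ?C"
    unfolding C by (simp add: matrix_mul_assoc)
  also have "\<dots> = mat 1"
    by (simp add: matrix_inv_inverse[OF det_g_nonzero] C)
  finally have "transpose ?C ** matrix_inv (g x) ** ?C = matrix_inv (g x)"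
    by (rule matrix_inv_g_unique)
  then have "(transpose ?C ** matrix_inv (g x) ** ?C) $ c $ d = matrix_inv (g x) $ c $ d"
    by simp
  then show ?thesis
    unfolding cstruct_congruence_entry ginv_def .
qed

abbreviation \<Gamma> :: "'n + 'n \<Rightarrow> 'n + 'n \<Rightarrow> 'n + 'n \<Rightarrow> complex ^ 'n \<Rightarrow> real" where
  "\<Gamma> \<equiv> christoffel g"

text \<open>Twice the Christoffel symbol of the first kind.\<close>

definition lower :: "'n + 'n \<Rightarrow> 'n + 'n \<Rightarrow> 'n + 'n \<Rightarrow> complex ^ 'n \<Rightarrow> real" where
  "lower d a b x = dg a b d x + dg b a d x - dg d a b x"

lemma christoffel_eq: "\<Gamma> c a b x = (1/2) * (\<Sum>d\<in>UNIV. ginv c d x * lower d a b x)"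
  by (simp add: christoffel_def ginv_def lower_def dg_def)

lemma christoffel_differentiable: "\<Gamma> c a b differentiable (at x)"
proof -
  have *: "\<Gamma> c a b = (\<lambda>x. (1/2) * (\<Sum>d\<in>UNIV. ginv c d x * (dg a b d x + dg b a d x - dg d a b x)))"
    by (auto simp: christoffel_eq lower_def)
  show ?thesis
    unfolding *
    by (intro differentiable_mult differentiable_const differentiable_sum differentiable_add differentiable_diff
        ginv_differentiable dg_differentiable finite ballI)
qed

lemma christoffel_sym: "\<Gamma> c a b = \<Gamma> c b a"
  by (auto simp: christoffel_eq lower_def add.commute dg_sym[of _ a b])

text \<open>The Kaehler condition enters here: the metric comes from a potential, whose third
  derivatives are symmetric in all indices.\<close>

lemma lower_rot: "lower d a (rot b) x = - rot_sign b * rot_sign d * lower (rot d) a b x"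
proof -
  note S = third_commute
  show ?thesis
    unfolding lower_def dg_eq
    using rot_sign_cases[of a] rot_sign_cases[of b] rot_sign_cases[of d]
    by (elim disjE) (simp_all add: field_simps S)
qed

text \<open>The connection is complex linear in each argument because the complex structure is parallel.\<close>

lemma christoffel_rot: "\<Gamma> c a (rot b) x = - rot_sign b * rot_sign c * \<Gamma> (rot c) a b x"
proof -
  have inv: "rot_sign d * ginv c (rot d) x = - rot_sign c * ginv (rot c) d x" for d
    using ginv_rot[of "rot c" d x] rot_sign_cases[of c] by auto
  have "(\<Sum>d\<in>UNIV. ginv c d x * lower d a (rot b) x)
      = (\<Sum>d\<in>UNIV. ginv c (rot d) x * lower (rot d) a (rot b) x)"
    by (rule sum_rot[symmetric])
  also have "\<dots> = (\<Sum>d\<in>UNIV. rot_sign b * (rot_sign d * ginv c (rot d) x) * lower d a b x)"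
    by (intro sum.cong refl) (simp add: lower_rot)
  also have "\<dots> = - rot_sign b * rot_sign c * (\<Sum>d\<in>UNIV. ginv (rot c) d x * lower d a b x)"
    unfolding inv sum_distrib_left by (intro sum.cong refl) simp
  finally show ?thesis
    by (simp add: christoffel_eq)
qed

text \<open>Complex linearity in both lower arguments, the square of the complex structure being
  \<open>-1\<close>.\<close>

lemma christoffel_rot_rot: "\<Gamma> c (rot b) (rot b) = (\<lambda>x. - \<Gamma> c b b x)"
proof
  fix x
  have "\<Gamma> c (rot b) (rot b) x = - rot_sign b * rot_sign c * \<Gamma> (rot c) b (rot b) x"
    by (simp add: christoffel_rot[of c] christoffel_sym[of _ "rot b" b])
  also have "\<dots> = - \<Gamma> c b b x"
    using rot_sign_cases[of b] rot_sign_cases[of c] by (auto simp: christoffel_rot[of "rot c"])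
  finally show "\<Gamma> c (rot b) (rot b) x = - \<Gamma> c b b x" .
qed

definition log_det :: "complex ^ 'n \<Rightarrow> real" where
  "log_det x = ln (det (g x))"

lemma log_det_has_derivative:
  "(log_det has_derivative (\<lambda>v. \<Sum>a\<in>UNIV. \<Sum>d\<in>UNIV. ginv a d x * dir_deriv v (\<lambda>y. g y $ d $ a) x)) (at x)"
proof -
  have *: "((\<lambda>y. g y $ a $ b) has_derivative (\<lambda>v. (\<chi> i j. dir_deriv v (\<lambda>y. g y $ i $ j) x) $ a $ b)) (at x)" for a b
    using differentiable_has_derivative_dir_deriv[OF g_differentiable] by simp
  have "((\<lambda>y. ln (det (g y))) has_derivative
      (\<lambda>v. inverse (det (g x)) * (det (g x) * trace (matrix_inv (g x) ** (\<chi> i j. dir_deriv v (\<lambda>y. g y $ i $ j) x))))) (at x)"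
    using has_derivative_ln[OF det_g_pos has_derivative_det[OF * det_g_nonzero]]
    by (simp add: mult.commute)
  then have "((\<lambda>y. ln (det (g y))) has_derivative
      (\<lambda>v. trace (matrix_inv (g x) ** (\<chi> i j. dir_deriv v (\<lambda>y. g y $ i $ j) x)))) (at x)"
    using det_g_nonzero[of x] by (simp add: mult.assoc[symmetric])
  then show ?thesis
    by (simp add: log_det_def[abs_def] trace_def matrix_matrix_mult_def ginv_def)
qed

lemma log_det_differentiable: "log_det differentiable (at x)"
  using log_det_has_derivative by (auto simp: differentiable_def)

text \<open>In the contracted Christoffel symbol two of the three terms of \<open>lower\<close>
  cancel by symmetry; the third is Jacobi's formula.\<close>

lemma coord_deriv_log_det: "coord_deriv b log_det = (\<lambda>x. 2 * (\<Sum>a\<in>UNIV. \<Gamma> a a b x))"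
proof
  fix x
  have "(\<Sum>a\<in>UNIV. \<Sum>d\<in>UNIV. ginv a d x * dg a b d x) = (\<Sum>a\<in>UNIV. \<Sum>d\<in>UNIV. ginv a d x * dg d a b x)"
    by (subst sum.swap) (intro sum.cong refl, simp add: ginv_sym dg_sym[of _ b])
  then have "2 * (\<Sum>a\<in>UNIV. \<Gamma> a a b x) = (\<Sum>a\<in>UNIV. \<Sum>d\<in>UNIV. ginv a d x * dg b a d x)"
    by (simp add: christoffel_eq lower_def sum_divide_distrib[symmetric] sum.distrib sum_subtractf distrib_left right_diff_distrib)
  moreover have "coord_deriv b log_det x = (\<Sum>a\<in>UNIV. \<Sum>d\<in>UNIV. ginv a d x * dg b d a x)"
    unfolding coord_deriv_def by (subst dir_deriv_eqI[OF log_det_has_derivative]) (simp add: dg_def coord_deriv_def)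
  ultimately show "coord_deriv b log_det x = 2 * (\<Sum>a\<in>UNIV. \<Gamma> a a b x)"
    by (simp add: dg_sym[of b])
qed

lemma coord_deriv_log_det_differentiable: "coord_deriv b log_det differentiable (at x)"
  unfolding coord_deriv_log_det
  by (intro differentiable_mult differentiable_const differentiable_sum finite ballI christoffel_differentiable)

lemma coord_deriv_twice_log_det:
  "coord_deriv b (coord_deriv b log_det) x = 2 * (\<Sum>a\<in>UNIV. coord_deriv b (\<Gamma> a a b) x)"
proof -
  have "((\<lambda>x. 2 * (\<Sum>a\<in>UNIV. \<Gamma> a a b x)) has_derivative (\<lambda>v. 2 * (\<Sum>a\<in>UNIV. dir_deriv v (\<Gamma> a a b) x))) (at x)"
    by (intro has_derivative_mult_right has_derivative_sum differentiable_has_derivative_dir_deriv christoffel_differentiable)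
  then show ?thesis
    unfolding coord_deriv_log_det unfolding coord_deriv_def by (rule dir_deriv_eqI)
qed

text \<open>Of the terms of the diagonal Ricci entry, \<open>D\<close>, \<open>U\<close> and
  \<open>T\<close> change sign when \<open>b\<close> is replaced by \<open>rot b\<close>. In the sum
  only the derivatives of \<open>log_det\<close> survive, and they form its Laplacian along a
  complex coordinate line.\<close>

lemma ricci_diagonal:
  "ricci g x $ b $ b + ricci g x $ rot b $ rot b
    = - (coord_deriv b (coord_deriv b log_det) x + coord_deriv (rot b) (coord_deriv (rot b) log_det) x) / 2"
proof -
  define T where "T b = (\<Sum>a\<in>UNIV. \<Sum>e\<in>UNIV. \<Gamma> a b e x * \<Gamma> e a b x)" for b
  define U where "U b = (\<Sum>a\<in>UNIV. \<Sum>e\<in>UNIV. \<Gamma> a a e x * \<Gamma> e b b x)" for b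
  define D where "D b = (\<Sum>a\<in>UNIV. coord_deriv a (\<Gamma> a b b) x)" for b
  have ric: "ricci g x $ b $ b = D b - coord_deriv b (coord_deriv b log_det) x / 2 + U b - T b" for b
    by (simp add: ricci_def riemann_curv_def coord_deriv_twice_log_det T_def U_def D_def sum.distrib sum_subtractf)
  have "coord_deriv a (\<lambda>x. - \<Gamma> a b b x) x = - coord_deriv a (\<Gamma> a b b) x" for a
    unfolding coord_deriv_def
    by (rule dir_deriv_eqI[OF has_derivative_minus[OF differentiable_has_derivative_dir_deriv[OF christoffel_differentiable]]])
  then have "D (rot b) = - D b"
    by (simp add: D_def christoffel_rot_rot sum_negf)
  moreover have "U (rot b) = - U b"
    by (simp add: U_def christoffel_rot_rot sum_negf)
  moreover have "T (rot b) = - T b"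
  proof -
    \<comment> \<open>Complex linearity moves the rotation from \<open>b\<close> to the summation
      index \<open>a\<close>; reindexing by \<open>rot\<close> then restores
      \<open>T b\<close>.\<close>
    have "\<Gamma> a (rot b) e x * \<Gamma> e a (rot b) x = - (\<Gamma> (rot a) b e x * \<Gamma> e (rot a) b x)" for a e
    proof -
      have 1: "\<Gamma> a (rot b) e x = - rot_sign b * rot_sign a * \<Gamma> (rot a) b e x"
        by (simp add: christoffel_sym[of _ _ e] christoffel_rot)
      have 2: "\<Gamma> e a (rot b) x = rot_sign b * rot_sign a * \<Gamma> e (rot a) b x"
        using christoffel_rot[of e a b x] christoffel_rot[of e b a x] rot_sign_cases[of a] rot_sign_cases[of b]
          rot_sign_cases[of e]
        by (auto simp: christoffel_sym[of "rot e" a b] christoffel_sym[of e "rot a" b])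
      show ?thesis
        unfolding 1 2 using rot_sign_cases[of a] rot_sign_cases[of b] by auto
    qed
    then have "T (rot b) = - (\<Sum>a\<in>UNIV. \<Sum>e\<in>UNIV. \<Gamma> (rot a) b e x * \<Gamma> e (rot a) b x)"
      by (simp add: T_def sum_negf)
    also have "\<dots> = - T b"
      unfolding T_def by (subst sum_rot[of "\<lambda>a. \<Sum>e\<in>UNIV. \<Gamma> a b e x * \<Gamma> e a b x"]) simp
    finally show ?thesis .
  qed
  ultimately show ?thesis
    by (simp add: ric)
qed

lemma has_derivative_complex_line:
  fixes f :: "complex ^ 'n \<Rightarrow> real" and x :: "complex ^ 'n" and j :: 'n
  assumes f: "\<And>y. f differentiable (at y)"
  defines "p \<equiv> \<lambda>z. x + Re z *\<^sub>R coord_vec (Inl j) + Im z *\<^sub>R coord_vec (Inr j)"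
  shows "((\<lambda>z. f (p z)) has_derivative
    (\<lambda>h. Re h * coord_deriv (Inl j) f (p z) + Im h * coord_deriv (Inr j) f (p z))) (at z)"
proof -
  note D = differentiable_has_derivative_dir_deriv[OF f]
  have "(p has_derivative (\<lambda>h. Re h *\<^sub>R coord_vec (Inl j) + Im h *\<^sub>R coord_vec (Inr j))) (at z)"
    unfolding p_def
    by (auto intro!: derivative_eq_intros bounded_linear_imp_has_derivative bounded_linear_Re bounded_linear_Im
        simp del: coord_vec.simps)
  from has_derivative_compose[OF this D] show ?thesis
    by (simp add: linear_add[OF has_derivative_linear[OF D]] linear_scale[OF has_derivative_linear[OF D]]
        coord_deriv_def del: coord_vec.simps)
qed

text \<open>Along every complex coordinate line \<open>log_det\<close> is harmonic, by
  \<open>ricci_diagonal\<close>, and bounded above, so its gradient vanishes.\<close>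

lemma log_det_constant:
  assumes flat: "ricci_flat g" and bound: "\<And>x. log_det x \<le> C"
  shows "log_det x = log_det y"
proof -
  have "coord_deriv (Inl j) log_det x = 0 \<and> coord_deriv (Inr j) log_det x = 0" for j x
  proof -
    define p where "p z = x + Re z *\<^sub>R coord_vec (Inl j) + Im z *\<^sub>R coord_vec (Inr j)" for z
    let ?k1 = "coord_deriv (Inl j) log_det" and ?k2 = "coord_deriv (Inr j) log_det"
    have mixed: "coord_deriv (Inl j) ?k2 y = coord_deriv (Inr j) ?k1 y" for y
      unfolding coord_deriv_def
      by (intro dir_deriv_commute_at log_det_differentiable coord_deriv_log_det_differentiable[unfolded coord_deriv_def])
    have harmonic: "coord_deriv (Inr j) ?k2 y = - coord_deriv (Inl j) ?k1 y" for y
      using ricci_diagonal[of y "Inl j"] flat by (simp add: ricci_flat_def rot_def)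
    have "?k1 (p 0) = 0 \<and> ?k2 (p 0) = 0"
    proof (rule bounded_harmonic_gradient_eq_0[where k = "\<lambda>z. log_det (p z)" and ?k1.0 = "\<lambda>z. ?k1 (p z)"
          and ?k2.0 = "\<lambda>z. ?k2 (p z)" and a = "\<lambda>z. coord_deriv (Inl j) ?k1 (p z)"
          and b = "\<lambda>z. coord_deriv (Inr j) ?k1 (p z)"])
      fix z
      show "((\<lambda>z. log_det (p z)) has_derivative (\<lambda>h. Re h * ?k1 (p z) + Im h * ?k2 (p z))) (at z)"
        unfolding p_def by (rule has_derivative_complex_line[OF log_det_differentiable])
      show "((\<lambda>z. ?k1 (p z)) has_derivative
          (\<lambda>h. Re h * coord_deriv (Inl j) ?k1 (p z) + Im h * coord_deriv (Inr j) ?k1 (p z))) (at z)"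
        unfolding p_def by (rule has_derivative_complex_line[OF coord_deriv_log_det_differentiable])
      show "((\<lambda>z. ?k2 (p z)) has_derivative
          (\<lambda>h. Re h * coord_deriv (Inr j) ?k1 (p z) - Im h * coord_deriv (Inl j) ?k1 (p z))) (at z)"
        using has_derivative_complex_line[OF coord_deriv_log_det_differentiable, of "Inr j" x j z]
        unfolding p_def[symmetric] mixed harmonic by simp
      show "log_det (p z) \<le> C" by (rule bound)
    qed
    then show ?thesis by (simp add: p_def)
  qed
  then have grad: "coord_deriv a log_det x = 0" for a x
    by (cases a) auto
  have "(log_det has_derivative (\<lambda>v. 0)) (at x within UNIV)" for x
  proof -
    have "dir_deriv v log_det x = 0" for v
    proof -
      obtain y where "v = of_coords y" using surj_of_coords by (metis surjD)
      then show ?thesis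
        by (simp add: dir_deriv_of_coords[OF log_det_differentiable] grad)
    qed
    then show ?thesis
      using differentiable_has_derivative_dir_deriv[OF log_det_differentiable, of x] by simp
  qed
  then show ?thesis
    using has_derivative_zero_constant[of UNIV log_det] by auto
qed

text \<open>The rescaled metric has determinant \<open>1\<close> and fits
  \<open>monge_ampere\<close>. There \<open>levi_eq_0\<close> makes its quadratic form
  Euclidean.\<close>

lemma rescaled_g_eq_mat_1:
  assumes c: "0 < c" and det: "\<And>x. c ^ CARD('n + 'n) * det (g x) = 1"
    and growth: "\<And>\<epsilon>. 0 < \<epsilon> \<Longrightarrow> \<exists>R. \<forall>x. R \<le> norm x \<longrightarrow> \<bar>c * \<phi> x - (norm x)\<^sup>2 / 2\<bar> \<le> \<epsilon> * (norm x)\<^sup>2"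
  shows "c *\<^sub>R g x = mat 1"
proof -
  have form: "y \<bullet> ((c *\<^sub>R g x) *v y) = levi ((*s) \<i>) (\<lambda>x. c * \<phi> x - (norm x)\<^sup>2 / 2) x (of_coords y) + (norm y)\<^sup>2" for x y
    by (simp add: levi_affine[OF smooth_potential norm_mult_i] norm_of_coords g_form scaleR_matrix_vector_assoc[symmetric])
  have pos: "posdef (c *\<^sub>R g x)" for x
    using posdef_g[of x] c by (auto simp: posdef_def scaleR_matrix_vector_assoc[symmetric] transpose_def vec_eq_iff)
  interpret monge_ampere "\<lambda>x. c * \<phi> x - (norm x)\<^sup>2 / 2" "(*s) \<i>" of_coords "\<lambda>x. c *\<^sub>R g x"
  proof (rule monge_ampere.intro)
    show "smooth (\<lambda>x. c * \<phi> x - (norm x)\<^sup>2 / 2)"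
      by (intro smooth_diff smooth_bounded_linear[OF bounded_linear_mult_right smooth_potential] smooth_half_norm_sq)
    show "det (c *\<^sub>R g x) = 1" for x
      using det[of x] by (simp add: det_scaleR)
    show "linear ((*s) \<i> :: complex ^ 'n \<Rightarrow> complex ^ 'n)"
      by (rule linear_mult_i)
  qed (use growth pos form in \<open>auto simp: norm_mult_i norm_of_coords surj_of_coords\<close>)
  show ?thesis
    using pos[of x] by (intro matrix_eq_mat_1_if_quadratic_form) (auto simp: posdef_def form levi_eq_0)
qed

end

section \<open>Normalising the volume and applying the rigidity result\<close>

theorem corollary1p2:
  fixes \<phi> :: "complex ^ 'n::finite \<Rightarrow> real"
    and g :: "complex ^ 'n \<Rightarrow> real ^ ('n + 'n) ^ ('n + 'n)"
  assumes "kaehler_potential \<phi> g"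
    and "ricci_flat g"
    and "\<exists>C>0. \<forall>A\<in>sets lborel.
           ennreal (1 / C) * emeasure lborel A \<le> emeasure (riemannian_volume g) A \<and>
           emeasure (riemannian_volume g) A \<le> ennreal C * emeasure lborel A"
    and "(\<lambda>x. \<phi> x -
            (measure (riemannian_volume g) (ball 0 1) / measure lborel (ball (0 :: complex ^ 'n) 1))
              powr (1 / real CARD('n)) * ((norm x)\<^sup>2 / 2))
          \<in> o[at_infinity](\<lambda>x. (norm x)\<^sup>2)"
  shows "\<forall>x. ((measure lborel (ball (0 :: complex ^ 'n) 1) / measure (riemannian_volume g) (ball 0 1))
              powr (1 / real CARD('n))) *\<^sub>R g x = mat 1"
proof
  fix x
  interpret kaehler_metric \<phi> g by unfold_locales (rule assms(1))
  obtain C where C: "C > 0" "\<And>A. A \<in> sets lborel \<Longrightarrow>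
      emeasure (riemannian_volume g) A \<le> ennreal C * emeasure lborel A"
    using assms(3) by blast
  have "continuous_on UNIV (\<lambda>x. sqrt (det (g x)))"
    by (intro continuous_on_real_sqrt continuous_at_imp_continuous_on ballI differentiable_imp_continuous_within
        differentiable_det g_differentiable)
  then have sqrt_le: "sqrt (det (g x)) \<le> C" for x
    using C(2) unfolding riemannian_volume_def by (rule density_le_imp_le[OF _ C(1)])
  have "log_det x \<le> ln (C\<^sup>2)" for x
  proof -
    have "det (g x) \<le> C\<^sup>2" using sqrt_le[of x] real_sqrt_le_iff[of "det (g x)" "C\<^sup>2"] C(1) by simp
    then show ?thesis using det_g_pos[of x] C(1) by (simp add: log_det_def)
  qed
  then have "ln (det (g y)) = ln (det (g 0))" for y
    using log_det_constant[OF assms(2)] unfolding log_det_def by blast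
  then have det_eq: "det (g y) = det (g 0)" for y
    using det_g_pos by simp
  \<comment> \<open>The constant volume density, hence also the ratio of the two volumes of the unit
    ball.\<close>
  define s where "s = sqrt (det (g 0))"
  have sqrt_det: "sqrt (det (g y)) = s" for y
    unfolding s_def by (rule arg_cong[OF det_eq])
  have s: "s > 0" using det_g_pos by (simp add: s_def)
  define m where "m = measure lborel (ball (0 :: complex ^ 'n) 1)"
  have m: "m > 0" unfolding m_def using content_ball_pos[of 1 "0 :: complex ^ 'n"] by simp
  have "emeasure (riemannian_volume g) (ball 0 1) = ennreal s * emeasure lborel (ball (0 :: complex ^ 'n) 1)"
    unfolding riemannian_volume_def sqrt_det by (simp add: emeasure_density_const)
  then have vol: "measure (riemannian_volume g) (ball 0 1) = s * m"
    using s by (simp add: measure_def m_def enn2real_mult)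
  define l where "l = s powr (1 / real CARD('n))"
  have l: "l > 0" using s by (simp add: l_def)
  have ratio: "(measure (riemannian_volume g) (ball 0 1) / m) powr (1 / real CARD('n)) = l"
    unfolding vol l_def using m by simp
  have ratio': "(m / measure (riemannian_volume g) (ball 0 1)) powr (1 / real CARD('n)) = 1 / l"
    unfolding vol l_def using m s by (simp add: powr_divide)
  have "(1 / l) *\<^sub>R g x = mat 1"
  proof (rule rescaled_g_eq_mat_1)
    show "0 < 1 / l" using l by simp
    fix y
    \<comment> \<open>The exponent is the complex dimension. In the real dimension the power of
      \<open>l\<close> is \<open>s\<^sup>2\<close>, which is the determinant of the metric.\<close>
    have "l ^ CARD('n) = s"
      using s by (simp add: l_def powr_powr flip: powr_realpow)
    then have "l ^ CARD('n + 'n) = det (g y)"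
      using det_g_pos[of 0] by (simp add: power_add s_def det_eq[of y])
    then show "(1 / l) ^ CARD('n + 'n) * det (g y) = 1"
      using l det_g_pos[of y] by (simp add: power_divide)
  next
    fix \<epsilon> :: real assume "0 < \<epsilon>"
    then have "eventually (\<lambda>x. norm (\<phi> x - l * ((norm x)\<^sup>2 / 2)) \<le> (\<epsilon> * l) * norm ((norm x)\<^sup>2)) at_infinity"
      using landau_o.smallD[OF assms(4), of "\<epsilon> * l"] l unfolding m_def[symmetric] ratio by simp
    then obtain R where R: "\<And>x. R \<le> norm x \<Longrightarrow> \<bar>\<phi> x - l * ((norm x)\<^sup>2 / 2)\<bar> \<le> \<epsilon> * l * (norm x)\<^sup>2"
      by (auto simp: eventually_at_infinity)
    have "\<bar>1 / l * \<phi> x - (norm x)\<^sup>2 / 2\<bar> \<le> \<epsilon> * (norm x)\<^sup>2" if "R \<le> norm x" for x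
    proof -
      have "1 / l * \<phi> x - (norm x)\<^sup>2 / 2 = (\<phi> x - l * ((norm x)\<^sup>2 / 2)) / l"
        using l by (simp add: field_simps)
      then show ?thesis
        using R[OF that] l by (simp add: pos_divide_le_eq mult_ac)
    qed
    then show "\<exists>R. \<forall>x. R \<le> norm x \<longrightarrow> \<bar>1 / l * \<phi> x - (norm x)\<^sup>2 / 2\<bar> \<le> \<epsilon> * (norm x)\<^sup>2"
      by blast
  qed
  then show "((measure lborel (ball (0 :: complex ^ 'n) 1) / measure (riemannian_volume g) (ball 0 1))
              powr (1 / real CARD('n))) *\<^sub>R g x = mat 1"
    unfolding m_def[symmetric] ratio' .
qed

end
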